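(* Let $R$ be a commutative Noetherian ring with $1\neq 0$, let $\mathbf{x}=x_1,\ldots,x_n$ be an $R$-regular sequence, and let $I$ be an ideal of $R$. Let $\mathcal S$ be a Serre subcategory of the category of all $R$-modules. If $$\operatorname{Ext}_R^i\bigl(R/(\mathbf x),H_I^j(R)\bigr)\in\mathcal S\quad\text{for all integers } i,j\geq 0,$$ then $$H_I^j\bigl(R/(\mathbf x)\bigr)\in\mathcal S\quad\text{for all integers } j\geq 0.$$
   Context: $(\mathbf x)$ denotes the ideal of $R$ generated by $x_1,\ldots,x_n$. For an $R$-module $M$, $\Gamma_I(M)=\{x\in M\mid I^t x=0\text{ for some }t\geq 0\}$, and the $i$-th local cohomology module of $M$ with respect to $I$ is $H_I^i(M)=H^i(\Gamma_I(E^\bullet))$, where $E^\bullet$ is an injective resolution of $M$. A subcategory (class of modules) $\mathcal S$ of the category of all $R$-modules is called a Serre subcategory if for every exact sequence $0\to M\to N\to L\to 0$ of $R$-modules one has $N\in\mathcal S$ if and only if both $M\in\mathcal S$ and $L\in\mathcal S$. *)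

theory Defs
  imports "HOL-Algebra.Algebra" "HOL-Library.Equipollence"
begin

text \<open>
  The category of all \<open>R\<close>-modules is rendered as the modules whose carrier is a subset of one
  type \<open>'m\<close>, the universe. In the theorem \<open>'m\<close> is arbitrary, subject to being
  infinite and at least as large as the ring. For Noetherian \<open>R\<close> every module of cardinality at
  most that of \<open>'m\<close> then embeds into an injective module with carrier in \<open>'m\<close>, so all the
  injective resolutions that are needed exist within the universe.

  HOL-Algebra's module record extends the ring record; the fields \<open>mult\<close> and \<open>one\<close> of a
  module are never used.
\<close>

section \<open>Modules\<close>

definition linear_map ::
  "('a, 'r) ring_scheme \<Rightarrow> ('a, 'b) module \<Rightarrow> ('a, 'c) module \<Rightarrow> ('b \<Rightarrow> 'c) \<Rightarrow> bool" where
  "linear_map R M N f \<longleftrightarrow>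
     f \<in> carrier M \<rightarrow> carrier N \<and>
     (\<forall>x\<in>carrier M. \<forall>y\<in>carrier M. f (x \<oplus>\<^bsub>M\<^esub> y) = f x \<oplus>\<^bsub>N\<^esub> f y) \<and>
     (\<forall>a\<in>carrier R. \<forall>x\<in>carrier M. f (a \<odot>\<^bsub>M\<^esub> x) = a \<odot>\<^bsub>N\<^esub> f x)"

definition module_isomorphic ::
  "('a, 'r) ring_scheme \<Rightarrow> ('a, 'b) module \<Rightarrow> ('a, 'c) module \<Rightarrow> bool" where
  "module_isomorphic R M N \<longleftrightarrow> (\<exists>f. linear_map R M N f \<and> bij_betw f (carrier M) (carrier N))"

definition regular_module :: "('a, 'r) ring_scheme \<Rightarrow> ('a, 'a) module" where
  "regular_module R =
     \<lparr>carrier = carrier R, monoid.mult = monoid.mult R, monoid.one = \<one>\<^bsub>R\<^esub>,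
      ring.zero = \<zero>\<^bsub>R\<^esub>, ring.add = add R, module.smult = monoid.mult R\<rparr>"

text \<open>The scalar multiple of a coset \<open>N + m\<close> by \<open>a\<close> is \<open>N + am\<close>.\<close>

definition quotient_module :: "('a, 'b) module \<Rightarrow> 'b set \<Rightarrow> ('a, 'b set) module" where
  "quotient_module M N =
     \<lparr>carrier = a_rcosets\<^bsub>M\<^esub> N, monoid.mult = undefined, monoid.one = undefined,
      ring.zero = N, ring.add = set_add M,
      module.smult = (\<lambda>a C. \<Union>x\<in>C. N +>\<^bsub>M\<^esub> (a \<odot>\<^bsub>M\<^esub> x))\<rparr>"

definition residue_module :: "('a, 'r) ring_scheme \<Rightarrow> 'a set \<Rightarrow> ('a, 'a set) module" where
  "residue_module R J = quotient_module (regular_module R) J"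

text \<open>Maps are taken extensional, so that equality in \<open>Hom(N, M)\<close> is equality on \<open>N\<close>.\<close>

definition Hom_module ::
  "('a, 'r) ring_scheme \<Rightarrow> ('a, 'b) module \<Rightarrow> ('a, 'c) module \<Rightarrow> ('a, 'b \<Rightarrow> 'c) module" where
  "Hom_module R N M =
     \<lparr>carrier = {f \<in> extensional (carrier N). linear_map R N M f},
      monoid.mult = undefined, monoid.one = undefined,
      ring.zero = (\<lambda>x\<in>carrier N. \<zero>\<^bsub>M\<^esub>),
      ring.add = (\<lambda>f g. \<lambda>x\<in>carrier N. f x \<oplus>\<^bsub>M\<^esub> g x),
      module.smult = (\<lambda>a f. \<lambda>x\<in>carrier N. a \<odot>\<^bsub>M\<^esub> f x)\<rparr>"

definition short_exact ::
  "('a, 'r) ring_scheme \<Rightarrow> ('a, 'b) module \<Rightarrow> ('b \<Rightarrow> 'c) \<Rightarrow> ('a, 'c) module \<Rightarrow>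
   ('c \<Rightarrow> 'd) \<Rightarrow> ('a, 'd) module \<Rightarrow> bool" where
  "short_exact R M f N g L \<longleftrightarrow>
     linear_map R M N f \<and> linear_map R N L g \<and>
     inj_on f (carrier M) \<and> f ` carrier M = a_kernel N L g \<and> g ` carrier N = carrier L"

section \<open>Serre subcategories\<close>

definition serre_subcategory ::
  "('a, 'r) ring_scheme \<Rightarrow> ('a, 'm) module set \<Rightarrow> bool" where
  "serre_subcategory R S \<longleftrightarrow>
     S \<subseteq> {M. module R M} \<and>
     (\<forall>M N L f g. module R M \<longrightarrow> module R N \<longrightarrow> module R L \<longrightarrow> short_exact R M f N g L \<longrightarrow>
        (N \<in> S \<longleftrightarrow> M \<in> S \<and> L \<in> S))"

text \<open>
  A Serre subcategory is closed under isomorphism (take \<open>L = 0\<close>). The modules constructed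
  below have carriers in types other than the universe, so they belong to \<open>S\<close> if they are
  isomorphic to a member of \<open>S\<close>.
\<close>

definition belongs_to ::
  "('a, 'r) ring_scheme \<Rightarrow> ('a, 'b) module \<Rightarrow> ('a, 'm) module set \<Rightarrow> bool" where
  "belongs_to R M S \<longleftrightarrow> (\<exists>N\<in>S. module_isomorphic R M N)"

section \<open>Injective resolutions and cohomology\<close>

text \<open>
  HOL cannot quantify over types here, so the test modules \<open>A\<close>, \<open>B\<close> range over the same
  universe as \<open>E\<close>; once the universe contains a copy of \<open>R\<close>, this is full injectivity
  by Baer's criterion.
\<close>

definition injective_module :: "('a, 'r) ring_scheme \<Rightarrow> ('a, 'm) module \<Rightarrow> bool" where
  "injective_module R E \<longleftrightarrow>
     module R E \<and>
     (\<forall>(A :: ('a, 'm) module) (B :: ('a, 'm) module) u f.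
        module R A \<longrightarrow> module R B \<longrightarrow> linear_map R A B u \<longrightarrow> inj_on u (carrier A) \<longrightarrow>
        linear_map R A E f \<longrightarrow>
        (\<exists>g. linear_map R B E g \<and> (\<forall>x\<in>carrier A. g (u x) = f x)))"

definition is_injective_resolution ::
  "('a, 'r) ring_scheme \<Rightarrow> ('a, 'b) module \<Rightarrow> ('b \<Rightarrow> 'm) \<Rightarrow>
   (nat \<Rightarrow> ('a, 'm) module) \<Rightarrow> (nat \<Rightarrow> 'm \<Rightarrow> 'm) \<Rightarrow> bool" where
  "is_injective_resolution R M e E d \<longleftrightarrow>
     (\<forall>i. injective_module R (E i)) \<and>
     linear_map R M (E 0) e \<and> (\<forall>i. linear_map R (E i) (E (Suc i)) (d i)) \<and>
     inj_on e (carrier M) \<and>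
     e ` carrier M = a_kernel (E 0) (E 1) (d 0) \<and>
     (\<forall>i. d i ` carrier (E i) = a_kernel (E (Suc i)) (E (Suc (Suc i))) (d (Suc i)))"

definition injective_resolution ::
  "('a, 'r) ring_scheme \<Rightarrow> ('a, 'b) module \<Rightarrow> (nat \<Rightarrow> ('a, 'm) module) \<times> (nat \<Rightarrow> 'm \<Rightarrow> 'm)" where
  "injective_resolution R M = (SOME (E, d). \<exists>e. is_injective_resolution R M e E d)"

text \<open>Cohomology of a cochain complex in non-negative degrees; the differential into degree 0 is 0.\<close>

definition coboundaries ::
  "(nat \<Rightarrow> ('a, 'b) module) \<Rightarrow> (nat \<Rightarrow> 'b \<Rightarrow> 'b) \<Rightarrow> nat \<Rightarrow> 'b set" where
  "coboundaries C d i = (case i of 0 \<Rightarrow> {\<zero>\<^bsub>C 0\<^esub>} | Suc j \<Rightarrow> d j ` carrier (C j))"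

definition cohomology ::
  "(nat \<Rightarrow> ('a, 'b) module) \<Rightarrow> (nat \<Rightarrow> 'b \<Rightarrow> 'b) \<Rightarrow> nat \<Rightarrow> ('a, 'b set) module" where
  "cohomology C d i =
     quotient_module ((C i)\<lparr>carrier := a_kernel (C i) (C (Suc i)) (d i)\<rparr>) (coboundaries C d i)"

section \<open>Ext and local cohomology\<close>

text \<open>
  In both definitions the type of the result determines the universe \<open>'m\<close> in which
  the injective resolution is taken.
\<close>

definition Ext ::
  "('a, 'r) ring_scheme \<Rightarrow> nat \<Rightarrow> ('a, 'b) module \<Rightarrow> ('a, 'c) module \<Rightarrow>
   ('a, ('b \<Rightarrow> 'm) set) module" where
  "Ext R i N M =
     (case injective_resolution R M of (E, d) \<Rightarrow>
        cohomology (\<lambda>k. Hom_module R N (E k)) (\<lambda>k. compose (carrier N) (d k)) i)"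

definition torsion_submodule ::
  "('a, 'r) ring_scheme \<Rightarrow> 'a set \<Rightarrow> ('a, 'b) module \<Rightarrow> ('a, 'b) module" where
  "torsion_submodule R I M =
     M\<lparr>carrier := {x \<in> carrier M.
        \<exists>t::nat. \<forall>a \<in> I [^]\<^bsub>ideals_set R\<^esub> t. a \<odot>\<^bsub>M\<^esub> x = \<zero>\<^bsub>M\<^esub>}\<rparr>"

definition local_cohomology ::
  "('a, 'r) ring_scheme \<Rightarrow> 'a set \<Rightarrow> nat \<Rightarrow> ('a, 'b) module \<Rightarrow> ('a, 'm set) module" where
  "local_cohomology R I i M =
     (case injective_resolution R M of (E, d) \<Rightarrow>
        cohomology (\<lambda>k. torsion_submodule R I (E k)) d i)"

section \<open>Regular sequences\<close>

definition nonzerodivisor_on :: "('a, 'b) module \<Rightarrow> 'a \<Rightarrow> bool" where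
  "nonzerodivisor_on M a \<longleftrightarrow> (\<forall>x\<in>carrier M. a \<odot>\<^bsub>M\<^esub> x = \<zero>\<^bsub>M\<^esub> \<longrightarrow> x = \<zero>\<^bsub>M\<^esub>)"

definition regular_sequence :: "('a, 'r) ring_scheme \<Rightarrow> 'a list \<Rightarrow> bool" where
  "regular_sequence R xs \<longleftrightarrow>
     set xs \<subseteq> carrier R \<and>
     (\<forall>i<length xs. nonzerodivisor_on (residue_module R (Idl\<^bsub>R\<^esub> (set (take i xs)))) (xs ! i)) \<and>
     Idl\<^bsub>R\<^esub> (set xs) \<noteq> carrier R"

end

theory Submission
  imports Defs
begin

text \<open>
  Let \<open>n\<close> be the length of the regular sequence \<open>x\<close>. In the derived category,
  \<open>RHom(R/(x), R)\<close> is \<open>R/(x)\<close> placed in degree \<open>n\<close>, and \<open>RHom(R/(x), -)\<close> commutes with the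
  derived torsion functor \<open>R\<Gamma>\<^sub>I\<close>. Hence \<open>H\<^sub>I\<^sup>j(R/(x))\<close> is the cohomology of
  \<open>RHom(R/(x), R\<Gamma>\<^sub>I R)\<close> in degree \<open>n + j\<close>, which is the limit of a first quadrant spectral sequence that
  starts from the modules \<open>Ext\<^sup>p(R/(x), H\<^sub>I\<^sup>q(R))\<close>. A Serre subcategory that contains these contains
  all their subquotients and iterated extensions.

  The formal argument replaces \<open>RHom(R/(x), -)\<close> by the Koszul complex \<open>K(C)\<close> of a complex \<open>C\<close>, a
  finite iteration of mapping cones. It is functorial, exact and free of choices. The
  spectral sequence becomes \<open>koszul_acyclic_mod\<close>: if the cohomology of \<open>K(H)\<close> lies in \<open>S\<close> for every
  cohomology module \<open>H\<close> of a bounded below complex \<open>C\<close>, then so does the cohomology of \<open>K(C)\<close>. This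
  follows by truncating \<open>C\<close> in one degree after the other. It is applied to \<open>\<Gamma>\<^sub>I(E)\<close> for an injective
  resolution \<open>E\<close> of \<open>R\<close>. The Koszul cohomology of \<open>H\<close> is \<open>Ext(R/(x), H)\<close>: if \<open>G\<close> is an injective
  resolution of \<open>H\<close>, then \<open>K(H) \<rightarrow> K(G)\<close> is a quasi-isomorphism, and so is the inclusion into
  \<open>K(G)\<close> of the elements of \<open>G\<close> killed by \<open>x\<close> (\<open>ann_koszul_quasi_iso\<close>), since each \<open>x\<^sub>k\<close> acts
  surjectively on the elements of an injective module that its predecessors kill
  (\<open>injective_divisible\<close>). These elements form the complex \<open>Hom(R/(x), G)\<close>.

  On the other side, the cohomology of \<open>K(E)\<close> is \<open>R/(x)\<close> in degree \<open>n\<close> and zero elsewhere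
  (\<open>concentrated_cohomology_koszul\<close>), so there is a quasi-isomorphism from \<open>K(E)\<close> to an injective
  resolution \<open>F\<close> of \<open>R/(x)\<close>, shifted by \<open>n\<close> (\<open>quasi_iso_to_shifted\<close>). Both complexes consist of
  injective modules and are bounded below, so \<open>\<Gamma>\<^sub>I\<close> preserves this quasi-isomorphism
  (\<open>torsion_quasi_iso\<close>); and \<open>\<Gamma>\<^sub>I(K(E)) = K(\<Gamma>\<^sub>I(E))\<close> (\<open>koszul_torsion\<close>). Thus the cohomology of
  \<open>\<Gamma>\<^sub>I(F)\<close> lies in \<open>S\<close>. The argument works for any choice of the resolutions.

  It remains to see that the resolutions exist, with carriers in the universe \<open>'m\<close>
  (\<open>injective_resolution_exists\<close>). The module of characters (\<open>character_module\<close>) is injective and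
  contains a given module, but is too large. Closing the image of the given module under the
  solution of finite systems of linear equations that are solvable in the module of characters
  yields a submodule whose cardinality is at most that of \<open>'m\<close>. It satisfies Baer's criterion because
  every ideal of \<open>R\<close> is finitely generated (\<open>hull_baer\<close>).
\<close>

section \<open>Ideals and submodules\<close>

lemma module_cring: "module R M \<Longrightarrow> cring R"
  by (rule module.axioms(1))

lemma (in abelian_group) minus_eq_zero_iff [simp]:
  "x \<in> carrier G \<Longrightarrow> y \<in> carrier G \<Longrightarrow> x \<ominus> y = \<zero> \<longleftrightarrow> x = y"
  using r_neg minus_equality[of x "\<ominus> y"] by (fastforce simp: a_minus_def)

lemma (in abelian_group) minus_right_zero [simp]: "x \<in> carrier G \<Longrightarrow> x \<ominus> \<zero> = x"
  using minus_equality[of \<zero> \<zero>] by (simp add: a_minus_def)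

lemma ideal_intro:
  fixes R (structure)
  assumes "cring R" and sub: "J \<subseteq> carrier R" and "\<zero> \<in> J"
    and "\<And>r s. r \<in> J \<Longrightarrow> s \<in> J \<Longrightarrow> r \<oplus> s \<in> J"
    and sm: "\<And>a r. a \<in> carrier R \<Longrightarrow> r \<in> J \<Longrightarrow> a \<otimes> r \<in> J"
  shows "ideal J R"
proof -
  interpret cring R by fact
  show ?thesis
  proof (rule idealI[OF ring_axioms])
    show "subgroup J (add_monoid R)"
    proof (rule subgroup.intro)
      show "inv\<^bsub>add_monoid R\<^esub> x \<in> J" if "x \<in> J" for x
        using sm[of "\<ominus> \<one>" x] that sub by (simp add: l_minus subset_iff a_inv_def[symmetric])
    qed (use assms in auto)
    show "r \<otimes> a \<in> J" "a \<otimes> r \<in> J" if "r \<in> J" "a \<in> carrier R" for a r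
      using sm[OF that(2,1)] m_comm[of a r] that sub by auto
  qed
qed

lemma submodule_intro:
  fixes R (structure)
  assumes M: "module R M" and "Z \<subseteq> carrier M" and "\<zero>\<^bsub>M\<^esub> \<in> Z"
    and "\<And>x y. x \<in> Z \<Longrightarrow> y \<in> Z \<Longrightarrow> x \<oplus>\<^bsub>M\<^esub> y \<in> Z"
    and sm: "\<And>a x. a \<in> carrier R \<Longrightarrow> x \<in> Z \<Longrightarrow> a \<odot>\<^bsub>M\<^esub> x \<in> Z"
  shows "submodule Z R M"
proof -
  interpret M: module R M by fact
  have "\<ominus>\<^bsub>M\<^esub> x \<in> Z" if "x \<in> Z" for x
    using sm[of "\<ominus> \<one>" x] that assms(2) M.smult_l_minus[of \<one> x] by auto
  then show ?thesis
    using assms by (intro M.submoduleI) auto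
qed

lemma submoduleD:
  assumes "submodule Z R M"
  shows submodule_subset: "Z \<subseteq> carrier M"
    and submodule_mem: "\<And>x. x \<in> Z \<Longrightarrow> x \<in> carrier M"
    and submodule_zero: "\<zero>\<^bsub>M\<^esub> \<in> Z"
    and submodule_add: "\<And>x y. x \<in> Z \<Longrightarrow> y \<in> Z \<Longrightarrow> x \<oplus>\<^bsub>M\<^esub> y \<in> Z"
    and submodule_smult: "\<And>a x. a \<in> carrier R \<Longrightarrow> x \<in> Z \<Longrightarrow> a \<odot>\<^bsub>M\<^esub> x \<in> Z"
    and submodule_neg: "\<And>x. x \<in> Z \<Longrightarrow> \<ominus>\<^bsub>M\<^esub> x \<in> Z"
proof -
  interpret submodule Z R M by fact
  show "Z \<subseteq> carrier M" using subset by simp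
  show "\<And>x. x \<in> Z \<Longrightarrow> x \<in> carrier M" using subset by auto
  show "\<zero>\<^bsub>M\<^esub> \<in> Z" using one_closed by simp
  show "\<And>x y. x \<in> Z \<Longrightarrow> y \<in> Z \<Longrightarrow> x \<oplus>\<^bsub>M\<^esub> y \<in> Z" using m_closed by simp
  show "\<And>a x. a \<in> carrier R \<Longrightarrow> x \<in> Z \<Longrightarrow> a \<odot>\<^bsub>M\<^esub> x \<in> Z" by simp
  show "\<And>x. x \<in> Z \<Longrightarrow> \<ominus>\<^bsub>M\<^esub> x \<in> Z" using m_inv_closed by (simp add: a_inv_def)
qed

lemma submodule_module: "module R M \<Longrightarrow> submodule Z R M \<Longrightarrow> module R (M\<lparr>carrier := Z\<rparr>)"
  by (rule submodule.submodule_is_module)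

lemma submodule_zero_set: "module R M \<Longrightarrow> submodule {\<zero>\<^bsub>M\<^esub>} R M"
  by (rule submodule_intro) (auto simp: module_def abelian_group_def abelian_monoid.l_zero
      abelian_monoid.zero_closed module.smult_r_null)

lemma submodule_carrier: "module R M \<Longrightarrow> submodule (carrier M) R M"
  by (rule module.carrier_is_submodule)

lemma submodule_Int:
  "module R M \<Longrightarrow> submodule Y R M \<Longrightarrow> submodule Z R M \<Longrightarrow> submodule (Y \<inter> Z) R M"
  by (rule submodule_intro) (auto simp: submoduleD)

lemma submodule_of_submodule:
  assumes "module R M" "submodule Z R M" "submodule Y R M" "Y \<subseteq> Z"
  shows "submodule Y R (M\<lparr>carrier := Z\<rparr>)"
  using assms by (intro submodule_intro[OF submodule_module]) (auto simp: submoduleD)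

section \<open>Linear maps\<close>

lemma linear_mapI:
  assumes "\<And>x. x \<in> carrier M \<Longrightarrow> f x \<in> carrier N"
    and "\<And>x y. x \<in> carrier M \<Longrightarrow> y \<in> carrier M \<Longrightarrow> f (x \<oplus>\<^bsub>M\<^esub> y) = f x \<oplus>\<^bsub>N\<^esub> f y"
    and "\<And>a x. a \<in> carrier R \<Longrightarrow> x \<in> carrier M \<Longrightarrow> f (a \<odot>\<^bsub>M\<^esub> x) = a \<odot>\<^bsub>N\<^esub> f x"
  shows "linear_map R M N f"
  using assms by (auto simp: linear_map_def)

lemma linear_mapD:
  assumes "linear_map R M N f"
  shows lm_closed: "\<And>x. x \<in> carrier M \<Longrightarrow> f x \<in> carrier N"
    and lm_add: "\<And>x y. x \<in> carrier M \<Longrightarrow> y \<in> carrier M \<Longrightarrow> f (x \<oplus>\<^bsub>M\<^esub> y) = f x \<oplus>\<^bsub>N\<^esub> f y"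
    and lm_smult: "\<And>a x. a \<in> carrier R \<Longrightarrow> x \<in> carrier M \<Longrightarrow> f (a \<odot>\<^bsub>M\<^esub> x) = a \<odot>\<^bsub>N\<^esub> f x"
  using assms by (auto simp: linear_map_def)

lemma lm_zero:
  assumes "module R M" "module R N" "linear_map R M N f"
  shows "f \<zero>\<^bsub>M\<^esub> = \<zero>\<^bsub>N\<^esub>"
proof -
  interpret M: module R M by fact
  interpret N: module R N by fact
  show ?thesis using lm_smult[OF assms(3), of "\<zero>\<^bsub>R\<^esub>" "\<zero>\<^bsub>M\<^esub>"] lm_closed[OF assms(3), of "\<zero>\<^bsub>M\<^esub>"]
    by simp
qed

lemma lm_neg:
  assumes "module R M" "module R N" "linear_map R M N f" "x \<in> carrier M"
  shows "f (\<ominus>\<^bsub>M\<^esub> x) = \<ominus>\<^bsub>N\<^esub> f x"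
proof -
  interpret M: module R M by fact
  interpret N: module R N by fact
  show ?thesis using lm_smult[OF assms(3), of "\<ominus>\<^bsub>R\<^esub> \<one>\<^bsub>R\<^esub>" x] lm_closed[OF assms(3), of x] assms(4)
    by (simp add: M.smult_l_minus N.smult_l_minus)
qed

lemma lm_minus:
  assumes "module R M" "module R N" "linear_map R M N f" "x \<in> carrier M" "y \<in> carrier M"
  shows "f (x \<ominus>\<^bsub>M\<^esub> y) = f x \<ominus>\<^bsub>N\<^esub> f y"
proof -
  interpret M: module R M by fact
  show ?thesis using assms by (simp add: a_minus_def lm_add lm_neg)
qed

lemma lm_comp:
  "linear_map R M N f \<Longrightarrow> linear_map R N L g \<Longrightarrow> linear_map R M L (\<lambda>x. g (f x))"
  by (auto simp: linear_map_def Pi_def)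

lemma lm_cong:
  "linear_map R M N f \<Longrightarrow> module R M \<Longrightarrow> (\<And>x. x \<in> carrier M \<Longrightarrow> g x = f x) \<Longrightarrow> linear_map R M N g"
  by (auto simp: linear_map_def Pi_def module_def abelian_group_def
     intro: module.smult_closed dest: abelian_monoid.a_closed module.smult_closed)
 (metis module.smult_closed module_def abelian_group_def abelian_monoid.a_closed)+

lemma lm_restrict:
  "linear_map R M N f \<Longrightarrow> Z \<subseteq> carrier M \<Longrightarrow> linear_map R (M\<lparr>carrier := Z\<rparr>) N f"
  by (auto simp: linear_map_def Pi_def subset_iff)

lemma lm_restrict2:
  "linear_map R M N f \<Longrightarrow> Z \<subseteq> carrier M \<Longrightarrow> f ` Z \<subseteq> Y \<Longrightarrow> linear_map R (M\<lparr>carrier := Z\<rparr>) (N\<lparr>carrier := Y\<rparr>) f"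
  by (auto simp: linear_map_def Pi_def subset_iff image_subset_iff)

lemma lm_expand:
  "linear_map R M (N\<lparr>carrier := Y\<rparr>) f \<Longrightarrow> Y \<subseteq> carrier N \<Longrightarrow> linear_map R M N f"
  by (auto simp: linear_map_def Pi_def subset_iff)

lemma lm_codom:
  "linear_map R M N f \<Longrightarrow> f ` carrier M \<subseteq> Y \<Longrightarrow> linear_map R M (N\<lparr>carrier := Y\<rparr>) f"
  by (auto simp: linear_map_def Pi_def subset_iff)

lemma lm_image:
  assumes "module R M" "module R N" "linear_map R M N f" "submodule Z R M"
  shows "submodule (f ` Z) R N"
proof (rule submodule_intro)
  show "f ` Z \<subseteq> carrier N" using assms by (auto simp: submoduleD lm_closed)
  show "\<zero>\<^bsub>N\<^esub> \<in> f ` Z" using lm_zero[OF assms(1-3)] submodule_zero[OF assms(4)] by (metis imageI)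
  show "x \<oplus>\<^bsub>N\<^esub> y \<in> f ` Z" if "x \<in> f ` Z" "y \<in> f ` Z" for x y
    using that assms(4) by (force simp: submoduleD lm_add[OF assms(3), symmetric])
  show "a \<odot>\<^bsub>N\<^esub> x \<in> f ` Z" if "a \<in> carrier R" "x \<in> f ` Z" for a x
    using that assms(4) by (force simp: submoduleD lm_smult[OF assms(3), symmetric])
qed fact

lemma lm_image_carrier:
  assumes "module R M" "module R N" "linear_map R M N f"
  shows "submodule (f ` carrier M) R N"
  by (rule lm_image[OF assms submodule_carrier[OF assms(1)]])

lemma lm_preimage:
  assumes "module R M" "module R N" "linear_map R M N f" "submodule Z R N"
  shows "submodule {x \<in> carrier M. f x \<in> Z} R M"
proof -
  interpret M: module R M by fact
  show ?thesis
  proof (rule submodule_intro)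
    show "\<zero>\<^bsub>M\<^esub> \<in> {x \<in> carrier M. f x \<in> Z}"
      using assms by (simp add: lm_zero[OF assms(1-3)] submoduleD)
  qed (use assms in \<open>auto simp: submoduleD lm_add lm_smult\<close>)
qed

lemma lm_kernel:
  assumes "module R M" "module R N" "linear_map R M N f"
  shows "submodule {x \<in> carrier M. f x = \<zero>\<^bsub>N\<^esub>} R M"
  using lm_preimage[OF assms submodule_zero_set[OF assms(2)]] by simp

lemma lm_inj:
  assumes "module R M" "module R N" "linear_map R M N f"
    and ker: "\<And>x. x \<in> carrier M \<Longrightarrow> f x = \<zero>\<^bsub>N\<^esub> \<Longrightarrow> x = \<zero>\<^bsub>M\<^esub>"
  shows "inj_on f (carrier M)"
proof (rule inj_onI)
  interpret M: module R M by fact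
  interpret N: module R N by fact
  fix x y assume xy: "x \<in> carrier M" "y \<in> carrier M" "f x = f y"
  then have "f (x \<ominus>\<^bsub>M\<^esub> y) = \<zero>\<^bsub>N\<^esub>"
    using lm_closed[OF assms(3)] by (simp add: lm_minus[OF assms(1-3)])
  then show "x = y" using ker[of "x \<ominus>\<^bsub>M\<^esub> y"] xy by auto
qed

lemma a_kernel_eq: "a_kernel M N f = {x \<in> carrier M. f x = \<zero>\<^bsub>N\<^esub>}"
  by (simp add: a_kernel_def' )

lemma lm_sum:
  assumes "module R M" "module R N" "linear_map R M N f" "linear_map R M N g"
  shows "linear_map R M N (\<lambda>x. f x \<oplus>\<^bsub>N\<^esub> g x)"
proof -
  interpret M: module R M by fact
  interpret N: module R N by fact
  show ?thesis
    using lm_closed[OF assms(3)] lm_closed[OF assms(4)]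
    by (intro linear_mapI) (simp_all add: lm_add[OF assms(3)] lm_add[OF assms(4)]
        lm_smult[OF assms(3)] lm_smult[OF assms(4)] N.smult_r_distr N.a_ac)
qed

lemma lm_scale:
  assumes "module R M" "module R N" "linear_map R M N f" "a \<in> carrier R"
  shows "linear_map R M N (\<lambda>x. a \<odot>\<^bsub>N\<^esub> f x)"
proof -
  interpret R: cring R by (rule module_cring[OF assms(1)])
  interpret M: module R M by fact
  interpret N: module R N by fact
  show ?thesis
    using lm_closed[OF assms(3)] assms(4)
    by (intro linear_mapI) (simp_all add: lm_add[OF assms(3)]
        lm_smult[OF assms(3)] N.smult_r_distr N.smult_assoc1[symmetric] R.m_comm)
qed

lemma lm_id: "linear_map R M M (\<lambda>x. x)"
  by (simp add: linear_map_def)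

lemma lm_diff:
  assumes "module R M" "module R N" "linear_map R M N f" "linear_map R M N g"
  shows "linear_map R M N (\<lambda>x. f x \<ominus>\<^bsub>N\<^esub> g x)"
proof -
  interpret N: module R N by fact
  have "linear_map R M N (\<lambda>x. f x \<oplus>\<^bsub>N\<^esub> (\<ominus>\<^bsub>R\<^esub> \<one>\<^bsub>R\<^esub>) \<odot>\<^bsub>N\<^esub> g x)"
    by (rule lm_sum[OF assms(1-3) lm_scale[OF assms(1,2,4)]]) simp
  then show ?thesis
    by (rule lm_cong[OF _ assms(1)]) (use lm_closed[OF assms(4)] in \<open>simp add: N.smult_l_minus a_minus_def\<close>)
qed

lemma lm_const_zero:
  assumes "module R N"
  shows "linear_map R M N (\<lambda>_. \<zero>\<^bsub>N\<^esub>)"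
proof -
  interpret N: module R N by fact
  show ?thesis by (intro linear_mapI) simp_all
qed

text \<open>The homomorphism theorem, stated for an arbitrary surjection so that cosets can be avoided.\<close>

lemma linear_factor:
  assumes "module R Z" "module R N" "module R P" and p: "linear_map R Z N p" and h: "linear_map R Z P h"
    and surj: "p ` carrier Z = carrier N"
    and ker: "\<And>z. z \<in> carrier Z \<Longrightarrow> p z = \<zero>\<^bsub>N\<^esub> \<Longrightarrow> h z = \<zero>\<^bsub>P\<^esub>"
  obtains k where "linear_map R N P k" "\<And>z. z \<in> carrier Z \<Longrightarrow> k (p z) = h z"
proof -
  interpret Z: module R Z by fact
  interpret N: module R N by fact
  interpret P: module R P by fact
  define k where "k = (\<lambda>n. h (SOME z. z \<in> carrier Z \<and> p z = n))"
  have k: "k (p z) = h z" if z: "z \<in> carrier Z" for z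
  proof -
    let ?w = "SOME w. w \<in> carrier Z \<and> p w = p z"
    have w: "?w \<in> carrier Z \<and> p ?w = p z" using z by (intro someI) auto
    then have "p (?w \<ominus>\<^bsub>Z\<^esub> z) = \<zero>\<^bsub>N\<^esub>"
      using z lm_closed[OF p] by (simp add: lm_minus[OF assms(1,2) p])
    then have "h (?w \<ominus>\<^bsub>Z\<^esub> z) = \<zero>\<^bsub>P\<^esub>" using ker[of "?w \<ominus>\<^bsub>Z\<^esub> z"] w z by simp
    then show ?thesis unfolding k_def
      using w z lm_closed[OF h] by (simp add: lm_minus[OF assms(1,3) h])
  qed
  have "linear_map R N P k"
  proof (rule linear_mapI)
    fix x assume "x \<in> carrier N"
    then obtain u where u: "u \<in> carrier Z" "x = p u" using surj by auto
    then show "k x \<in> carrier P" using k lm_closed[OF h] by auto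
    { fix y assume "y \<in> carrier N"
      then obtain v where "v \<in> carrier Z" "y = p v" using surj by auto
      then show "k (x \<oplus>\<^bsub>N\<^esub> y) = k x \<oplus>\<^bsub>P\<^esub> k y"
        using u by (simp add: k lm_add[OF p, symmetric] lm_add[OF h]) }
    { fix a assume "a \<in> carrier R"
      then show "k (a \<odot>\<^bsub>N\<^esub> x) = a \<odot>\<^bsub>P\<^esub> k x"
        using u by (simp add: k lm_smult[OF p, symmetric] lm_smult[OF h]) }
  qed
  then show ?thesis using k that by blast
qed

section \<open>Baer's criterion\<close>

definition baer_injective :: "('a, 'r) ring_scheme \<Rightarrow> ('a, 'b) module \<Rightarrow> bool" where
  "baer_injective R E \<longleftrightarrow>
     (\<forall>J f. ideal J R \<longrightarrow> linear_map R ((regular_module R)\<lparr>carrier := J\<rparr>) E f \<longrightarrow>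
        (\<exists>y\<in>carrier E. \<forall>r\<in>J. f r = r \<odot>\<^bsub>E\<^esub> y))"

text \<open>
  Baer's criterion, by Zorn's lemma. A partial extension is the graph \<open>G\<close> of a linear map from a submodule
  of \<open>B\<close>. If \<open>b\<close> is outside its domain, then \<open>{r. r b \<in> dom G}\<close> is an ideal, on which \<open>G\<close> defines a
  linear map to \<open>E\<close>; an element \<open>y\<close> that induces this map is an admissible value at \<open>b\<close>. Two maps \<open>g\<close>
  and \<open>h\<close> in place of an inclusion and a map on a submodule allow \<open>k\<close> to be prescribed on
  \<open>g ` A\<close> without passing to the image.
\<close>

lemma baer_extension:
  fixes R (structure)
  assumes A: "module R A" and B: "module R B" and E: "module R E" and baer: "baer_injective R E"
    and g: "linear_map R A B g" and h: "linear_map R A E h"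
    and ker: "\<And>x. x \<in> carrier A \<Longrightarrow> g x = \<zero>\<^bsub>B\<^esub> \<Longrightarrow> h x = \<zero>\<^bsub>E\<^esub>"
  obtains k where "linear_map R B E k" "\<And>x. x \<in> carrier A \<Longrightarrow> k (g x) = h x"
proof -
  interpret R: cring R by (rule module_cring[OF A])
  interpret A: module R A by fact
  interpret B: module R B by fact
  interpret E: module R E by fact
  define G0 where "G0 = (\<lambda>x. (g x, h x)) ` carrier A"
  define P where "P G \<longleftrightarrow> G \<subseteq> carrier B \<times> carrier E \<and>
      (\<forall>b e b' e'. (b, e) \<in> G \<longrightarrow> (b', e') \<in> G \<longrightarrow> (b \<oplus>\<^bsub>B\<^esub> b', e \<oplus>\<^bsub>E\<^esub> e') \<in> G) \<and>
      (\<forall>a b e. a \<in> carrier R \<longrightarrow> (b, e) \<in> G \<longrightarrow> (a \<odot>\<^bsub>B\<^esub> b, a \<odot>\<^bsub>E\<^esub> e) \<in> G) \<and>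
      (\<forall>e. (\<zero>\<^bsub>B\<^esub>, e) \<in> G \<longrightarrow> e = \<zero>\<^bsub>E\<^esub>) \<and> G0 \<subseteq> G" for G
  have G0: "P G0"
    unfolding P_def G0_def using ker lm_closed[OF g] lm_closed[OF h]
    by (auto simp: lm_add[OF g, symmetric] lm_add[OF h, symmetric]
        lm_smult[OF g, symmetric] lm_smult[OF h, symmetric])
  have "\<exists>M\<in>Collect P. \<forall>Y\<in>Collect P. M \<subseteq> Y \<longrightarrow> Y = M"
  proof (rule subset_Zorn_nonempty)
    show "Collect P \<noteq> {}" using G0 by blast
    fix C assume C: "C \<noteq> {}" "subset.chain (Collect P) C"
    then have CP: "P c" if "c \<in> C" for c using that by (auto simp: subset.chain_def)
    have two: "\<exists>c\<in>C. u \<in> c \<and> v \<in> c" if "u \<in> \<Union>C" "v \<in> \<Union>C" for u v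
    proof -
      from that obtain c d where cd: "c \<in> C" "u \<in> c" "d \<in> C" "v \<in> d" by blast
      then have "c \<subseteq> d \<or> d \<subseteq> c" using C(2) by (auto simp: subset.chain_def)
      then show ?thesis using cd by blast
    qed
    have "P (\<Union>C)" unfolding P_def
    proof (intro conjI allI impI)
      show "\<Union>C \<subseteq> carrier B \<times> carrier E" using CP unfolding P_def by blast
      show "G0 \<subseteq> \<Union>C" using CP C(1) unfolding P_def by blast
      show "e = \<zero>\<^bsub>E\<^esub>" if "(\<zero>\<^bsub>B\<^esub>, e) \<in> \<Union>C" for e using that CP unfolding P_def by blast
      show "(a \<odot>\<^bsub>B\<^esub> b, a \<odot>\<^bsub>E\<^esub> e) \<in> \<Union>C" if "a \<in> carrier R" "(b, e) \<in> \<Union>C" for a b e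
        using that CP unfolding P_def by blast
      show "(b \<oplus>\<^bsub>B\<^esub> b', e \<oplus>\<^bsub>E\<^esub> e') \<in> \<Union>C" if "(b, e) \<in> \<Union>C" "(b', e') \<in> \<Union>C" for b e b' e'
        using two[OF that] CP unfolding P_def by blast
    qed
    then show "\<Union>C \<in> Collect P" by simp
  qed
  then obtain G where G: "P G" and max: "\<And>Y. P Y \<Longrightarrow> G \<subseteq> Y \<Longrightarrow> Y = G" by auto
  have sub: "\<And>b e. (b, e) \<in> G \<Longrightarrow> b \<in> carrier B \<and> e \<in> carrier E" using G unfolding P_def by blast
  have add: "\<And>b e b' e'. (b, e) \<in> G \<Longrightarrow> (b', e') \<in> G \<Longrightarrow> (b \<oplus>\<^bsub>B\<^esub> b', e \<oplus>\<^bsub>E\<^esub> e') \<in> G"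
    and sm: "\<And>a b e. a \<in> carrier R \<Longrightarrow> (b, e) \<in> G \<Longrightarrow> (a \<odot>\<^bsub>B\<^esub> b, a \<odot>\<^bsub>E\<^esub> e) \<in> G"
    and null: "\<And>e. (\<zero>\<^bsub>B\<^esub>, e) \<in> G \<Longrightarrow> e = \<zero>\<^bsub>E\<^esub>" and G0G: "G0 \<subseteq> G" using G unfolding P_def by blast+
  have neg: "(\<ominus>\<^bsub>B\<^esub> b, \<ominus>\<^bsub>E\<^esub> e) \<in> G" if "(b, e) \<in> G" for b e
    using sm[OF _ that, of "\<ominus> \<one>"] sub[OF that] by (simp add: B.smult_l_minus E.smult_l_minus)
  have uniq: "e = e'" if "(b, e) \<in> G" "(b, e') \<in> G" for b e e'
  proof -
    have "(\<zero>\<^bsub>B\<^esub>, e \<ominus>\<^bsub>E\<^esub> e') \<in> G" using add[OF that(1) neg[OF that(2)]] sub[OF that(1)]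
      by (simp add: B.r_neg a_minus_def)
    from null[OF this] show ?thesis using sub[OF that(1)] sub[OF that(2)] by simp
  qed
  have zero: "(\<zero>\<^bsub>B\<^esub>, \<zero>\<^bsub>E\<^esub>) \<in> G"
    using G0G lm_zero[OF A B g] lm_zero[OF A E h] by (force simp: G0_def)
  have total: "\<exists>e. (b, e) \<in> G" if b: "b \<in> carrier B" for b
  proof -
    define J where "J = {r \<in> carrier R. \<exists>e. (r \<odot>\<^bsub>B\<^esub> b, e) \<in> G}"
    define f where "f r = (THE e. (r \<odot>\<^bsub>B\<^esub> b, e) \<in> G)" for r
    have feq: "f r = e" if "(r \<odot>\<^bsub>B\<^esub> b, e) \<in> G" for r e
      unfolding f_def using that uniq by blast
    have fG: "(r \<odot>\<^bsub>B\<^esub> b, f r) \<in> G" if "r \<in> J" for r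
      using that feq unfolding J_def by blast
    have J0: "\<zero> \<in> J" using zero b by (auto simp: J_def)
    have Jadd: "(r \<oplus> s) \<in> J \<and> f (r \<oplus> s) = f r \<oplus>\<^bsub>E\<^esub> f s" if "r \<in> J" "s \<in> J" for r s
    proof -
      have "((r \<oplus> s) \<odot>\<^bsub>B\<^esub> b, f r \<oplus>\<^bsub>E\<^esub> f s) \<in> G"
        using add[OF fG[OF that(1)] fG[OF that(2)]] that b by (simp add: J_def B.smult_l_distr)
      then show ?thesis using feq that by (auto simp: J_def)
    qed
    have Jsm: "(a \<otimes> r) \<in> J \<and> f (a \<otimes> r) = a \<odot>\<^bsub>E\<^esub> f r" if "a \<in> carrier R" "r \<in> J" for a r
    proof -
      have "((a \<otimes> r) \<odot>\<^bsub>B\<^esub> b, a \<odot>\<^bsub>E\<^esub> f r) \<in> G"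
        using sm[OF that(1) fG[OF that(2)]] that b by (simp add: J_def B.smult_assoc1)
      then show ?thesis using feq that by (auto simp: J_def)
    qed
    have Jsub: "J \<subseteq> carrier R" by (auto simp: J_def)
    have "ideal J R"
      by (rule ideal_intro[OF R.cring_axioms Jsub J0]) (use Jadd Jsm in auto)
    moreover have "linear_map R ((regular_module R)\<lparr>carrier := J\<rparr>) E f"
      using Jadd Jsm sub[OF fG] by (intro linear_mapI) (auto simp: regular_module_def)
    ultimately obtain y where y: "y \<in> carrier E" "\<And>r. r \<in> J \<Longrightarrow> f r = r \<odot>\<^bsub>E\<^esub> y"
      using baer unfolding baer_injective_def by blast
    define G' where "G' = {(c \<oplus>\<^bsub>B\<^esub> r \<odot>\<^bsub>B\<^esub> b, e \<oplus>\<^bsub>E\<^esub> r \<odot>\<^bsub>E\<^esub> y) | c e r. (c, e) \<in> G \<and> r \<in> carrier R}"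
    have GG': "G \<subseteq> G'"
    proof
      fix u assume "u \<in> G"
      moreover obtain c e where "u = (c, e)" by fastforce
      ultimately have "(c, e) \<in> G" "u = (c \<oplus>\<^bsub>B\<^esub> \<zero> \<odot>\<^bsub>B\<^esub> b, e \<oplus>\<^bsub>E\<^esub> \<zero> \<odot>\<^bsub>E\<^esub> y)" using sub b y by auto
      then show "u \<in> G'" unfolding G'_def by blast
    qed
    have "P G'" unfolding P_def
    proof (intro conjI allI impI)
      show "G' \<subseteq> carrier B \<times> carrier E" using sub b y by (auto simp: G'_def)
      show "G0 \<subseteq> G'" using G0G GG' by simp
      fix c e assume "(c, e) \<in> G'"
      then obtain c1 e1 r1 where 1: "c = c1 \<oplus>\<^bsub>B\<^esub> r1 \<odot>\<^bsub>B\<^esub> b" "e = e1 \<oplus>\<^bsub>E\<^esub> r1 \<odot>\<^bsub>E\<^esub> y"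
        "(c1, e1) \<in> G" "r1 \<in> carrier R" by (auto simp: G'_def)
      { fix c' e' assume "(c', e') \<in> G'"
        then obtain c2 e2 r2 where 2: "c' = c2 \<oplus>\<^bsub>B\<^esub> r2 \<odot>\<^bsub>B\<^esub> b" "e' = e2 \<oplus>\<^bsub>E\<^esub> r2 \<odot>\<^bsub>E\<^esub> y"
          "(c2, e2) \<in> G" "r2 \<in> carrier R" by (auto simp: G'_def)
        have "c \<oplus>\<^bsub>B\<^esub> c' = (c1 \<oplus>\<^bsub>B\<^esub> c2) \<oplus>\<^bsub>B\<^esub> (r1 \<oplus> r2) \<odot>\<^bsub>B\<^esub> b"
          "e \<oplus>\<^bsub>E\<^esub> e' = (e1 \<oplus>\<^bsub>E\<^esub> e2) \<oplus>\<^bsub>E\<^esub> (r1 \<oplus> r2) \<odot>\<^bsub>E\<^esub> y"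
          using 1 2 sub[OF 1(3)] sub[OF 2(3)] b y
          by (simp_all add: B.smult_l_distr E.smult_l_distr B.a_ac E.a_ac)
        then show "(c \<oplus>\<^bsub>B\<^esub> c', e \<oplus>\<^bsub>E\<^esub> e') \<in> G'"
          using add[OF 1(3) 2(3)] 1(4) 2(4) unfolding G'_def by blast }
      { fix a assume a: "a \<in> carrier R"
        have "a \<odot>\<^bsub>B\<^esub> c = a \<odot>\<^bsub>B\<^esub> c1 \<oplus>\<^bsub>B\<^esub> (a \<otimes> r1) \<odot>\<^bsub>B\<^esub> b" "a \<odot>\<^bsub>E\<^esub> e = a \<odot>\<^bsub>E\<^esub> e1 \<oplus>\<^bsub>E\<^esub> (a \<otimes> r1) \<odot>\<^bsub>E\<^esub> y"
          using 1 sub[OF 1(3)] b y a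
          by (simp_all add: B.smult_r_distr E.smult_r_distr B.smult_assoc1 E.smult_assoc1)
        then show "(a \<odot>\<^bsub>B\<^esub> c, a \<odot>\<^bsub>E\<^esub> e) \<in> G'"
          using sm[OF a 1(3)] 1(4) a unfolding G'_def by blast }
    next
      fix e assume "(\<zero>\<^bsub>B\<^esub>, e) \<in> G'"
      then obtain c1 e1 r1 where 1: "\<zero>\<^bsub>B\<^esub> = c1 \<oplus>\<^bsub>B\<^esub> r1 \<odot>\<^bsub>B\<^esub> b" "e = e1 \<oplus>\<^bsub>E\<^esub> r1 \<odot>\<^bsub>E\<^esub> y"
        "(c1, e1) \<in> G" "r1 \<in> carrier R" by (auto simp: G'_def)
      have "r1 \<odot>\<^bsub>B\<^esub> b = \<ominus>\<^bsub>B\<^esub> c1" using 1 sub[OF 1(3)] b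
        by (metis B.M.add.inv_equality B.M.minus_minus B.smult_closed B.M.a_comm B.M.a_inv_closed)
      then have "(r1 \<odot>\<^bsub>B\<^esub> b, \<ominus>\<^bsub>E\<^esub> e1) \<in> G" using neg[OF 1(3)] by simp
      moreover from this have "r1 \<in> J" using 1 by (auto simp: J_def)
      ultimately have "\<ominus>\<^bsub>E\<^esub> e1 = r1 \<odot>\<^bsub>E\<^esub> y" using y feq by metis
      then show "e = \<zero>\<^bsub>E\<^esub>" using 1 sub[OF 1(3)] by (metis E.M.r_neg)
    qed
    from max[OF this GG'] have "G' = G" .
    moreover have "(\<zero>\<^bsub>B\<^esub> \<oplus>\<^bsub>B\<^esub> \<one> \<odot>\<^bsub>B\<^esub> b, \<zero>\<^bsub>E\<^esub> \<oplus>\<^bsub>E\<^esub> \<one> \<odot>\<^bsub>E\<^esub> y) \<in> G'"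
      unfolding G'_def using zero by blast
    ultimately show ?thesis using b y by auto
  qed
  define k where "k b = (THE e. (b, e) \<in> G)" for b
  have keq: "k b = e" if "(b, e) \<in> G" for b e unfolding k_def using that uniq by blast
  have kG: "(b, k b) \<in> G" if "b \<in> carrier B" for b using total[OF that] keq by auto
  have "linear_map R B E k"
    by (rule linear_mapI) (use sub[OF kG] add[OF kG kG] sm[OF _ kG] keq in auto)
  moreover have "k (g x) = h x" if "x \<in> carrier A" for x
    using G0G that by (intro keq) (auto simp: G0_def)
  ultimately show ?thesis using that by blast
qed

section \<open>Characters\<close>

text \<open>
  The unit circle is divisible and has elements of every finite order, which makes it a substitute
  for \<open>\<rat>/\<int>\<close>.
\<close>

definition circle :: "(int, complex) module" where
  "circle = \<lparr>carrier = {z. norm z = 1}, monoid.mult = undefined, monoid.one = undefined,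
     ring.zero = 1, ring.add = (*), module.smult = (\<lambda>n z. z powi n)\<rparr>"

definition underlying_group :: "('b, 'c) ring_scheme \<Rightarrow> (int, 'b) module" where
  "underlying_group A = \<lparr>carrier = carrier A, monoid.mult = undefined, monoid.one = undefined,
     ring.zero = \<zero>\<^bsub>A\<^esub>, ring.add = add A, module.smult = (\<lambda>n x. [n] \<cdot>\<^bsub>A\<^esub> x)\<rparr>"

lemma circle_module: "module \<Z> circle"
proof (rule moduleI)
  show "cring \<Z>" by (rule int_is_cring)
  show "abelian_group circle"
  proof (rule abelian_groupI)
    fix x assume "x \<in> carrier circle"
    moreover from this have "x \<noteq> 0" by (auto simp: circle_def)
    ultimately show "\<exists>y\<in>carrier circle. y \<oplus>\<^bsub>circle\<^esub> x = \<zero>\<^bsub>circle\<^esub>"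
      by (intro bexI[of _ "inverse x"]) (auto simp: circle_def norm_inverse)
  qed (auto simp: circle_def norm_mult)
next
  fix a b :: int and x assume "x \<in> carrier circle"
  then have "x \<noteq> 0" by (auto simp: circle_def)
  then show "(a \<oplus>\<^bsub>\<Z>\<^esub> b) \<odot>\<^bsub>circle\<^esub> x = a \<odot>\<^bsub>circle\<^esub> x \<oplus>\<^bsub>circle\<^esub> b \<odot>\<^bsub>circle\<^esub> x"
    by (simp add: circle_def power_int_add)
qed (auto simp: circle_def norm_power_int power_int_mult_distrib mult.commute simp flip: power_int_mult)

lemma underlying_group_module:
  assumes "abelian_group A"
  shows "module \<Z> (underlying_group A)"
proof -
  interpret A: abelian_group A by fact
  have G: "group (add_monoid A)" "comm_group (add_monoid A)"
    using A.a_comm_group by (auto simp: comm_group_def)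
  have "abelian_group (underlying_group A)"
  proof (rule abelian_groupI)
    fix x assume "x \<in> carrier (underlying_group A)"
    then show "\<exists>y\<in>carrier (underlying_group A). y \<oplus>\<^bsub>underlying_group A\<^esub> x = \<zero>\<^bsub>underlying_group A\<^esub>"
      by (intro bexI[of _ "\<ominus>\<^bsub>A\<^esub> x"]) (auto simp: underlying_group_def A.l_neg)
  qed (auto simp: underlying_group_def A.a_ac)
  then show ?thesis
    by (rule moduleI[OF int_is_cring])
      (use group.int_pow_closed[OF G(1)] group.int_pow_mult[OF G(1)] comm_group.int_pow_distrib[OF G(2)]
        group.int_pow_pow[OF G(1)] group.int_pow_1[OF G(1)]
        in \<open>auto simp: underlying_group_def add_pow_def mult.commute\<close>)
qed

text \<open>Every integer is a sum of copies of \<open>1\<close> or of \<open>- 1\<close>, so additivity determines the action of \<open>\<int>\<close>.\<close>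

lemma int_linear:
  assumes "module \<Z> A" "module \<Z> B" and cl: "\<And>x. x \<in> carrier A \<Longrightarrow> f x \<in> carrier B"
    and add: "\<And>x y. x \<in> carrier A \<Longrightarrow> y \<in> carrier A \<Longrightarrow> f (x \<oplus>\<^bsub>A\<^esub> y) = f x \<oplus>\<^bsub>B\<^esub> f y"
  shows "linear_map \<Z> A B f"
proof (rule linear_mapI)
  interpret A: module \<Z> A by fact
  interpret B: module \<Z> B by fact
  fix n :: int and x assume x: "x \<in> carrier A"
  have f0: "f \<zero>\<^bsub>A\<^esub> = \<zero>\<^bsub>B\<^esub>"
    using add[of "\<zero>\<^bsub>A\<^esub>" "\<zero>\<^bsub>A\<^esub>"] cl[of "\<zero>\<^bsub>A\<^esub>"] by (metis A.M.l_zero A.M.zero_closed B.M.add.r_cancel_one')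
  have sA: "(m + k) \<odot>\<^bsub>A\<^esub> x = m \<odot>\<^bsub>A\<^esub> x \<oplus>\<^bsub>A\<^esub> k \<odot>\<^bsub>A\<^esub> x" for m k
    using A.smult_l_distr[of m k x] x by simp
  have sB: "(m + k) \<odot>\<^bsub>B\<^esub> f x = m \<odot>\<^bsub>B\<^esub> f x \<oplus>\<^bsub>B\<^esub> k \<odot>\<^bsub>B\<^esub> f x" for m k
    using B.smult_l_distr[of m k "f x"] cl[OF x] by simp
  have cA: "m \<odot>\<^bsub>A\<^esub> x \<in> carrier A" and cB: "m \<odot>\<^bsub>B\<^esub> f x \<in> carrier B" for m
    using A.smult_closed[of m x] B.smult_closed[of m "f x"] cl x by auto
  have one: "1 \<odot>\<^bsub>A\<^esub> x = x" "1 \<odot>\<^bsub>B\<^esub> f x = f x"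
    using A.smult_one[of x] B.smult_one[of "f x"] x cl by auto
  show "f (n \<odot>\<^bsub>A\<^esub> x) = n \<odot>\<^bsub>B\<^esub> f x"
  proof (induction n rule: int_induct[where k = 0])
    case base
    then show ?case using A.smult_l_null[of x] B.smult_l_null[of "f x"] x cl f0 by simp
  next
    case (step1 i)
    then show ?case by (simp add: sA sB add cA x one)
  next
    case (step2 i)
    have "f (i \<odot>\<^bsub>A\<^esub> x) = f ((i - 1) \<odot>\<^bsub>A\<^esub> x) \<oplus>\<^bsub>B\<^esub> f x"
      using sA[of "i - 1" 1] by (simp add: add cA x one)
    moreover have "i \<odot>\<^bsub>B\<^esub> f x = (i - 1) \<odot>\<^bsub>B\<^esub> f x \<oplus>\<^bsub>B\<^esub> f x"
      using sB[of "i - 1" 1] by (simp add: one)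
    ultimately have "f ((i - 1) \<odot>\<^bsub>A\<^esub> x) \<oplus>\<^bsub>B\<^esub> f x = (i - 1) \<odot>\<^bsub>B\<^esub> f x \<oplus>\<^bsub>B\<^esub> f x"
      using step2 by simp
    then show ?case using cA cB x cl by (metis B.M.add.r_cancel)
  qed
qed fact+

lemma int_ideal_principal:
  assumes "ideal J \<Z>"
  obtains d :: nat where "int d \<in> J" "\<And>r. r \<in> J \<Longrightarrow> int d dvd r"
proof -
  interpret J: ideal J \<Z> by fact
  have zero: "0 \<in> J" using J.zero_closed by simp
  have add: "r + s \<in> J" if "r \<in> J" "s \<in> J" for r s using J.a_closed[OF that] by simp
  have sm: "a * r \<in> J" if "r \<in> J" for a r using J.I_l_closed[OF that, of a] by simp
  show ?thesis
  proof (cases "\<exists>d>0. int d \<in> J")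
    case False
    have "r = 0" if "r \<in> J" for r
      using False that sm[OF that, of "-1"] by (metis linorder_neqE_linordered_idom mult_minus1
          neg_0_less_iff_less of_nat_0_less_iff zero_less_imp_eq_int)
    then show ?thesis using that[of 0] zero by auto
  next
    case True
    define d where "d = (LEAST d. d > 0 \<and> int d \<in> J)"
    have d: "d > 0" "int d \<in> J" using LeastI_ex[OF True] by (auto simp: d_def)
    have "int d dvd r" if "r \<in> J" for r
    proof -
      have "r mod int d = r + (- (r div int d)) * int d"
        by (simp add: minus_div_mult_eq_mod [symmetric])
      then have "r mod int d \<in> J" using add[OF that sm[OF d(2), of "- (r div int d)"]] by simp
      moreover have "r mod int d = int (nat (r mod int d))" "nat (r mod int d) < d"
        using d(1) by (simp_all add: nat_less_iff)
      ultimately have "nat (r mod int d) = 0"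
        using not_less_Least[of "nat (r mod int d)" "\<lambda>d. d > 0 \<and> int d \<in> J"] unfolding d_def[symmetric]
        by (metis gr0I)
      then have "r mod int d = 0" using \<open>r mod int d = int (nat (r mod int d))\<close> by simp
      then show ?thesis by (simp add: dvd_eq_mod_eq_0)
    qed
    then show ?thesis using that d by blast
  qed
qed

lemma circle_root:
  assumes "norm (z :: complex) = 1" "n > 0"
  obtains w where "norm w = 1" "w ^ n = z"
proof
  show "norm (cis (Arg z / n)) = 1" by simp
  have "z \<noteq> 0" using assms by auto
  then show "cis (Arg z / n) ^ n = z"
    using assms by (simp add: DeMoivre cis_Arg sgn_div_norm)
qed

text \<open>
  A linear map from \<open>d\<int>\<close> to the circle is determined by its value at \<open>d\<close>; a \<open>d\<close>-th root of that value
  extends it to \<open>\<int>\<close>.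
\<close>

lemma circle_baer: "baer_injective \<Z> circle"
  unfolding baer_injective_def
proof (intro allI impI)
  fix J f assume J: "ideal J \<Z>" and f: "linear_map \<Z> ((regular_module \<Z>)\<lparr>carrier := J\<rparr>) circle f"
  obtain d where d: "int d \<in> J" "\<And>r. r \<in> J \<Longrightarrow> int d dvd r" using int_ideal_principal[OF J] by blast
  have fr: "norm (f r) = 1" if "r \<in> J" for r using lm_closed[OF f, of r] that by (simp add: circle_def)
  have fm: "f (k * r) = f r powi k" if "r \<in> J" for k r
    using lm_smult[OF f, of k r] that by (simp add: circle_def regular_module_def)
  have "\<exists>y. norm y = 1 \<and> y ^ d = f (int d)"
  proof (cases "d = 0")
    case True
    then show ?thesis using fm[OF d(1), of 0] by (intro exI[of _ 1]) auto
  next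
    case False
    then show ?thesis using circle_root[of "f (int d)" d] fr[OF d(1)] by auto
  qed
  then obtain y where y: "norm y = 1" "y ^ d = f (int d)" by blast
  have "f r = y powi r" if r: "r \<in> J" for r
  proof -
    obtain k where k: "r = k * int d" using d(2)[OF r] by (auto simp: dvd_def mult.commute)
    have "f r = (y powi int d) powi k" using fm[OF d(1), of k] k y by simp
    then show ?thesis using k by (simp add: mult.commute[of k] power_int_mult)
  qed
  then show "\<exists>y\<in>carrier circle. \<forall>r\<in>J. f r = r \<odot>\<^bsub>circle\<^esub> y"
    using y by (auto simp: circle_def)
qed

text \<open>
  The cyclic group generated by \<open>m\<close> is \<open>\<int>/d\<int>\<close> with \<open>d \<noteq> 1\<close>. It has a character that sends \<open>m\<close> to a
  primitive \<open>d\<close>-th root of unity, or to \<open>-1\<close> if \<open>d = 0\<close>, and this character extends to \<open>B\<close>.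
\<close>

lemma characters_separate:
  assumes B: "module \<Z> B" and m: "m \<in> carrier B" "m \<noteq> \<zero>\<^bsub>B\<^esub>"
  obtains \<chi> where "linear_map \<Z> B circle \<chi>" "\<chi> m \<noteq> 1"
proof -
  interpret B: module \<Z> B by fact
  have reg: "module \<Z> (regular_module \<Z>)"
    by (rule moduleI, rule int_is_cring, rule abelian_groupI)
      (auto simp: regular_module_def algebra_simps intro: exI[of _ "- _"])
  have g: "linear_map \<Z> (regular_module \<Z>) B (\<lambda>n. n \<odot>\<^bsub>B\<^esub> m)"
    using B.smult_closed[of _ m] B.smult_l_distr[of _ _ m] B.smult_assoc1[of _ _ m] m
    by (intro linear_mapI) (auto simp: regular_module_def)
  have "ideal {n. n \<odot>\<^bsub>B\<^esub> m = \<zero>\<^bsub>B\<^esub>} \<Z>"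
    using B.smult_l_distr[of _ _ m] B.smult_assoc1[of _ _ m] B.smult_r_null B.smult_l_null[of m] m
    by (intro ideal_intro[OF int_is_cring]) auto
  then obtain d where d: "int d \<odot>\<^bsub>B\<^esub> m = \<zero>\<^bsub>B\<^esub>" "\<And>r. r \<odot>\<^bsub>B\<^esub> m = \<zero>\<^bsub>B\<^esub> \<Longrightarrow> int d dvd r"
    by (rule int_ideal_principal) auto
  have d1: "d \<noteq> 1" using d(1) B.smult_one[of m] m by auto
  have "\<exists>z::complex. norm z = 1 \<and> z \<noteq> 1 \<and> z ^ d = 1"
  proof (cases "d = 0")
    case True
    then show ?thesis by (intro exI[of _ "-1"]) auto
  next
    case False
    have "cis (2 * pi / d) \<noteq> 1"
    proof
      assume "cis (2 * pi / d) = 1"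
      then have "cos (2 * pi / d) = 1" by (simp add: complex_eq_iff)
      then obtain n :: int where "2 * pi / d = n * 2 * pi" by (auto simp: cos_one_2pi_int)
      then have "real_of_int n * real d = 1" using False by (simp add: field_simps)
      then have "n * int d = 1" by (metis of_int_1 of_int_eq_iff of_int_mult of_int_of_nat_eq)
      then show False using d1 by (simp add: zmult_eq_1_iff)
    qed
    then show ?thesis using False by (intro exI[of _ "cis (2 * pi / d)"]) (auto simp: DeMoivre)
  qed
  then obtain z :: complex where z: "norm z = 1" "z \<noteq> 1" "z ^ d = 1" by blast
  then have "z \<noteq> 0" by auto
  have h: "linear_map \<Z> (regular_module \<Z>) circle (\<lambda>n. z powi n)"
    using z \<open>z \<noteq> 0\<close> by (intro int_linear reg circle_module) (auto simp: regular_module_def circle_def norm_power_int power_int_add)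
  obtain \<chi> where \<chi>: "linear_map \<Z> B circle \<chi>" "\<And>n. n \<in> carrier (regular_module \<Z>) \<Longrightarrow> \<chi> (n \<odot>\<^bsub>B\<^esub> m) = z powi n"
  proof (rule baer_extension[OF reg B circle_module circle_baer g h])
    fix n assume "n \<odot>\<^bsub>B\<^esub> m = \<zero>\<^bsub>B\<^esub>"
    then obtain k where "n = int d * k" using d(2) by (metis dvdE)
    then show "z powi n = \<zero>\<^bsub>circle\<^esub>" using z by (simp add: power_int_mult circle_def)
  qed blast
  have "\<chi> m = z" using \<chi>(2)[of 1] B.smult_one[of m] m by (simp add: regular_module_def)
  then show ?thesis using that \<chi>(1) z(2) by blast
qed

section \<open>An injective module containing a given one\<close>

text \<open>
  The product of copies of the character group of \<open>R\<close>, indexed by \<open>\<chi>\<close>. The intended indices are the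
  characters of a module with carrier in \<open>'b\<close>; ranging over all functions makes the construction
  independent of the operations of that module. The value \<open>1\<close> outside \<open>R\<close> makes
  equality of elements equality of functions.
\<close>

definition character_module :: "('a, 'r) ring_scheme \<Rightarrow> ('a, ('b \<Rightarrow> complex) \<Rightarrow> 'a \<Rightarrow> complex) module" where
  "character_module R =
     \<lparr>carrier = {F. (\<forall>\<chi>. \<forall>r\<in>carrier R. norm (F \<chi> r) = 1) \<and> (\<forall>\<chi>. \<forall>r. r \<notin> carrier R \<longrightarrow> F \<chi> r = 1) \<and>
        (\<forall>\<chi>. \<forall>r\<in>carrier R. \<forall>s\<in>carrier R. F \<chi> (r \<oplus>\<^bsub>R\<^esub> s) = F \<chi> r * F \<chi> s)},
      monoid.mult = undefined, monoid.one = undefined,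
      ring.zero = (\<lambda>\<chi> r. 1), ring.add = (\<lambda>F G \<chi> r. F \<chi> r * G \<chi> r),
      module.smult = (\<lambda>a F \<chi> r. if r \<in> carrier R then F \<chi> (a \<otimes>\<^bsub>R\<^esub> r) else 1)\<rparr>"

lemma character_module_module:
  fixes R (structure)
  assumes "cring R"
  shows "module R (character_module R)"
proof -
  interpret cring R by fact
  let ?E = "character_module R"
  have "abelian_group ?E"
  proof (rule abelian_groupI)
    fix F assume F: "F \<in> carrier ?E"
    have "norm (F \<chi> r) = 1" for \<chi> r using F by (cases "r \<in> carrier R") (auto simp: character_module_def)
    then have nz: "F \<chi> r \<noteq> 0" for \<chi> r by (metis norm_zero zero_neq_one)
    show "\<exists>G\<in>carrier ?E. G \<oplus>\<^bsub>?E\<^esub> F = \<zero>\<^bsub>?E\<^esub>"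
      using F nz by (intro bexI[of _ "\<lambda>\<chi> r. inverse (F \<chi> r)"]) (auto simp: character_module_def norm_inverse)
  qed (auto simp: character_module_def norm_mult fun_eq_iff)
  then show ?thesis
    by (rule moduleI[OF assms])
      (auto simp: character_module_def fun_eq_iff l_distr r_distr m_ac)
qed

text \<open>
  A linear map \<open>f\<close> from \<open>J\<close> to this module is the same as a family of additive maps
  \<open>r \<mapsto> f r \<chi> 1\<close> from \<open>J\<close> to the circle. As the circle is injective over \<open>\<int>\<close>, they extend to \<open>R\<close>, and the family of
  extensions is the required element.
\<close>

lemma character_module_baer:
  fixes R (structure)
  assumes R: "cring R"
  shows "baer_injective R (character_module R :: ('a, ('b \<Rightarrow> complex) \<Rightarrow> 'a \<Rightarrow> complex) module)"
  unfolding baer_injective_def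
proof (intro allI impI)
  interpret cring R by fact
  let ?E = "character_module R :: ('a, ('b \<Rightarrow> complex) \<Rightarrow> 'a \<Rightarrow> complex) module"
  fix J f assume J: "ideal J R" and f: "linear_map R ((regular_module R)\<lparr>carrier := J\<rparr>) ?E f"
  interpret J: ideal J R by fact
  let ?U = "underlying_group R"
  have U: "module \<Z> ?U" by (rule underlying_group_module[OF abelian_group_axioms])
  have JU: "submodule J \<Z> ?U"
  proof (rule submodule_intro[OF U])
    fix n :: int and x assume x: "x \<in> J"
    then have "[n] \<cdot> x = ([n] \<cdot> \<one>) \<otimes> x"
      using add_pow_ldistr_int[of \<one> x n] J.Icarr by simp
    also have "\<dots> \<in> J" using x by (intro J.I_l_closed) simp_all
    finally show "n \<odot>\<^bsub>?U\<^esub> x \<in> J" by (simp add: underlying_group_def)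
  qed (auto simp: underlying_group_def J.Icarr)
  have UJ: "module \<Z> (?U\<lparr>carrier := J\<rparr>)" by (rule submodule_module[OF U JU])
  have fE: "f r \<in> carrier ?E" if "r \<in> J" for r using lm_closed[OF f] that by simp
  have "\<exists>k. linear_map \<Z> ?U circle k \<and> (\<forall>r\<in>J. k r = f r \<chi> \<one>)" for \<chi>
  proof -
    have h: "linear_map \<Z> (?U\<lparr>carrier := J\<rparr>) circle (\<lambda>r. f r \<chi> \<one>)"
    proof (rule int_linear[OF UJ circle_module])
      show "f r \<chi> \<one> \<in> carrier circle" if "r \<in> carrier (?U\<lparr>carrier := J\<rparr>)" for r
        using fE[of r] that by (simp add: character_module_def circle_def)
      fix r s assume "r \<in> carrier (?U\<lparr>carrier := J\<rparr>)" "s \<in> carrier (?U\<lparr>carrier := J\<rparr>)"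
      then show "f (r \<oplus>\<^bsub>?U\<lparr>carrier := J\<rparr>\<^esub> s) \<chi> \<one> = f r \<chi> \<one> \<oplus>\<^bsub>circle\<^esub> f s \<chi> \<one>"
        using lm_add[OF f, of r s] by (simp add: regular_module_def underlying_group_def character_module_def circle_def)
    qed
    obtain k where "linear_map \<Z> ?U circle k" "\<And>x. x \<in> carrier (?U\<lparr>carrier := J\<rparr>) \<Longrightarrow> k x = f x \<chi> \<one>"
    proof (rule baer_extension[OF UJ U circle_module circle_baer _ h])
      show "linear_map \<Z> (?U\<lparr>carrier := J\<rparr>) ?U (\<lambda>x. x)"
        by (rule lm_restrict[OF lm_id submodule_subset[OF JU]])
      fix x assume "x \<in> carrier (?U\<lparr>carrier := J\<rparr>)" "x = \<zero>\<^bsub>?U\<^esub>"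
      then show "f x \<chi> \<one> = \<zero>\<^bsub>circle\<^esub>" using lm_zero[OF UJ circle_module h] by simp
    qed blast
    then show ?thesis by auto
  qed
  then obtain k where k: "\<And>\<chi>. linear_map \<Z> ?U circle (k \<chi>)" "\<And>\<chi> r. r \<in> J \<Longrightarrow> k \<chi> r = f r \<chi> \<one>"
    by metis
  define y where "y = (\<lambda>\<chi> r. if r \<in> carrier R then k \<chi> r else 1)"
  have "y \<in> carrier ?E"
    using lm_closed[OF k(1)] lm_add[OF k(1)]
    by (auto simp: y_def character_module_def underlying_group_def circle_def)
  moreover have "f r = r \<odot>\<^bsub>?E\<^esub> y" if r: "r \<in> J" for r
  proof -
    have "f r \<chi> s = k \<chi> (r \<otimes> s)" if s: "s \<in> carrier R" for \<chi> s
    proof -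
      have "k \<chi> (r \<otimes> s) = f (s \<otimes> r) \<chi> \<one>" using k(2)[of "s \<otimes> r" \<chi>] r s J.Icarr by (simp add: m_comm[of r s] J.I_l_closed)
      also have "f (s \<otimes> r) = s \<odot>\<^bsub>?E\<^esub> f r" using lm_smult[OF f s, of r] r by (simp add: regular_module_def)
      finally show ?thesis using s by (simp add: character_module_def)
    qed
    moreover have "f r \<chi> s = 1" if "s \<notin> carrier R" for \<chi> s
      using fE[OF r] that by (simp add: character_module_def)
    ultimately show ?thesis using r J.Icarr by (auto simp: character_module_def y_def fun_eq_iff)
  qed
  ultimately show "\<exists>y\<in>carrier ?E. \<forall>r\<in>J. f r = r \<odot>\<^bsub>?E\<^esub> y" by blast
qed

text \<open>
  The element \<open>m\<close> goes to \<open>(\<chi>, r) \<mapsto> \<chi> (r m)\<close>. This is injective because characters separate points.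
\<close>

lemma embed_character_module:
  fixes R (structure) and M :: "('a, 'b) module"
  assumes M: "module R M"
  obtains e :: "'b \<Rightarrow> ('b \<Rightarrow> complex) \<Rightarrow> 'a \<Rightarrow> complex"
    where "linear_map R M (character_module R) e" "inj_on e (carrier M)"
proof -
  interpret R: cring R by (rule module_cring[OF M])
  interpret M: module R M by fact
  let ?U = "underlying_group M"
  have U: "module \<Z> ?U" by (rule underlying_group_module[OF M.M.abelian_group_axioms])
  define e where "e = (\<lambda>m \<chi> r. if r \<in> carrier R \<and> linear_map \<Z> ?U circle \<chi> then \<chi> (r \<odot>\<^bsub>M\<^esub> m) else 1)"
  have ch: "norm (\<chi> m) = 1" if "linear_map \<Z> ?U circle \<chi>" "m \<in> carrier M" for \<chi> m
    using lm_closed[OF that(1), of m] that by (simp add: underlying_group_def circle_def)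
  have cha: "\<chi> (m \<oplus>\<^bsub>M\<^esub> m') = \<chi> m * \<chi> m'" if "linear_map \<Z> ?U circle \<chi>" "m \<in> carrier M" "m' \<in> carrier M" for \<chi> m m'
    using lm_add[OF that(1), of m m'] that by (simp add: underlying_group_def circle_def)
  have e: "linear_map R M (character_module R) e"
    by (rule linear_mapI) (auto simp: e_def character_module_def fun_eq_iff ch cha M.smult_l_distr M.smult_r_distr
        R.m_comm simp flip: M.smult_assoc1)
  have "inj_on e (carrier M)"
  proof (rule lm_inj[OF M character_module_module[OF R.cring_axioms] e], rule ccontr)
    fix m assume m: "m \<in> carrier M" "e m = \<zero>\<^bsub>character_module R\<^esub>" "m \<noteq> \<zero>\<^bsub>M\<^esub>"
    then obtain \<chi> where "linear_map \<Z> ?U circle \<chi>" "\<chi> m \<noteq> 1"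
      using characters_separate[OF U, of m] by (auto simp: underlying_group_def)
    moreover have "e m \<chi> \<one> = 1" using m(2) by (simp add: character_module_def)
    ultimately show False using m(1) by (simp add: e_def)
  qed
  with e show ?thesis using that by blast
qed

section \<open>Quotients and transport of structure\<close>

lemma submodule_abelian_subgroup:
  assumes "module R M" "submodule N R M"
  shows "abelian_subgroup N M"
proof -
  interpret M: module R M by fact
  show ?thesis
    by (rule abelian_subgroupI3[OF additive_subgroupI[OF submodule.axioms(1)[OF assms(2)]] M.M.abelian_group_axioms])
qed

lemma coset_eq_iff:
  assumes M: "module R M" and N: "submodule N R M" and x: "x \<in> carrier M" and y: "y \<in> carrier M"
  shows "N +>\<^bsub>M\<^esub> x = N +>\<^bsub>M\<^esub> y \<longleftrightarrow> x \<ominus>\<^bsub>M\<^esub> y \<in> N"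
proof -
  interpret M: module R M by fact
  interpret N: abelian_subgroup N M by (rule submodule_abelian_subgroup[OF M N])
  show ?thesis
  proof
    assume "N +>\<^bsub>M\<^esub> x = N +>\<^bsub>M\<^esub> y"
    then have "x \<in> N +>\<^bsub>M\<^esub> y" using N.a_rcos_self[OF x] by simp
    then obtain n where n: "n \<in> N" "x = n \<oplus>\<^bsub>M\<^esub> y" by (auto simp: a_r_coset_def')
    then have "x \<ominus>\<^bsub>M\<^esub> y = n" using y submodule_mem[OF N n(1)]
      by (simp add: a_minus_def M.M.a_assoc M.M.r_neg)
    then show "x \<ominus>\<^bsub>M\<^esub> y \<in> N" using n by simp
  next
    assume d: "x \<ominus>\<^bsub>M\<^esub> y \<in> N"
    have "x = (x \<ominus>\<^bsub>M\<^esub> y) \<oplus>\<^bsub>M\<^esub> y" using x y by (simp add: a_minus_def M.M.a_assoc M.M.l_neg)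
    then have "x \<in> N +>\<^bsub>M\<^esub> y" using d by (auto simp: a_r_coset_def')
    then show "N +>\<^bsub>M\<^esub> x = N +>\<^bsub>M\<^esub> y"
      using N.a_repr_independence' y by metis
  qed
qed

lemma quotient_module_carrier: "carrier (quotient_module M N) = (\<lambda>x. N +>\<^bsub>M\<^esub> x) ` carrier M"
  by (auto simp: quotient_module_def A_RCOSETS_def RCOSETS_def a_r_coset_def)

lemma quotient_module_ops:
  assumes M: "module R M" and N: "submodule N R M"
  shows "\<And>x y. x \<in> carrier M \<Longrightarrow> y \<in> carrier M \<Longrightarrow>
           (N +>\<^bsub>M\<^esub> x) \<oplus>\<^bsub>quotient_module M N\<^esub> (N +>\<^bsub>M\<^esub> y) = N +>\<^bsub>M\<^esub> (x \<oplus>\<^bsub>M\<^esub> y)"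
    and "\<And>a x. a \<in> carrier R \<Longrightarrow> x \<in> carrier M \<Longrightarrow>
           a \<odot>\<^bsub>quotient_module M N\<^esub> (N +>\<^bsub>M\<^esub> x) = N +>\<^bsub>M\<^esub> (a \<odot>\<^bsub>M\<^esub> x)"
    and "\<zero>\<^bsub>quotient_module M N\<^esub> = N +>\<^bsub>M\<^esub> \<zero>\<^bsub>M\<^esub>"
proof -
  interpret M: module R M by fact
  interpret N: abelian_subgroup N M by (rule submodule_abelian_subgroup[OF M N])
  show "(N +>\<^bsub>M\<^esub> x) \<oplus>\<^bsub>quotient_module M N\<^esub> (N +>\<^bsub>M\<^esub> y) = N +>\<^bsub>M\<^esub> (x \<oplus>\<^bsub>M\<^esub> y)"
    if "x \<in> carrier M" "y \<in> carrier M" for x y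
    using N.a_rcos_sum[OF that] by (simp add: quotient_module_def)
  show "a \<odot>\<^bsub>quotient_module M N\<^esub> (N +>\<^bsub>M\<^esub> x) = N +>\<^bsub>M\<^esub> (a \<odot>\<^bsub>M\<^esub> x)"
    if a: "a \<in> carrier R" and x: "x \<in> carrier M" for a x
  proof -
    have "N +>\<^bsub>M\<^esub> (a \<odot>\<^bsub>M\<^esub> y) = N +>\<^bsub>M\<^esub> (a \<odot>\<^bsub>M\<^esub> x)" if y: "y \<in> N +>\<^bsub>M\<^esub> x" for y
    proof -
      obtain n where n: "n \<in> N" "y = n \<oplus>\<^bsub>M\<^esub> x" using y by (auto simp: a_r_coset_def')
      have "a \<odot>\<^bsub>M\<^esub> y \<ominus>\<^bsub>M\<^esub> a \<odot>\<^bsub>M\<^esub> x = a \<odot>\<^bsub>M\<^esub> n"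
        using n x a submodule_mem[OF N n(1)]
        by (simp add: M.smult_r_distr a_minus_def M.M.a_assoc M.M.r_neg)
      then show ?thesis
        using coset_eq_iff[OF M N, of "a \<odot>\<^bsub>M\<^esub> y" "a \<odot>\<^bsub>M\<^esub> x"] n x a submodule_mem[OF N n(1)] submodule_smult[OF N a n(1)] by simp
    qed
    then have "(\<Union>y\<in>N +>\<^bsub>M\<^esub> x. N +>\<^bsub>M\<^esub> (a \<odot>\<^bsub>M\<^esub> y)) = (\<Union>y\<in>N +>\<^bsub>M\<^esub> x. N +>\<^bsub>M\<^esub> (a \<odot>\<^bsub>M\<^esub> x))"
      by (intro SUP_cong) auto
    moreover have "N +>\<^bsub>M\<^esub> x \<noteq> {}" using N.a_rcos_self[OF x] by blast
    ultimately show ?thesis unfolding quotient_module_def by simp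
  qed
  have "N +>\<^bsub>M\<^esub> \<zero>\<^bsub>M\<^esub> = N" using submodule_mem[OF N] by (auto simp: a_r_coset_def')
  then show "\<zero>\<^bsub>quotient_module M N\<^esub> = N +>\<^bsub>M\<^esub> \<zero>\<^bsub>M\<^esub>" by (simp add: quotient_module_def)
qed

lemma quotient_module_module:
  assumes M: "module R M" and N: "submodule N R M"
  shows "module R (quotient_module M N)"
proof -
  interpret M: module R M by fact
  note ops = quotient_module_ops[OF M N]
  let ?Q = "quotient_module M N"
  have "abelian_group ?Q"
  proof (rule abelian_groupI)
    fix C assume "C \<in> carrier ?Q"
    then obtain x where x: "C = N +>\<^bsub>M\<^esub> x" "x \<in> carrier M" by (auto simp: quotient_module_carrier)
    then show "\<exists>D\<in>carrier ?Q. D \<oplus>\<^bsub>?Q\<^esub> C = \<zero>\<^bsub>?Q\<^esub>"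
      by (intro bexI[of _ "N +>\<^bsub>M\<^esub> (\<ominus>\<^bsub>M\<^esub> x)"]) (auto simp: quotient_module_carrier ops M.M.l_neg)
  next
    show "C \<oplus>\<^bsub>?Q\<^esub> D = D \<oplus>\<^bsub>?Q\<^esub> C" if "C \<in> carrier ?Q" "D \<in> carrier ?Q" for C D
      using that by (auto simp: quotient_module_carrier ops M.M.a_comm)
  qed (auto simp: quotient_module_carrier ops M.M.a_assoc)
  then show ?thesis
    by (rule moduleI[OF M.cring_axioms])
      (auto simp: quotient_module_carrier ops(1,2) M.smult_l_distr M.smult_r_distr M.smult_assoc1)
qed

lemma quotient_projection:
  assumes M: "module R M" and N: "submodule N R M"
  shows "linear_map R M (quotient_module M N) (\<lambda>x. N +>\<^bsub>M\<^esub> x)"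
    and "\<And>x. x \<in> carrier M \<Longrightarrow> N +>\<^bsub>M\<^esub> x = \<zero>\<^bsub>quotient_module M N\<^esub> \<longleftrightarrow> x \<in> N"
proof -
  interpret M: module R M by fact
  show "linear_map R M (quotient_module M N) (\<lambda>x. N +>\<^bsub>M\<^esub> x)"
    by (rule linear_mapI) (auto simp: quotient_module_carrier quotient_module_ops[OF M N])
  show "N +>\<^bsub>M\<^esub> x = \<zero>\<^bsub>quotient_module M N\<^esub> \<longleftrightarrow> x \<in> N" if "x \<in> carrier M" for x
    unfolding quotient_module_ops(3)[OF M N] coset_eq_iff[OF M N that M.M.zero_closed] M.M.minus_right_zero[OF that] ..
qed

definition transport :: "('b \<Rightarrow> 'c) \<Rightarrow> ('a, 'b) module \<Rightarrow> ('a, 'c) module" where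
  "transport h M =
     (let g = inv_into (carrier M) h in
     \<lparr>carrier = h ` carrier M, monoid.mult = undefined, monoid.one = undefined,
      ring.zero = h \<zero>\<^bsub>M\<^esub>, ring.add = (\<lambda>x y. h (g x \<oplus>\<^bsub>M\<^esub> g y)),
      module.smult = (\<lambda>a x. h (a \<odot>\<^bsub>M\<^esub> g x))\<rparr>)"

lemma transport_module:
  assumes M: "module R M" and h: "inj_on h (carrier M)"
  shows "module R (transport h M)" "linear_map R M (transport h M) h" "bij_betw h (carrier M) (carrier (transport h M))"
proof -
  interpret M: module R M by fact
  let ?T = "transport h M"
  note [simp] = transport_def Let_def inv_into_f_f[OF h]
  have "abelian_group ?T"
  proof (rule abelian_groupI)
    fix y assume "y \<in> carrier ?T"
    then obtain x where "y = h x" "x \<in> carrier M" by auto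
    then show "\<exists>z\<in>carrier ?T. z \<oplus>\<^bsub>?T\<^esub> y = \<zero>\<^bsub>?T\<^esub>"
      by (intro bexI[of _ "h (\<ominus>\<^bsub>M\<^esub> x)"]) (auto simp: M.M.l_neg)
  qed (auto simp: M.M.a_ac)
  then show "module R ?T"
    by (rule moduleI[OF M.cring_axioms]) (auto simp: M.smult_l_distr M.smult_r_distr M.smult_assoc1)
  show "linear_map R M ?T h" by (rule linear_mapI) auto
  show "bij_betw h (carrier M) (carrier ?T)" using h by (simp add: bij_betw_def)
qed

lemma isomorphic_in_universe:
  fixes M :: "('a, 'b) module"
  assumes "module R M" "carrier M \<lesssim> (UNIV :: 'm set)"
  obtains N :: "('a, 'm) module" and h where "module R N" "linear_map R M N h" "bij_betw h (carrier M) (carrier N)"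
proof -
  obtain h :: "'b \<Rightarrow> 'm" where "inj_on h (carrier M)" using assms(2) by (auto simp: lepoll_def)
  then show ?thesis using transport_module[OF assms(1)] that by blast
qed

lemma lm_inverse:
  assumes M: "module R M" and f: "linear_map R M N f" and b: "bij_betw f (carrier M) (carrier N)"
  shows "linear_map R N M (inv_into (carrier M) f)"
proof -
  interpret M: module R M by fact
  have inj: "inj_on f (carrier M)" and im: "carrier N = f ` carrier M" using b by (auto simp: bij_betw_def)
  note [simp] = inv_into_f_f[OF inj]
  show ?thesis
    by (rule linear_mapI) (auto simp: im simp flip: lm_add[OF f] lm_smult[OF f])
qed

text \<open>
  Allows a quotient to be handled through a surjection \<open>q\<close> to a module in the universe, without cosets.
\<close>

lemma quotient_in_universe:
  fixes M :: "('a, 'b) module"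
  assumes M: "module R M" and N: "submodule N R M" and "carrier M \<lesssim> (UNIV :: 'm set)"
  obtains Q :: "('a, 'm) module" and q where "module R Q" "linear_map R M Q q" "q ` carrier M = carrier Q"
    "\<And>x. x \<in> carrier M \<Longrightarrow> q x = \<zero>\<^bsub>Q\<^esub> \<longleftrightarrow> x \<in> N"
proof -
  let ?Q = "quotient_module M N"
  have Q: "module R ?Q" by (rule quotient_module_module[OF M N])
  have "carrier ?Q \<lesssim> (UNIV :: 'm set)"
    unfolding quotient_module_carrier by (rule lepoll_trans[OF image_lepoll assms(3)])
  then obtain P :: "('a, 'm) module" and h where P: "module R P" "linear_map R ?Q P h" "bij_betw h (carrier ?Q) (carrier P)"
    using isomorphic_in_universe[OF Q] by blast
  let ?q = "\<lambda>x. h (N +>\<^bsub>M\<^esub> x)"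
  have "linear_map R M P ?q" by (rule lm_comp[OF quotient_projection(1)[OF M N] P(2)])
  moreover have "?q ` carrier M = carrier P"
    using P(3) by (auto simp: bij_betw_def quotient_module_carrier)
  moreover have "?q x = \<zero>\<^bsub>P\<^esub> \<longleftrightarrow> x \<in> N" if x: "x \<in> carrier M" for x
  proof -
    have "?q x = \<zero>\<^bsub>P\<^esub> \<longleftrightarrow> ?q x = h \<zero>\<^bsub>?Q\<^esub>" using lm_zero[OF Q P(1,2)] by simp
    also have "\<dots> \<longleftrightarrow> N +>\<^bsub>M\<^esub> x = \<zero>\<^bsub>?Q\<^esub>"
    proof (rule inj_on_eq_iff)
      show "inj_on h (carrier ?Q)" using P(3) by (simp add: bij_betw_def)
      show "N +>\<^bsub>M\<^esub> x \<in> carrier ?Q" using x by (simp add: quotient_module_carrier)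
      show "\<zero>\<^bsub>?Q\<^esub> \<in> carrier ?Q" by (rule submodule_zero[OF submodule_carrier[OF Q]])
    qed
    finally show ?thesis using quotient_projection(2)[OF M N x] by simp
  qed
  ultimately show ?thesis using that P(1) by blast
qed

section \<open>Cardinality in an infinite universe\<close>

lemma pairing_exists:
  assumes "infinite (UNIV :: 'm set)"
  obtains f :: "'m \<times> 'm \<Rightarrow> 'm" where "bij f"
proof -
  have "ordIso2 (card_of (UNIV \<times> UNIV :: ('m \<times> 'm) set)) (card_of (UNIV :: 'm set))"
    by (rule card_of_Times_same_infinite[OF assms])
  then show ?thesis using that by (auto simp flip: card_of_ordIso)
qed

lemma times_lepoll_universe:
  assumes "infinite (UNIV :: 'm set)" "A \<lesssim> (UNIV :: 'm set)" "B \<lesssim> (UNIV :: 'm set)"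
  shows "A \<times> B \<lesssim> (UNIV :: 'm set)"
proof -
  obtain f :: "'m \<times> 'm \<Rightarrow> 'm" where f: "bij f" using pairing_exists[OF assms(1)] .
  have "A \<times> B \<lesssim> (UNIV :: 'm set) \<times> (UNIV :: 'm set)" by (rule times_lepoll_mono[OF assms(2,3)])
  also have "\<dots> \<lesssim> (UNIV :: 'm set)" using f by (auto simp: lepoll_def bij_def)
  finally show ?thesis .
qed

text \<open>
  A list is encoded by its length and its elements, nested as pairs; the length is needed because the
  code of the empty list may also be a pair.
\<close>

lemma lists_lepoll_universe:
  assumes "infinite (UNIV :: 'm set)" "A \<lesssim> (UNIV :: 'm set)"
  shows "lists A \<lesssim> (UNIV :: 'm set)"
proof -
  obtain f :: "'m \<times> 'm \<Rightarrow> 'm" where f: "bij f" using pairing_exists[OF assms(1)] .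
  obtain n :: "nat \<Rightarrow> 'm" where n: "inj n" using assms(1) by (auto simp: infinite_le_lepoll lepoll_def)
  define enc where "enc = rec_list undefined (\<lambda>x _ c. f (x, c))"
  have [simp]: "enc (x # xs) = f (x, enc xs)" for x xs by (simp add: enc_def)
  have enc: "xs = ys" if "length xs = length ys" "enc xs = enc ys" for xs ys
    using that f by (induction xs ys rule: list_induct2) (auto simp: bij_def inj_eq)
  have "inj (\<lambda>xs. f (n (length xs), enc xs))"
  proof (rule injI)
    fix xs ys assume "f (n (length xs), enc xs) = f (n (length ys), enc ys)"
    then have "(n (length xs), enc xs) = (n (length ys), enc ys)" using f by (metis bij_is_inj injD)
    then show "xs = ys" using enc injD[OF n] by blast
  qed
  then have "lists (UNIV :: 'm set) \<lesssim> (UNIV :: 'm set)" by (auto simp: lepoll_def)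
  then show ?thesis by (rule lepoll_trans[OF lists_lepoll_mono[OF assms(2)]])
qed

lemma UN_nat_lepoll_universe:
  assumes "infinite (UNIV :: 'm set)" "\<And>n :: nat. A n \<lesssim> (UNIV :: 'm set)"
  shows "(\<Union>n. A n) \<lesssim> (UNIV :: 'm set)"
proof -
  have "\<forall>n. \<exists>g :: 'm \<Rightarrow> _. A n \<subseteq> range g" using assms(2) by (simp add: lepoll_iff)
  then obtain g :: "nat \<Rightarrow> 'm \<Rightarrow> _" where g: "\<And>n. A n \<subseteq> range (g n)" by metis
  have "(\<Union>n. A n) \<lesssim> (UNIV :: nat set) \<times> (UNIV :: 'm set)"
    by (rule subset_image_lepoll[of _ "\<lambda>(n, m). g n m"]) (use g in force)
  also have "\<dots> \<lesssim> (UNIV :: 'm set)"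
    using assms(1) by (intro times_lepoll_universe) (auto simp: infinite_le_lepoll)
  finally show ?thesis .
qed

section \<open>Injective modules of bounded cardinality\<close>

text \<open>
  Finite systems of equations \<open>a y = b u + v\<close> for \<open>y\<close>. With \<open>a = 1\<close> their solutions include sums and
  scalar multiples; with \<open>b = 0\<close> they describe the elements that induce a given map on a finitely generated ideal.
\<close>

definition solves :: "('a, 'r) ring_scheme \<Rightarrow> ('a, 'e) module \<Rightarrow> ('a \<times> 'a \<times> 'e \<times> 'e) list \<Rightarrow> 'e \<Rightarrow> bool" where
  "solves R E ps y \<longleftrightarrow> y \<in> carrier E \<and> (\<forall>(a, b, u, v)\<in>set ps. a \<odot>\<^bsub>E\<^esub> y = b \<odot>\<^bsub>E\<^esub> u \<oplus>\<^bsub>E\<^esub> v)"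

text \<open>
  Each stage adds one solution of each solvable system with parameters in the previous stage. The union of the
  stages is a Skolem hull for the language of modules.
\<close>

fun hull_stage :: "('a, 'r) ring_scheme \<Rightarrow> ('a, 'e) module \<Rightarrow> 'e set \<Rightarrow> nat \<Rightarrow> 'e set" where
  "hull_stage R E G 0 = G"
| "hull_stage R E G (Suc n) = (\<lambda>ps. Eps (solves R E ps)) `
     {ps \<in> lists (carrier R \<times> carrier R \<times> hull_stage R E G n \<times> hull_stage R E G n). \<exists>y. solves R E ps y}"

lemma hull_stage_subset:
  assumes "G \<subseteq> carrier E"
  shows "hull_stage R E G n \<subseteq> carrier E"
proof (cases n)
  case (Suc k)
  have "Eps (solves R E ps) \<in> carrier E" if "\<exists>y. solves R E ps y" for ps
  proof -
    have "solves R E ps (Eps (solves R E ps))" using that by (rule someI_ex)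
    then show ?thesis unfolding solves_def[of R E ps "Eps (solves R E ps)"] by blast
  qed
  then show ?thesis using Suc by auto
qed (use assms in simp)

lemma hull_stage_lepoll:
  assumes "infinite (UNIV :: 'm set)" "G \<lesssim> (UNIV :: 'm set)" "carrier R \<lesssim> (UNIV :: 'm set)"
  shows "hull_stage R E G n \<lesssim> (UNIV :: 'm set)"
proof (induction n)
  case (Suc n)
  let ?H = "hull_stage R E G n"
  have "{ps \<in> lists (carrier R \<times> carrier R \<times> ?H \<times> ?H). \<exists>y. solves R E ps y} \<lesssim>
      lists (carrier R \<times> carrier R \<times> ?H \<times> ?H)"
    by (intro subset_imp_lepoll) auto
  also have "\<dots> \<lesssim> (UNIV :: 'm set)"
    by (intro lists_lepoll_universe times_lepoll_universe assms Suc.IH)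
  finally show ?case unfolding hull_stage.simps by (rule lepoll_trans[OF image_lepoll])
qed (use assms in simp)

lemma hull_stage_solution:
  fixes R (structure)
  assumes E: "module R E" and G: "G \<subseteq> carrier E"
    and ps: "set ps \<subseteq> carrier R \<times> carrier R \<times> hull_stage R E G n \<times> hull_stage R E G n" and "solves R E ps y"
  obtains z where "z \<in> hull_stage R E G (Suc n)" "solves R E ps z"
proof -
  have "Eps (solves R E ps) \<in> hull_stage R E G (Suc n)"
    using assms unfolding hull_stage.simps by (intro imageI) auto
  moreover have "solves R E ps (Eps (solves R E ps))" using assms(4) by (rule someI)
  ultimately show ?thesis using that by blast
qed

lemma hull_stage_unit_solution:
  fixes R (structure)
  assumes E: "module R E" and G: "G \<subseteq> carrier E"
    and b: "b \<in> carrier R" and u: "u \<in> hull_stage R E G n" and v: "v \<in> hull_stage R E G n"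
  shows "b \<odot>\<^bsub>E\<^esub> u \<oplus>\<^bsub>E\<^esub> v \<in> hull_stage R E G (Suc n)"
proof -
  interpret E: module R E by fact
  have uv: "u \<in> carrier E" "v \<in> carrier E" using hull_stage_subset[OF G] u v by auto
  obtain z where "z \<in> hull_stage R E G (Suc n)" "solves R E [(\<one>, b, u, v)] z"
  proof (rule hull_stage_solution[OF E G])
    show "set [(\<one>, b, u, v)] \<subseteq> carrier R \<times> carrier R \<times> hull_stage R E G n \<times> hull_stage R E G n"
      using b u v by simp
    show "solves R E [(\<one>, b, u, v)] (b \<odot>\<^bsub>E\<^esub> u \<oplus>\<^bsub>E\<^esub> v)" using b uv by (simp add: solves_def)
  qed blast
  moreover from this(2) have "z = b \<odot>\<^bsub>E\<^esub> u \<oplus>\<^bsub>E\<^esub> v" by (auto simp: solves_def)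
  ultimately show ?thesis by simp
qed

lemma hull_stage_mono:
  fixes R (structure)
  assumes E: "module R E" and G: "G \<subseteq> carrier E" and "m \<le> n"
  shows "hull_stage R E G m \<subseteq> hull_stage R E G n"
proof -
  interpret E: module R E by fact
  have "hull_stage R E G k \<subseteq> hull_stage R E G (Suc k)" for k
  proof
    fix u assume u: "u \<in> hull_stage R E G k"
    then have uE: "u \<in> carrier E" using hull_stage_subset[OF G] by auto
    have "\<zero> \<odot>\<^bsub>E\<^esub> u \<oplus>\<^bsub>E\<^esub> u \<in> hull_stage R E G (Suc k)"
      by (rule hull_stage_unit_solution[OF E G _ u u]) simp
    then show "u \<in> hull_stage R E G (Suc k)" using uE by simp
  qed
  then show ?thesis by (rule lift_Suc_mono_le[OF _ assms(3)])
qed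

lemma injective_module_of_baer:
  fixes E :: "('a, 'm) module"
  assumes E: "module R E" and "baer_injective R E"
  shows "injective_module R E"
  unfolding injective_module_def
proof (intro conjI allI impI E)
  fix A B :: "('a, 'm) module" and u f
  assume A: "module R A" and B: "module R B" and u: "linear_map R A B u" "inj_on u (carrier A)" and f: "linear_map R A E f"
  interpret A: module R A by fact
  have "f x = \<zero>\<^bsub>E\<^esub>" if "x \<in> carrier A" "u x = \<zero>\<^bsub>B\<^esub>" for x
    using that u lm_zero[OF A B u(1)] lm_zero[OF A E f] by (metis A.M.zero_closed inj_onD)
  then obtain k where "linear_map R B E k" "\<And>x. x \<in> carrier A \<Longrightarrow> k (u x) = f x"
    using baer_extension[OF A B E assms(2) u(1) f] by blast
  then show "\<exists>g. linear_map R B E g \<and> (\<forall>x\<in>carrier A. g (u x) = f x)" by blast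
qed

lemma baer_transfer:
  assumes E: "module R E" and b: "baer_injective R E" and F: "module R F"
    and h: "linear_map R E F h" "bij_betw h (carrier E) (carrier F)"
  shows "baer_injective R F"
  unfolding baer_injective_def
proof (intro allI impI)
  fix J f assume J: "ideal J R" and f: "linear_map R ((regular_module R)\<lparr>carrier := J\<rparr>) F f"
  let ?g = "inv_into (carrier E) h"
  have "linear_map R ((regular_module R)\<lparr>carrier := J\<rparr>) E (\<lambda>x. ?g (f x))"
    by (rule lm_comp[OF f lm_inverse[OF E h]])
  then obtain y where y: "y \<in> carrier E" "\<And>r. r \<in> J \<Longrightarrow> ?g (f r) = r \<odot>\<^bsub>E\<^esub> y"
    using b J unfolding baer_injective_def by blast
  have "f r = r \<odot>\<^bsub>F\<^esub> h y" if r: "r \<in> J" for r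
  proof -
    have "f r \<in> h ` carrier E" using lm_closed[OF f, of r] r h(2) by (auto simp: bij_betw_def)
    then have "f r = h (?g (f r))" by (simp add: f_inv_into_f)
    also have "\<dots> = r \<odot>\<^bsub>F\<^esub> h y" using y r ideal.Icarr[OF J r] by (simp add: lm_smult[OF h(1)])
    finally show ?thesis .
  qed
  then show "\<exists>y\<in>carrier F. \<forall>r\<in>J. f r = r \<odot>\<^bsub>F\<^esub> y" using lm_closed[OF h(1) y(1)] by blast
qed

text \<open>
  A linear map from an ideal to the hull is induced by an element of \<open>E\<close>. That this element has the
  right products with finitely many generators of the ideal is a solvable system with parameters in one
  stage, and the chosen solution lies in the next stage.
\<close>

lemma hull_baer:
  fixes R (structure)
  assumes "noetherian_ring R" and E: "module R E" and bE: "baer_injective R E"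
    and G: "submodule G R E"
  defines "H \<equiv> \<Union>n. hull_stage R E G n"
  shows "submodule H R E" "baer_injective R (E\<lparr>carrier := H\<rparr>)"
proof -
  interpret E: module R E by fact
  interpret N: noetherian_ring R by fact
  note GE = submodule_subset[OF G]
  have HE: "H \<subseteq> carrier E" unfolding H_def using hull_stage_subset[OF GE] by auto
  have lin: "b \<odot>\<^bsub>E\<^esub> u \<oplus>\<^bsub>E\<^esub> v \<in> H" if b: "b \<in> carrier R" and uv: "u \<in> H" "v \<in> H" for b u v
  proof -
    obtain m n where "u \<in> hull_stage R E G m" "v \<in> hull_stage R E G n" using uv by (auto simp: H_def)
    then have "u \<in> hull_stage R E G (max m n)" "v \<in> hull_stage R E G (max m n)"
      using hull_stage_mono[OF E GE, of m "max m n"] hull_stage_mono[OF E GE, of n "max m n"] by auto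
    then show ?thesis using hull_stage_unit_solution[OF E GE b] unfolding H_def by blast
  qed
  have zH: "\<zero>\<^bsub>E\<^esub> \<in> H" using submodule_zero[OF G] hull_stage.simps(1)[of R E G] unfolding H_def by blast
  show H: "submodule H R E"
  proof (rule submodule_intro[OF E HE zH])
    show "x \<oplus>\<^bsub>E\<^esub> y \<in> H" if "x \<in> H" "y \<in> H" for x y
      using lin[OF _ that, of \<one>] that HE by (simp add: subset_iff)
    show "a \<odot>\<^bsub>E\<^esub> x \<in> H" if "a \<in> carrier R" "x \<in> H" for a x
      using lin[OF that zH] that HE by (simp add: subset_iff)
  qed
  show "baer_injective R (E\<lparr>carrier := H\<rparr>)"
    unfolding baer_injective_def
  proof (intro allI impI)
    fix J f assume J: "ideal J R" and f: "linear_map R ((regular_module R)\<lparr>carrier := J\<rparr>) (E\<lparr>carrier := H\<rparr>) f"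
    have fH: "f r \<in> H" if "r \<in> J" for r using lm_closed[OF f, of r] that by simp
    obtain y where y: "y \<in> carrier E" "\<And>r. r \<in> J \<Longrightarrow> f r = r \<odot>\<^bsub>E\<^esub> y"
      using bE J lm_expand[OF f HE] unfolding baer_injective_def by blast
    obtain A where A: "A \<subseteq> carrier R" "finite A" "J = Idl A" using N.finetely_gen[OF J] by blast
    have AJ: "A \<subseteq> J" using A E.genideal_self by blast
    have "\<exists>n. f ` A \<subseteq> hull_stage R E G n"
      using \<open>finite A\<close> AJ
    proof (induction A)
      case (insert a A)
      then obtain n where n: "f ` A \<subseteq> hull_stage R E G n" by auto
      obtain m where m: "f a \<in> hull_stage R E G m" using fH[of a] insert.prems by (auto simp: H_def)
      show ?case
        using n m hull_stage_mono[OF E GE, of n "max m n"] hull_stage_mono[OF E GE, of m "max m n"]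
        by (intro exI[of _ "max m n"]) auto
    qed simp
    then obtain n where n: "f ` A \<subseteq> hull_stage R E G n" by blast
    obtain as where as: "set as = A" using \<open>finite A\<close> finite_list by blast
    (* The equation a y = 0 f(a) + f(a); the parameter f(a) with coefficient 0 fills the slot of u. *)
    let ?ps = "map (\<lambda>a. (a, \<zero>, f a, f a)) as"
    have fE: "f r \<in> carrier E" if "r \<in> J" for r using fH[OF that] HE by auto
    obtain z where z: "z \<in> hull_stage R E G (Suc n)" "solves R E ?ps z"
    proof (rule hull_stage_solution[OF E GE])
      show "set ?ps \<subseteq> carrier R \<times> carrier R \<times> hull_stage R E G n \<times> hull_stage R E G n"
        using n A(1) as by auto
      show "solves R E ?ps y" using y fE AJ as by (auto simp: solves_def subset_iff)
    qed blast
    then have zE: "z \<in> carrier E" and zA: "a \<odot>\<^bsub>E\<^esub> z = f a" if "a \<in> A" for a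
      using fE AJ as that by (auto simp: solves_def subset_iff)
    have zE: "z \<in> carrier E" using z(2) by (simp add: solves_def)
    let ?K = "{r \<in> carrier R. r \<odot>\<^bsub>E\<^esub> z = r \<odot>\<^bsub>E\<^esub> y}"
    have "ideal ?K R"
      using y(1) zE by (intro ideal_intro[OF E.cring_axioms]) (auto simp: E.smult_l_distr E.smult_assoc1)
    moreover have "A \<subseteq> ?K" using A(1) zA y(2) AJ by (auto simp: subset_iff)
    ultimately have "J \<subseteq> ?K" unfolding A(3) by (rule E.genideal_minimal)
    then have "\<forall>r\<in>J. f r = r \<odot>\<^bsub>E\<lparr>carrier := H\<rparr>\<^esub> z" using y(2) by auto
    moreover have "z \<in> H" using z(1) unfolding H_def by blast
    ultimately show "\<exists>y\<in>carrier (E\<lparr>carrier := H\<rparr>). \<forall>r\<in>J. f r = r \<odot>\<^bsub>E\<lparr>carrier := H\<rparr>\<^esub> y" by auto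
  qed
qed

lemma embeds_in_injective:
  fixes M :: "('a, 'b) module"
  assumes noeth: "noetherian_ring R" and inf: "infinite (UNIV :: 'm set)" and cR: "carrier R \<lesssim> (UNIV :: 'm set)"
    and M: "module R M" and cM: "carrier M \<lesssim> (UNIV :: 'm set)"
  obtains E :: "('a, 'm) module" and e where "injective_module R E" "linear_map R M E e" "inj_on e (carrier M)"
proof -
  let ?C = "character_module R :: ('a, ('b \<Rightarrow> complex) \<Rightarrow> 'a \<Rightarrow> complex) module"
  have R: "cring R" by (rule module_cring[OF M])
  have C: "module R ?C" "baer_injective R ?C"
    by (rule character_module_module[OF R], rule character_module_baer[OF R])
  obtain e :: "'b \<Rightarrow> ('b \<Rightarrow> complex) \<Rightarrow> 'a \<Rightarrow> complex" where e: "linear_map R M ?C e" "inj_on e (carrier M)"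
    using embed_character_module[OF M] .
  let ?G = "e ` carrier M"
  have G: "submodule ?G R ?C" by (rule lm_image_carrier[OF M C(1) e(1)])
  define H where "H = (\<Union>n. hull_stage R ?C ?G n)"
  note hull = hull_baer[OF noeth C G, folded H_def]
  have GH: "?G \<subseteq> H" using hull_stage.simps(1)[of R ?C ?G] unfolding H_def by blast
  have "H \<lesssim> (UNIV :: 'm set)" unfolding H_def
    by (intro UN_nat_lepoll_universe hull_stage_lepoll inf cR lepoll_trans[OF image_lepoll cM])
  moreover have HM: "module R (?C\<lparr>carrier := H\<rparr>)" by (rule submodule_module[OF C(1) hull(1)])
  ultimately obtain E :: "('a, 'm) module" and h where E: "module R E" "linear_map R (?C\<lparr>carrier := H\<rparr>) E h"
    "bij_betw h (carrier (?C\<lparr>carrier := H\<rparr>)) (carrier E)"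
    using isomorphic_in_universe[OF HM] by auto
  have "injective_module R E"
    by (rule injective_module_of_baer[OF E(1) baer_transfer[OF HM hull(2) E]])
  moreover have "linear_map R M E (\<lambda>x. h (e x))"
    by (rule lm_comp[OF lm_codom[OF e(1) GH] E(2)])
  moreover have "inj_on (\<lambda>x. h (e x)) (carrier M)"
    using comp_inj_on[OF e(2) inj_on_subset[of h H ?G]] E(3) GH by (auto simp: bij_betw_def comp_def)
  ultimately show ?thesis using that by blast
qed

text \<open>
  Embeds \<open>M/K\<close>. The form without quotient is what the construction of a resolution iterates.
\<close>

lemma injective_with_kernel:
  fixes M :: "('a, 'b) module"
  assumes noeth: "noetherian_ring R" and inf: "infinite (UNIV :: 'm set)" and cR: "carrier R \<lesssim> (UNIV :: 'm set)"
    and M: "module R M" and cM: "carrier M \<lesssim> (UNIV :: 'm set)" and K: "submodule K R M"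
  obtains E :: "('a, 'm) module" and e where "injective_module R E" "linear_map R M E e" "a_kernel M E e = K"
proof -
  obtain Q :: "('a, 'm) module" and q where Q: "module R Q" "linear_map R M Q q" "q ` carrier M = carrier Q"
    "\<And>x. x \<in> carrier M \<Longrightarrow> q x = \<zero>\<^bsub>Q\<^esub> \<longleftrightarrow> x \<in> K"
    using quotient_in_universe[OF M K cM] by blast
  have "carrier Q \<lesssim> (UNIV :: 'm set)" by (intro subset_imp_lepoll) simp
  then obtain E :: "('a, 'm) module" and e where E: "injective_module R E" "linear_map R Q E e" "inj_on e (carrier Q)"
    using embeds_in_injective[OF noeth inf cR Q(1)] by blast
  have mE: "module R E" using E(1) by (simp add: injective_module_def)
  have "e (q x) = \<zero>\<^bsub>E\<^esub> \<longleftrightarrow> x \<in> K" if x: "x \<in> carrier M" for x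
  proof -
    have "e (q x) = \<zero>\<^bsub>E\<^esub> \<longleftrightarrow> e (q x) = e \<zero>\<^bsub>Q\<^esub>" using lm_zero[OF Q(1) mE E(2)] by simp
    also have "\<dots> \<longleftrightarrow> q x = \<zero>\<^bsub>Q\<^esub>"
      using E(3) lm_closed[OF Q(2) x] submodule_zero[OF submodule_carrier[OF Q(1)]] by (rule inj_on_eq_iff)
    finally show ?thesis using Q(4)[OF x] by simp
  qed
  then have "a_kernel M E (\<lambda>x. e (q x)) = K"
    using submodule_mem[OF K] by (auto simp: a_kernel_eq)
  then show ?thesis using that E(1) lm_comp[OF Q(2) E(2)] by blast
qed

text \<open>
  Dependent choice of pairs \<open>(I, K)\<close>, where \<open>K\<close> is the image of the previous differential in \<open>I\<close> and so
  the kernel that the next differential must have.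
\<close>

lemma injective_resolution_exists:
  fixes M :: "('a, 'b) module"
  assumes noeth: "noetherian_ring R" and inf: "infinite (UNIV :: 'm set)" and cR: "carrier R \<lesssim> (UNIV :: 'm set)"
    and M: "module R M" and cM: "carrier M \<lesssim> (UNIV :: 'm set)"
  obtains e and E :: "nat \<Rightarrow> ('a, 'm) module" and d where "is_injective_resolution R M e E d"
proof -
  note K = injective_with_kernel[OF noeth inf cR]
  have mI: "module R I" if "injective_module R I" for I :: "('a, 'm) module" using that by (simp add: injective_module_def)
  obtain E0 :: "('a, 'm) module" and e where E0: "injective_module R E0" "linear_map R M E0 e" "inj_on e (carrier M)"
    using embeds_in_injective[OF noeth inf cR M cM] by blast
  define P where "P = (\<lambda>(n::nat) (I :: ('a, 'm) module, K). injective_module R I \<and> submodule K R I \<and> (n = 0 \<longrightarrow> I = E0 \<and> K = e ` carrier M))"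
  define Q where "Q = (\<lambda>(n::nat) (I :: ('a, 'm) module, K) (I' :: ('a, 'm) module, K').
     \<exists>f. linear_map R I I' f \<and> a_kernel I I' f = K \<and> K' = f ` carrier I)"
  have "\<exists>s. \<forall>n. P n (s n) \<and> Q n (s n) (s (Suc n))"
  proof (rule dependent_nat_choice)
    show "\<exists>x. P 0 x"
      using E0 lm_image_carrier[OF M mI[OF E0(1)] E0(2)] by (intro exI[of _ "(E0, e ` carrier M)"]) (simp add: P_def)
    fix x n assume "P n x"
    moreover obtain I K where x: "x = (I, K)" by fastforce
    ultimately have IK: "injective_module R I" "submodule K R I" by (auto simp: P_def)
    have "carrier I \<lesssim> (UNIV :: 'm set)" by (intro subset_imp_lepoll) simp
    then obtain I' :: "('a, 'm) module" and f where f: "injective_module R I'" "linear_map R I I' f" "a_kernel I I' f = K"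
      using K[OF mI[OF IK(1)] _ IK(2)] by blast
    have "submodule (f ` carrier I) R I'" by (rule lm_image_carrier[OF mI[OF IK(1)] mI[OF f(1)] f(2)])
    then show "\<exists>y. P (Suc n) y \<and> Q n x y"
      using f x by (intro exI[of _ "(I', f ` carrier I)"]) (auto simp: P_def Q_def)
  qed
  then obtain s where s: "\<And>n. P n (s n)" "\<And>n. Q n (s n) (s (Suc n))" by blast
  define E where "E n = fst (s n)" for n
  define L where "L n = snd (s n)" for n
  have sE: "s n = (E n, L n)" for n by (simp add: E_def L_def)
  have E: "injective_module R (E n)" for n using s(1)[of n] by (simp add: P_def sE)
  have E0': "E 0 = E0" "L 0 = e ` carrier M" using s(1)[of 0] by (simp_all add: P_def sE)
  have "\<forall>n. \<exists>f. linear_map R (E n) (E (Suc n)) f \<and> a_kernel (E n) (E (Suc n)) f = L n \<and> L (Suc n) = f ` carrier (E n)"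
    using s(2) by (simp add: Q_def sE)
  then obtain d where d: "\<And>n. linear_map R (E n) (E (Suc n)) (d n)" "\<And>n. a_kernel (E n) (E (Suc n)) (d n) = L n"
    "\<And>n. L (Suc n) = d n ` carrier (E n)" by metis
  have "is_injective_resolution R M e E d"
    unfolding is_injective_resolution_def using E d E0 E0' d(2)[of 0] by auto
  then show ?thesis using that by blast
qed

lemma injective_resolution_is_resolution:
  fixes M :: "('a, 'b) module"
  assumes noeth: "noetherian_ring R" and inf: "infinite (UNIV :: 'm set)" and cR: "carrier R \<lesssim> (UNIV :: 'm set)"
    and M: "module R M" and cM: "carrier M \<lesssim> (UNIV :: 'm set)"
    and Ed: "injective_resolution R M = (E :: nat \<Rightarrow> ('a, 'm) module, d)"
  obtains e where "is_injective_resolution R M e E d"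
proof -
  obtain e0 and E0 :: "nat \<Rightarrow> ('a, 'm) module" and d0 where "is_injective_resolution R M e0 E0 d0"
    using injective_resolution_exists[OF noeth inf cR M cM] .
  then have "\<exists>x :: (nat \<Rightarrow> ('a, 'm) module) \<times> (nat \<Rightarrow> 'm \<Rightarrow> 'm). (case x of (E, d) \<Rightarrow> \<exists>e. is_injective_resolution R M e E d)"
    by (intro exI[of _ "(E0, d0)"]) auto
  then have "case injective_resolution R M of (E :: nat \<Rightarrow> ('a, 'm) module, d) \<Rightarrow> \<exists>e. is_injective_resolution R M e E d"
    unfolding injective_resolution_def by (rule someI_ex)
  then show ?thesis using that Ed by auto
qed

text \<open>
  \<open>injective_module\<close> speaks of test modules in the universe only; \<open>A\<close> may live elsewhere because it enters
  only through its image in \<open>B\<close>.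
\<close>

lemma injective_extend:
  fixes B E :: "('a, 'm) module" and A :: "('a, 'b) module"
  assumes E: "injective_module R E" and A: "module R A" and B: "module R B"
    and g: "linear_map R A B g" and h: "linear_map R A E h"
    and ker: "\<And>x. x \<in> carrier A \<Longrightarrow> g x = \<zero>\<^bsub>B\<^esub> \<Longrightarrow> h x = \<zero>\<^bsub>E\<^esub>"
  obtains k where "linear_map R B E k" "\<And>x. x \<in> carrier A \<Longrightarrow> k (g x) = h x"
proof -
  have mE: "module R E" using E by (simp add: injective_module_def)
  let ?I = "B\<lparr>carrier := g ` carrier A\<rparr>"
  have sub: "submodule (g ` carrier A) R B" by (rule lm_image_carrier[OF A B g])
  have I: "module R ?I" by (rule submodule_module[OF B sub])
  have g': "linear_map R A ?I g" by (rule lm_codom[OF g]) simp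
  obtain k0 where k0: "linear_map R ?I E k0" "\<And>x. x \<in> carrier A \<Longrightarrow> k0 (g x) = h x"
    using linear_factor[OF A I mE g' h] ker by auto
  have "linear_map R ?I B (\<lambda>x. x)" by (rule lm_restrict[OF lm_id submodule_subset[OF sub]])
  then obtain k where "linear_map R B E k" "\<forall>x\<in>carrier ?I. k x = k0 x"
    using E I B k0(1) unfolding injective_module_def by (metis inj_on_id2)
  then show ?thesis using that k0(2) by auto
qed

section \<open>Subquotients in a Serre subcategory\<close>

text \<open>
  The quotient \<open>Z/B\<close> belongs to \<open>S\<close>. A surjection from \<open>Z\<close> with kernel \<open>B\<close> stands for it, so that \<open>M\<close>
  may have any carrier type and no cosets occur.
\<close>

definition subquotient_in ::
  "('a, 'r) ring_scheme \<Rightarrow> ('a, 'm) module set \<Rightarrow> ('a, 'b) module \<Rightarrow> 'b set \<Rightarrow> 'b set \<Rightarrow> bool" where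
  "subquotient_in R S M Z B \<longleftrightarrow>
     (\<exists>N\<in>S. \<exists>p. linear_map R (M\<lparr>carrier := Z\<rparr>) N p \<and> p ` Z = carrier N \<and> (\<forall>z\<in>Z. p z = \<zero>\<^bsub>N\<^esub> \<longleftrightarrow> z \<in> B))"

lemma subquotient_inI:
  assumes "N \<in> S" "linear_map R (M\<lparr>carrier := Z\<rparr>) N p" "p ` Z = carrier N"
    and "\<And>z. z \<in> Z \<Longrightarrow> p z = \<zero>\<^bsub>N\<^esub> \<longleftrightarrow> z \<in> B"
  shows "subquotient_in R S M Z B"
  using assms unfolding subquotient_in_def by blast

lemma subquotient_inE:
  assumes "subquotient_in R S M Z B"
  obtains N p where "N \<in> S" "linear_map R (M\<lparr>carrier := Z\<rparr>) N p" "p ` Z = carrier N"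
    "\<And>z. z \<in> Z \<Longrightarrow> p z = \<zero>\<^bsub>N\<^esub> \<longleftrightarrow> z \<in> B"
  using assms unfolding subquotient_in_def by blast

locale serre_class =
  fixes R :: "('a, 'r) ring_scheme" and S :: "('a, 'm) module set"
  assumes cring: "cring R" and serre: "serre_subcategory R S"
begin

lemma S_module: "N \<in> S \<Longrightarrow> module R N"
  using serre by (auto simp: serre_subcategory_def)

lemma S_exact:
  "module R M \<Longrightarrow> module R N \<Longrightarrow> module R L \<Longrightarrow> short_exact R M f N g L \<Longrightarrow> N \<in> S \<longleftrightarrow> M \<in> S \<and> L \<in> S"
  using serre unfolding serre_subcategory_def by blast

lemma S_of_kernel_and_image:
  assumes N: "module R N" and L: "module R L" and p: "linear_map R N L p" "p ` carrier N = carrier L"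
  shows "N \<in> S \<longleftrightarrow> N\<lparr>carrier := {x \<in> carrier N. p x = \<zero>\<^bsub>L\<^esub>}\<rparr> \<in> S \<and> L \<in> S"
proof -
  have K: "submodule {x \<in> carrier N. p x = \<zero>\<^bsub>L\<^esub>} R N" by (rule lm_kernel[OF N L p(1)])
  show ?thesis
    by (rule S_exact[OF submodule_module[OF N K] N L, of "\<lambda>x. x" p])
      (use p lm_restrict[OF lm_id submodule_subset[OF K]] in \<open>auto simp: short_exact_def a_kernel_eq\<close>)
qed

lemma S_submodule:
  assumes N: "N \<in> S" and K: "submodule K R N"
  shows "N\<lparr>carrier := K\<rparr> \<in> S"
proof -
  obtain Q :: "('a, 'm) module" and q where q: "module R Q" "linear_map R N Q q" "q ` carrier N = carrier Q"
    "\<And>x. x \<in> carrier N \<Longrightarrow> q x = \<zero>\<^bsub>Q\<^esub> \<longleftrightarrow> x \<in> K"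
    using quotient_in_universe[OF S_module[OF N] K subset_imp_lepoll] by blast
  have "{x \<in> carrier N. q x = \<zero>\<^bsub>Q\<^esub>} = K" using q(4) submodule_mem[OF K] by auto
  then show ?thesis using S_of_kernel_and_image[OF S_module[OF N] q(1-3)] N by simp
qed

lemma S_image:
  assumes "N \<in> S" "module R L" "linear_map R N L p" "p ` carrier N = carrier L"
  shows "L \<in> S"
  using S_of_kernel_and_image[OF S_module assms(2-4)] assms(1) by blast

text \<open>Submodules of members: \<open>f\<close> embeds \<open>Z/B\<close> into \<open>Z'/B'\<close>.\<close>

lemma subquotient_in_mono:
  assumes "subquotient_in R S M' Z' B'" and M: "module R M" and Z: "submodule Z R M"
    and f: "linear_map R (M\<lparr>carrier := Z\<rparr>) (M'\<lparr>carrier := Z'\<rparr>) f"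
    and B: "\<And>z. z \<in> Z \<Longrightarrow> f z \<in> B' \<longleftrightarrow> z \<in> B"
  shows "subquotient_in R S M Z B"
proof -
  obtain N p where N: "N \<in> S" and p: "linear_map R (M'\<lparr>carrier := Z'\<rparr>) N p" "p ` Z' = carrier N"
    "\<And>z. z \<in> Z' \<Longrightarrow> p z = \<zero>\<^bsub>N\<^esub> \<longleftrightarrow> z \<in> B'"
    using assms(1) by (rule subquotient_inE) blast
  have pf: "linear_map R (M\<lparr>carrier := Z\<rparr>) N (\<lambda>z. p (f z))" by (rule lm_comp[OF f p(1)])
  let ?K = "(\<lambda>z. p (f z)) ` Z"
  have K: "submodule ?K R N"
    using lm_image_carrier[OF submodule_module[OF M Z] S_module[OF N] pf] by simp
  show ?thesis
  proof (rule subquotient_inI[OF S_submodule[OF N K]])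
    show "linear_map R (M\<lparr>carrier := Z\<rparr>) (N\<lparr>carrier := ?K\<rparr>) (\<lambda>z. p (f z))"
      by (rule lm_codom[OF pf]) simp
    show "p (f z) = \<zero>\<^bsub>N\<lparr>carrier := ?K\<rparr>\<^esub> \<longleftrightarrow> z \<in> B" if "z \<in> Z" for z
      using p(3)[of "f z"] lm_closed[OF f, of z] B[OF that] that by simp
  qed simp
qed

text \<open>Quotients of members: \<open>f\<close> maps \<open>Z/B\<close> onto \<open>Y/B'\<close>.\<close>

lemma subquotient_in_image:
  fixes M' :: "('a, 'm) module"
  assumes "subquotient_in R S M Z B" and M: "module R M" and Z: "submodule Z R M"
    and M': "module R M'" and Y: "submodule Y R M'" and B': "submodule B' R M'" "B' \<subseteq> Y"
    and f: "linear_map R (M\<lparr>carrier := Z\<rparr>) (M'\<lparr>carrier := Y\<rparr>) f"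
    and fB: "\<And>z. z \<in> Z \<Longrightarrow> z \<in> B \<Longrightarrow> f z \<in> B'"
    and onto: "\<And>y. y \<in> Y \<Longrightarrow> \<exists>z\<in>Z. \<exists>b\<in>B'. y = f z \<oplus>\<^bsub>M'\<^esub> b"
  shows "subquotient_in R S M' Y B'"
proof -
  obtain N p where N: "N \<in> S" and p: "linear_map R (M\<lparr>carrier := Z\<rparr>) N p" "p ` Z = carrier N"
    "\<And>z. z \<in> Z \<Longrightarrow> p z = \<zero>\<^bsub>N\<^esub> \<longleftrightarrow> z \<in> B"
    using assms(1) by (rule subquotient_inE) blast
  have mY: "module R (M'\<lparr>carrier := Y\<rparr>)" by (rule submodule_module[OF M' Y])
  obtain Q :: "('a, 'm) module" and q where q: "module R Q" "linear_map R (M'\<lparr>carrier := Y\<rparr>) Q q"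
    "q ` Y = carrier Q" "\<And>x. x \<in> Y \<Longrightarrow> q x = \<zero>\<^bsub>Q\<^esub> \<longleftrightarrow> x \<in> B'"
    using quotient_in_universe[OF mY submodule_of_submodule[OF M' Y B'] subset_imp_lepoll] by auto
  interpret Q: module R Q by (rule q(1))
  have fY: "f z \<in> Y" if "z \<in> Z" for z using lm_closed[OF f, of z] that by simp
  obtain k where k: "linear_map R N Q k" "\<And>z. z \<in> Z \<Longrightarrow> k (p z) = q (f z)"
  proof (rule linear_factor[OF submodule_module[OF M Z] S_module[OF N] q(1) p(1) lm_comp[OF f q(2)]])
    show "q (f z) = \<zero>\<^bsub>Q\<^esub>" if "z \<in> carrier (M\<lparr>carrier := Z\<rparr>)" "p z = \<zero>\<^bsub>N\<^esub>" for z
      using that p(3)[of z] fB[of z] q(4)[OF fY, of z] by simp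
  qed (use p in auto)
  have qf: "q (f z \<oplus>\<^bsub>M'\<^esub> b) = q (f z)" if "z \<in> Z" "b \<in> B'" for z b
  proof -
    have "b \<in> Y" using that B'(2) by auto
    then show ?thesis using lm_add[OF q(2), of "f z" b] fY[OF that(1)] q(4)[of b] that lm_closed[OF q(2), of "f z"] by simp
  qed
  have "k ` carrier N = carrier Q"
  proof
    show "k ` carrier N \<subseteq> carrier Q" using lm_closed[OF k(1)] by auto
    show "carrier Q \<subseteq> k ` carrier N"
    proof
      fix w assume "w \<in> carrier Q"
      then obtain y where y: "y \<in> Y" "w = q y" using q(3) by auto
      then obtain z b where zb: "z \<in> Z" "b \<in> B'" "y = f z \<oplus>\<^bsub>M'\<^esub> b" using onto by blast
      then have "w = k (p z)" using y qf k(2) by simp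
      then show "w \<in> k ` carrier N" using zb(1) p(2) by auto
    qed
  qed
  then have "Q \<in> S" by (rule S_image[OF N q(1) k(1)])
  then show ?thesis by (rule subquotient_inI[OF _ q(2-4)])
qed

text \<open>
  The exact sequence \<open>0 \<rightarrow> Y/B \<rightarrow> Z/B \<rightarrow> Z/Y \<rightarrow> 0\<close>, with \<open>Z/B\<close> realised in the universe.
\<close>

lemma subquotient_in_extension:
  fixes M :: "('a, 'm) module"
  assumes ZY: "subquotient_in R S M Z Y" and YB: "subquotient_in R S M Y B" and M: "module R M"
    and Z: "submodule Z R M" and Y: "submodule Y R M" "Y \<subseteq> Z" and B: "submodule B R M" "B \<subseteq> Y"
  shows "subquotient_in R S M Z B"
proof -
  obtain L p where L: "L \<in> S" and p: "linear_map R (M\<lparr>carrier := Z\<rparr>) L p" "p ` Z = carrier L"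
    "\<And>z. z \<in> Z \<Longrightarrow> p z = \<zero>\<^bsub>L\<^esub> \<longleftrightarrow> z \<in> Y"
    using ZY by (rule subquotient_inE) blast
  obtain N r where N: "N \<in> S" and r: "linear_map R (M\<lparr>carrier := Y\<rparr>) N r" "r ` Y = carrier N"
    "\<And>z. z \<in> Y \<Longrightarrow> r z = \<zero>\<^bsub>N\<^esub> \<longleftrightarrow> z \<in> B"
    using YB by (rule subquotient_inE) blast
  have mZ: "module R (M\<lparr>carrier := Z\<rparr>)" and mY: "module R (M\<lparr>carrier := Y\<rparr>)"
    using submodule_module[OF M] Z Y by auto
  have BZ: "submodule B R (M\<lparr>carrier := Z\<rparr>)" using B Y by (intro submodule_of_submodule[OF M Z]) auto
  obtain Q :: "('a, 'm) module" and q where q: "module R Q" "linear_map R (M\<lparr>carrier := Z\<rparr>) Q q"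
    "q ` Z = carrier Q" "\<And>x. x \<in> Z \<Longrightarrow> q x = \<zero>\<^bsub>Q\<^esub> \<longleftrightarrow> x \<in> B"
    using quotient_in_universe[OF mZ BZ subset_imp_lepoll] by auto
  have qY: "linear_map R (M\<lparr>carrier := Y\<rparr>) Q q"
    using lm_restrict[OF q(2), of Y] Y(2) by simp
  obtain i where i: "linear_map R N Q i" "\<And>y. y \<in> Y \<Longrightarrow> i (r y) = q y"
  proof (rule linear_factor[OF mY S_module[OF N] q(1) r(1) qY])
    show "q z = \<zero>\<^bsub>Q\<^esub>" if "z \<in> carrier (M\<lparr>carrier := Y\<rparr>)" "r z = \<zero>\<^bsub>N\<^esub>" for z
      using that r(3)[of z] q(4)[of z] Y(2) by auto
  qed (use r in auto)
  obtain s where s: "linear_map R Q L s" "\<And>z. z \<in> Z \<Longrightarrow> s (q z) = p z"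
  proof (rule linear_factor[OF mZ q(1) S_module[OF L] q(2) p(1)])
    show "p z = \<zero>\<^bsub>L\<^esub>" if "z \<in> carrier (M\<lparr>carrier := Z\<rparr>)" "q z = \<zero>\<^bsub>Q\<^esub>" for z
      using that p(3)[of z] q(4)[of z] B(2) by auto
  qed (use q in auto)
  have "short_exact R N i Q s L"
    unfolding short_exact_def
  proof (intro conjI i(1) s(1))
    show "inj_on i (carrier N)"
    proof (rule lm_inj[OF S_module[OF N] q(1) i(1)])
      fix n assume n: "n \<in> carrier N" "i n = \<zero>\<^bsub>Q\<^esub>"
      then obtain y where y: "y \<in> Y" "n = r y" using r(2) by auto
      then show "n = \<zero>\<^bsub>N\<^esub>" using n i(2) q(4)[of y] r(3)[of y] Y(2) by auto
    qed
    show "i ` carrier N = a_kernel Q L s"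
    proof -
      have "i ` carrier N = q ` Y" using i(2) unfolding r(2)[symmetric] by (auto simp: image_image)
      also have "\<dots> = a_kernel Q L s"
        unfolding a_kernel_eq q(3)[symmetric] using s(2) p(3) Y(2) by auto
      finally show ?thesis .
    qed
    show "s ` carrier Q = carrier L" unfolding q(3)[symmetric] p(2)[symmetric] using s(2) by (auto simp: image_image)
  qed
  then have "Q \<in> S" using S_exact[OF S_module[OF N] q(1) S_module[OF L]] N L by blast
  then show ?thesis by (rule subquotient_inI[OF _ q(2-4)])
qed

text \<open>
  The middle term of an exact sequence \<open>Z1/B1 \<rightarrow> Z2/B2 \<rightarrow> Z3/B3\<close> is an extension of a submodule of the
  third term by a quotient of the first. The intermediate module is the preimage \<open>{z \<in> Z2. g z \<in> B3}\<close>.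
\<close>

lemma subquotient_in_exact:
  fixes M2 :: "('a, 'm) module"
  assumes S1: "subquotient_in R S M1 Z1 B1" and S3: "subquotient_in R S M3 Z3 B3"
    and M1: "module R M1" and M2: "module R M2" and M3: "module R M3"
    and Z1: "submodule Z1 R M1" and Z2: "submodule Z2 R M2" and Z3: "submodule Z3 R M3"
    and B2: "submodule B2 R M2" "B2 \<subseteq> Z2" and B3: "submodule B3 R M3"
    and f: "linear_map R (M1\<lparr>carrier := Z1\<rparr>) (M2\<lparr>carrier := Z2\<rparr>) f"
    and g: "linear_map R (M2\<lparr>carrier := Z2\<rparr>) (M3\<lparr>carrier := Z3\<rparr>) g"
    and fB: "\<And>b. b \<in> B1 \<Longrightarrow> f b \<in> B2" and gB: "\<And>b. b \<in> B2 \<Longrightarrow> g b \<in> B3"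
    and gf: "\<And>z. z \<in> Z1 \<Longrightarrow> g (f z) \<in> B3"
    and ex: "\<And>z. z \<in> Z2 \<Longrightarrow> g z \<in> B3 \<Longrightarrow> \<exists>a\<in>Z1. \<exists>b\<in>B2. z = f a \<oplus>\<^bsub>M2\<^esub> b"
  shows "subquotient_in R S M2 Z2 B2"
proof -
  let ?Y = "{z \<in> Z2. g z \<in> B3}"
  have "submodule {z \<in> carrier (M2\<lparr>carrier := Z2\<rparr>). g z \<in> Z3 \<inter> B3} R (M2\<lparr>carrier := Z2\<rparr>)"
    by (rule lm_preimage[OF submodule_module[OF M2 Z2] submodule_module[OF M3 Z3] g
          submodule_of_submodule[OF M3 Z3 submodule_Int[OF M3 Z3 B3]]]) simp
  moreover have "{z \<in> carrier (M2\<lparr>carrier := Z2\<rparr>). g z \<in> Z3 \<inter> B3} = ?Y" using lm_closed[OF g] by auto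
  ultimately have Y': "submodule ?Y R (M2\<lparr>carrier := Z2\<rparr>)" by simp
  have Y: "submodule ?Y R M2"
    by (rule submodule_intro[OF M2])
      (use submodule_add[OF Y'] submodule_smult[OF Y'] submodule_zero[OF Y'] submodule_mem[OF Z2] in auto)
  have "subquotient_in R S M2 Z2 ?Y"
    by (rule subquotient_in_mono[OF S3 M2 Z2 g]) auto
  moreover have "subquotient_in R S M2 ?Y B2"
  proof (rule subquotient_in_image[OF S1 M1 Z1 M2 Y B2(1)])
    show "B2 \<subseteq> ?Y" using B2(2) gB by auto
    show "linear_map R (M1\<lparr>carrier := Z1\<rparr>) (M2\<lparr>carrier := ?Y\<rparr>) f"
    proof -
      have "linear_map R (M1\<lparr>carrier := Z1\<rparr>) ((M2\<lparr>carrier := Z2\<rparr>)\<lparr>carrier := ?Y\<rparr>) f"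
        using gf lm_closed[OF f] by (intro lm_codom[OF f]) auto
      then show ?thesis by simp
    qed
  qed (use fB ex in auto)
  ultimately show ?thesis
    by (rule subquotient_in_extension[OF _ _ M2 Z2 Y _ B2(1)]) (use B2(2) gB in auto)
qed

lemma subquotient_in_trivial:
  assumes "S \<noteq> {}" and M: "module R M"
    and Z: "submodule Z R M" "submodule B R M" and "Z \<subseteq> B"
  shows "subquotient_in R S M Z B"
proof -
  obtain N where N: "N \<in> S" using assms(1) by blast
  have "N\<lparr>carrier := {\<zero>\<^bsub>N\<^esub>}\<rparr> \<in> S" by (rule S_submodule[OF N submodule_zero_set[OF S_module[OF N]]])
  moreover have "linear_map R (M\<lparr>carrier := Z\<rparr>) (N\<lparr>carrier := {\<zero>\<^bsub>N\<^esub>}\<rparr>) (\<lambda>_. \<zero>\<^bsub>N\<^esub>)"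
    by (rule lm_codom[OF lm_const_zero[OF S_module[OF N]]]) auto
  ultimately show ?thesis
    using submodule_zero[OF Z(1)] assms(5) by (intro subquotient_inI[where p = "\<lambda>_. \<zero>\<^bsub>N\<^esub>"]) auto
qed

end

section \<open>Cochain complexes\<close>

text \<open>
  Complexes are indexed by the integers, so that shifts and cones need no exception in degree \<open>0\<close>.
  A complex that starts in some degree has zero modules below it.
\<close>

type_synonym ('a, 'm) cochain = "(int \<Rightarrow> ('a, 'm) module) \<times> (int \<Rightarrow> 'm \<Rightarrow> 'm)"

abbreviation term_of :: "('a, 'm) cochain \<Rightarrow> int \<Rightarrow> ('a, 'm) module" where "term_of \<equiv> fst"
abbreviation diff_of :: "('a, 'm) cochain \<Rightarrow> int \<Rightarrow> 'm \<Rightarrow> 'm" where "diff_of \<equiv> snd"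

definition cochain_complex :: "('a, 'r) ring_scheme \<Rightarrow> ('a, 'm) cochain \<Rightarrow> bool" where
  "cochain_complex R C \<longleftrightarrow>
     (\<forall>k. module R (term_of C k)) \<and> (\<forall>k. linear_map R (term_of C k) (term_of C (k + 1)) (diff_of C k)) \<and>
     (\<forall>k. \<forall>x\<in>carrier (term_of C k). diff_of C (k + 1) (diff_of C k x) = \<zero>\<^bsub>term_of C (k + 1 + 1)\<^esub>)"

definition cocycles :: "('a, 'm) cochain \<Rightarrow> int \<Rightarrow> 'm set" where
  "cocycles C k = {x \<in> carrier (term_of C k). diff_of C k x = \<zero>\<^bsub>term_of C (k + 1)\<^esub>}"

definition cobounds :: "('a, 'm) cochain \<Rightarrow> int \<Rightarrow> 'm set" where
  "cobounds C k = diff_of C (k - 1) ` carrier (term_of C (k - 1))"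

definition exact_complex :: "('a, 'm) cochain \<Rightarrow> bool" where
  "exact_complex C \<longleftrightarrow> (\<forall>k. cocycles C k \<subseteq> cobounds C k)"

definition chain_map ::
  "('a, 'r) ring_scheme \<Rightarrow> ('a, 'm) cochain \<Rightarrow> ('a, 'm) cochain \<Rightarrow> (int \<Rightarrow> 'm \<Rightarrow> 'm) \<Rightarrow> bool" where
  "chain_map R C D f \<longleftrightarrow>
     (\<forall>k. linear_map R (term_of C k) (term_of D k) (f k)) \<and>
     (\<forall>k. \<forall>x\<in>carrier (term_of C k). f (k + 1) (diff_of C k x) = diff_of D k (f k x))"

text \<open>Stated with sums instead of differences, so that no signs occur in diagram chases.\<close>

definition quasi_iso ::
  "('a, 'r) ring_scheme \<Rightarrow> ('a, 'm) cochain \<Rightarrow> ('a, 'm) cochain \<Rightarrow> (int \<Rightarrow> 'm \<Rightarrow> 'm) \<Rightarrow> bool" where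
  "quasi_iso R C D f \<longleftrightarrow> chain_map R C D f \<and>
     (\<forall>k. \<forall>a\<in>cocycles C k. f k a \<in> cobounds D k \<longrightarrow> a \<in> cobounds C k) \<and>
     (\<forall>k. \<forall>b\<in>cocycles D k. \<exists>a\<in>cocycles C k. \<exists>e\<in>carrier (term_of D (k - 1)).
        b = f k a \<oplus>\<^bsub>term_of D k\<^esub> diff_of D (k - 1) e)"

lemma complexD:
  assumes "cochain_complex R C"
  shows cx_module: "\<And>k. module R (term_of C k)"
    and cx_lin: "\<And>k. linear_map R (term_of C k) (term_of C (k + 1)) (diff_of C k)"
    and cx_dd: "\<And>k x. x \<in> carrier (term_of C k) \<Longrightarrow> diff_of C (k + 1) (diff_of C k x) = \<zero>\<^bsub>term_of C (k + 1 + 1)\<^esub>"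
    and cx_lin': "\<And>k. linear_map R (term_of C (k - 1)) (term_of C k) (diff_of C (k - 1))"
    and cx_lin2: "\<And>k. linear_map R (term_of C (k - 2)) (term_of C (k - 1)) (diff_of C (k - 2))"
    and cx_dd': "\<And>k x. x \<in> carrier (term_of C (k - 1)) \<Longrightarrow> diff_of C k (diff_of C (k - 1) x) = \<zero>\<^bsub>term_of C (k + 1)\<^esub>"
proof -
  show 1: "\<And>k. module R (term_of C k)" and 2: "\<And>k. linear_map R (term_of C k) (term_of C (k + 1)) (diff_of C k)"
    and 3: "\<And>k x. x \<in> carrier (term_of C k) \<Longrightarrow> diff_of C (k + 1) (diff_of C k x) = \<zero>\<^bsub>term_of C (k + 1 + 1)\<^esub>"
    using assms by (auto simp: cochain_complex_def)
  show "linear_map R (term_of C (k - 1)) (term_of C k) (diff_of C (k - 1))" for k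
    using 2[of "k - 1"] by simp
  show "linear_map R (term_of C (k - 2)) (term_of C (k - 1)) (diff_of C (k - 2))" for k
    using 2[of "k - 2"] by (simp add: algebra_simps)
  show "diff_of C k (diff_of C (k - 1) x) = \<zero>\<^bsub>term_of C (k + 1)\<^esub>" if "x \<in> carrier (term_of C (k - 1))" for k x
    using 3[OF that] by simp
qed

lemma chain_mapD:
  assumes "chain_map R C D f"
  shows cm_lin: "\<And>k. linear_map R (term_of C k) (term_of D k) (f k)"
    and cm_comm: "\<And>k x. x \<in> carrier (term_of C k) \<Longrightarrow> f (k + 1) (diff_of C k x) = diff_of D k (f k x)"
    and cm_comm': "\<And>k x. x \<in> carrier (term_of C (k - 1)) \<Longrightarrow> f k (diff_of C (k - 1) x) = diff_of D (k - 1) (f (k - 1) x)"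
proof -
  show "\<And>k. linear_map R (term_of C k) (term_of D k) (f k)" and
    2: "\<And>k x. x \<in> carrier (term_of C k) \<Longrightarrow> f (k + 1) (diff_of C k x) = diff_of D k (f k x)"
    using assms by (auto simp: chain_map_def)
  show "f k (diff_of C (k - 1) x) = diff_of D (k - 1) (f (k - 1) x)" if "x \<in> carrier (term_of C (k - 1))" for k x
    using 2[OF that] by simp
qed

lemma quasi_isoD:
  assumes "quasi_iso R C D f"
  shows qi_map: "chain_map R C D f"
    and qi_inj: "\<And>k a. a \<in> cocycles C k \<Longrightarrow> f k a \<in> cobounds D k \<Longrightarrow> a \<in> cobounds C k"
    and qi_surj: "\<And>k b. b \<in> cocycles D k \<Longrightarrow> \<exists>a\<in>cocycles C k. \<exists>e\<in>carrier (term_of D (k - 1)).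
        b = f k a \<oplus>\<^bsub>term_of D k\<^esub> diff_of D (k - 1) e"
  using assms by (auto simp: quasi_iso_def)

lemma cocycles_submodule: "cochain_complex R C \<Longrightarrow> submodule (cocycles C k) R (term_of C k)"
  unfolding cocycles_def by (rule lm_kernel) (auto simp: complexD)

lemma cobounds_submodule: "cochain_complex R C \<Longrightarrow> submodule (cobounds C k) R (term_of C k)"
  unfolding cobounds_def by (rule lm_image_carrier) (auto simp: complexD)

lemma cobounds_cocycles: "cochain_complex R C \<Longrightarrow> cobounds C k \<subseteq> cocycles C k"
  unfolding cobounds_def cocycles_def using cx_dd'[of R C _ k] lm_closed[OF cx_lin'[of R C k]] by auto

lemma cocyclesI: "x \<in> carrier (term_of C k) \<Longrightarrow> diff_of C k x = \<zero>\<^bsub>term_of C (k + 1)\<^esub> \<Longrightarrow> x \<in> cocycles C k"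
  by (simp add: cocycles_def)

lemma cocyclesD: "x \<in> cocycles C k \<Longrightarrow> x \<in> carrier (term_of C k)"
  "x \<in> cocycles C k \<Longrightarrow> diff_of C k x = \<zero>\<^bsub>term_of C (k + 1)\<^esub>"
  by (simp_all add: cocycles_def)

lemma cobounds_iff: "x \<in> cobounds C k \<longleftrightarrow> (\<exists>y\<in>carrier (term_of C (k - 1)). x = diff_of C (k - 1) y)"
  by (auto simp: cobounds_def)

lemma cm_cocycle:
  assumes C: "cochain_complex R C" and D: "cochain_complex R D" and f: "chain_map R C D f" and x: "x \<in> cocycles C k"
  shows "f k x \<in> cocycles D k"
proof (rule cocyclesI)
  show "f k x \<in> carrier (term_of D k)" using x by (intro lm_closed[OF cm_lin[OF f]]) (rule cocyclesD)
  have "diff_of D k (f k x) = f (k + 1) \<zero>\<^bsub>term_of C (k + 1)\<^esub>"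
    using x cm_comm[OF f, of x k] by (simp add: cocyclesD)
  then show "diff_of D k (f k x) = \<zero>\<^bsub>term_of D (k + 1)\<^esub>"
    using lm_zero[OF cx_module[OF C] cx_module[OF D] cm_lin[OF f]] by simp
qed

lemma cm_cobound:
  assumes f: "chain_map R C D f" and x: "x \<in> cobounds C k"
  shows "f k x \<in> cobounds D k"
  using x lm_closed[OF cm_lin[OF f, of "k - 1"]] cm_comm'[OF f] by (auto simp: cobounds_iff)

lemma cm_restrict_cocycles:
  assumes "cochain_complex R C" "cochain_complex R D" "chain_map R C D f"
  shows "linear_map R ((term_of C k)\<lparr>carrier := cocycles C k\<rparr>) ((term_of D k)\<lparr>carrier := cocycles D k\<rparr>) (f k)"
  using cm_cocycle[OF assms] by (intro lm_restrict2[OF cm_lin[OF assms(3)]]) (auto simp: cocyclesD)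

text \<open>
  This takes the place of subtraction in diagram chases, which then involve sums only and are
  settled by associativity and commutativity.
\<close>

lemma lm_eq_split:
  assumes "module R M" "module R N" "linear_map R M N f" "x \<in> carrier M" "y \<in> carrier M" "f x = f y"
  obtains t where "t \<in> carrier M" "x = y \<oplus>\<^bsub>M\<^esub> t" "f t = \<zero>\<^bsub>N\<^esub>"
proof
  interpret M: module R M by fact
  interpret N: module R N by fact
  show "x \<ominus>\<^bsub>M\<^esub> y \<in> carrier M" using assms by simp
  show "f (x \<ominus>\<^bsub>M\<^esub> y) = \<zero>\<^bsub>N\<^esub>" using assms lm_closed[OF assms(3)] by (simp add: lm_minus[OF assms(1-3)])
  show "x = y \<oplus>\<^bsub>M\<^esub> (x \<ominus>\<^bsub>M\<^esub> y)" using assms by (simp add: a_minus_def M.M.a_lcomm M.M.r_neg)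
qed

section \<open>Cones\<close>

text \<open>
  A bijection between pairs and elements of the universe keeps the modules of iterated cones in the
  universe.
\<close>

locale pairing =
  fixes pr :: "'m \<Rightarrow> 'm \<Rightarrow> 'm" and p1 p2 :: "'m \<Rightarrow> 'm"
  assumes p1_pr [simp]: "p1 (pr u v) = u" and p2_pr [simp]: "p2 (pr u v) = v"
    and pr_p [simp]: "pr (p1 w) (p2 w) = w"
begin

lemma pr_eq_iff [simp]: "pr a b = pr c e \<longleftrightarrow> a = c \<and> b = e"
  by (metis p1_pr p2_pr)

definition pair_module :: "('a, 'm) module \<Rightarrow> ('a, 'm) module \<Rightarrow> ('a, 'm) module" where
  "pair_module M N =
     \<lparr>carrier = {w. p1 w \<in> carrier M \<and> p2 w \<in> carrier N}, monoid.mult = undefined, monoid.one = undefined,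
      ring.zero = pr \<zero>\<^bsub>M\<^esub> \<zero>\<^bsub>N\<^esub>, ring.add = (\<lambda>u v. pr (p1 u \<oplus>\<^bsub>M\<^esub> p1 v) (p2 u \<oplus>\<^bsub>N\<^esub> p2 v)),
      module.smult = (\<lambda>a u. pr (a \<odot>\<^bsub>M\<^esub> p1 u) (a \<odot>\<^bsub>N\<^esub> p2 u))\<rparr>"

lemma pair_module_simps [simp]:
  "w \<in> carrier (pair_module M N) \<longleftrightarrow> p1 w \<in> carrier M \<and> p2 w \<in> carrier N"
  "\<zero>\<^bsub>pair_module M N\<^esub> = pr \<zero>\<^bsub>M\<^esub> \<zero>\<^bsub>N\<^esub>"
  "u \<oplus>\<^bsub>pair_module M N\<^esub> v = pr (p1 u \<oplus>\<^bsub>M\<^esub> p1 v) (p2 u \<oplus>\<^bsub>N\<^esub> p2 v)"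
  "a \<odot>\<^bsub>pair_module M N\<^esub> u = pr (a \<odot>\<^bsub>M\<^esub> p1 u) (a \<odot>\<^bsub>N\<^esub> p2 u)"
  by (simp_all add: pair_module_def)

lemma pair_module_module:
  assumes M: "module R M" and N: "module R N"
  shows "module R (pair_module M N)"
proof -
  interpret M: module R M by fact
  interpret N: module R N by fact
  have "abelian_group (pair_module M N)"
  proof (rule abelian_groupI)
    fix w assume "w \<in> carrier (pair_module M N)"
    then show "\<exists>v\<in>carrier (pair_module M N). v \<oplus>\<^bsub>pair_module M N\<^esub> w = \<zero>\<^bsub>pair_module M N\<^esub>"
      by (intro bexI[of _ "pr (\<ominus>\<^bsub>M\<^esub> p1 w) (\<ominus>\<^bsub>N\<^esub> p2 w)"]) (auto simp: M.M.l_neg N.M.l_neg)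
  qed (auto simp: M.M.a_ac N.M.a_ac)
  then show ?thesis
    by (rule moduleI[OF module_cring[OF M]])
      (auto simp: M.smult_l_distr M.smult_r_distr M.smult_assoc1 N.smult_l_distr N.smult_r_distr N.smult_assoc1)
qed

text \<open>
  The homotopy fibre of a chain map. The sign is a scalar, not the additive inverse of the module,
  because the latter depends on the carrier and would not commute with passage to subcomplexes.
\<close>

definition fibre ::
  "('a, 'r) ring_scheme \<Rightarrow> ('a, 'm) cochain \<Rightarrow> ('a, 'm) cochain \<Rightarrow> (int \<Rightarrow> 'm \<Rightarrow> 'm) \<Rightarrow> ('a, 'm) cochain" where
  "fibre R C D f =
     (\<lambda>k. pair_module (term_of C k) (term_of D (k - 1)),
      \<lambda>k w. pr (diff_of C k (p1 w))
        (f k (p1 w) \<oplus>\<^bsub>term_of D k\<^esub> (\<ominus>\<^bsub>R\<^esub> \<one>\<^bsub>R\<^esub>) \<odot>\<^bsub>term_of D k\<^esub> diff_of D (k - 1) (p2 w)))"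

lemma fibre_d:
  assumes C: "cochain_complex R C" and D: "cochain_complex R D" and f: "chain_map R C D f"
    and w: "p1 w \<in> carrier (term_of C k)" "p2 w \<in> carrier (term_of D (k - 1))"
  shows "diff_of (fibre R C D f) k w =
    pr (diff_of C k (p1 w)) (f k (p1 w) \<ominus>\<^bsub>term_of D k\<^esub> diff_of D (k - 1) (p2 w))"
proof -
  interpret D: module R "term_of D k" by (rule cx_module[OF D])
  show ?thesis
    using lm_closed[OF cx_lin'[OF D] w(2)] by (simp add: fibre_def D.smult_l_minus a_minus_def)
qed

lemma fibre_term [simp]: "term_of (fibre R C D f) k = pair_module (term_of C k) (term_of D (k - 1))"
  by (simp add: fibre_def)

lemma fibre_complex:
  assumes C: "cochain_complex R C" and D: "cochain_complex R D" and f: "chain_map R C D f"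
  shows "cochain_complex R (fibre R C D f)"
  unfolding cochain_complex_def
proof (intro conjI allI ballI)
  fix k
  show "module R (term_of (fibre R C D f) k)" by (simp add: pair_module_module cx_module[OF C] cx_module[OF D])
  interpret D: module R "term_of D k" by (rule cx_module[OF D])
  interpret D1: module R "term_of D (k + 1)" by (rule cx_module[OF D])
  interpret C1: module R "term_of C (k + 1)" by (rule cx_module[OF C])
  show "linear_map R (term_of (fibre R C D f) k) (term_of (fibre R C D f) (k + 1)) (diff_of (fibre R C D f) k)"
  proof (rule linear_mapI)
    fix u assume u: "u \<in> carrier (term_of (fibre R C D f) k)"
    note cl = lm_closed[OF cm_lin[OF f, of k]] lm_closed[OF cx_lin'[OF D, of k]] lm_closed[OF cx_lin[OF C, of k]]
    show "diff_of (fibre R C D f) k u \<in> carrier (term_of (fibre R C D f) (k + 1))"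
      using u cl by (simp add: fibre_def)
    { fix v assume v: "v \<in> carrier (term_of (fibre R C D f) k)"
      show "diff_of (fibre R C D f) k (u \<oplus>\<^bsub>term_of (fibre R C D f) k\<^esub> v) =
          diff_of (fibre R C D f) k u \<oplus>\<^bsub>term_of (fibre R C D f) (k + 1)\<^esub> diff_of (fibre R C D f) k v"
        using u v cl by (simp add: fibre_def lm_add[OF cm_lin[OF f]] lm_add[OF cx_lin[OF C]] lm_add[OF cx_lin'[OF D]]
            D.smult_r_distr D.M.a_ac) }
    { fix a assume a: "a \<in> carrier R"
      have "a \<odot>\<^bsub>term_of D k\<^esub> ((\<ominus>\<^bsub>R\<^esub> \<one>\<^bsub>R\<^esub>) \<odot>\<^bsub>term_of D k\<^esub> y) = (\<ominus>\<^bsub>R\<^esub> \<one>\<^bsub>R\<^esub>) \<odot>\<^bsub>term_of D k\<^esub> (a \<odot>\<^bsub>term_of D k\<^esub> y)"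
        if "y \<in> carrier (term_of D k)" for y
        using a that by (simp add: D.smult_l_minus D.smult_r_minus)
      then show "diff_of (fibre R C D f) k (a \<odot>\<^bsub>term_of (fibre R C D f) k\<^esub> u) =
          a \<odot>\<^bsub>term_of (fibre R C D f) (k + 1)\<^esub> diff_of (fibre R C D f) k u"
        using u a cl by (simp add: fibre_def lm_smult[OF cm_lin[OF f]] lm_smult[OF cx_lin[OF C]] lm_smult[OF cx_lin'[OF D]]
            D.smult_r_distr) }
  qed
  fix w assume "w \<in> carrier (term_of (fibre R C D f) k)"
  then have w: "p1 w \<in> carrier (term_of C k)" "p2 w \<in> carrier (term_of D (k - 1))" by simp_all
  let ?a = "p1 w" and ?b = "p2 w"
  have fa: "f k ?a \<in> carrier (term_of D k)" and db: "diff_of D (k - 1) ?b \<in> carrier (term_of D k)"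
    and da: "diff_of C k ?a \<in> carrier (term_of C (k + 1))"
    using lm_closed[OF cm_lin[OF f]] lm_closed[OF cx_lin'[OF D]] lm_closed[OF cx_lin[OF C]] w by auto
  have "diff_of D k (f k ?a \<ominus>\<^bsub>term_of D k\<^esub> diff_of D (k - 1) ?b) = f (k + 1) (diff_of C k ?a)"
    using fa db w lm_closed[OF cx_lin[OF D] fa]
    by (simp add: lm_minus[OF cx_module[OF D] cx_module[OF D] cx_lin[OF D]] cx_dd'[OF D] cm_comm[OF f])
  moreover have "f (k + 1) (diff_of C k ?a) \<in> carrier (term_of D (k + 1))"
    by (rule lm_closed[OF cm_lin[OF f] da])
  ultimately have "f (k + 1) (diff_of C k ?a) \<ominus>\<^bsub>term_of D (k + 1)\<^esub>
      diff_of D k (f k ?a \<ominus>\<^bsub>term_of D k\<^esub> diff_of D (k - 1) ?b) = \<zero>\<^bsub>term_of D (k + 1)\<^esub>"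
    by simp
  moreover have "diff_of (fibre R C D f) k w = pr (diff_of C k ?a) (f k ?a \<ominus>\<^bsub>term_of D k\<^esub> diff_of D (k - 1) ?b)"
    by (rule fibre_d[OF C D f w])
  ultimately show "diff_of (fibre R C D f) (k + 1) (diff_of (fibre R C D f) k w) = \<zero>\<^bsub>term_of (fibre R C D f) (k + 1 + 1)\<^esub>"
    using fibre_d[OF C D f, of "diff_of (fibre R C D f) k w" "k + 1"] fa db da w by (simp add: cx_dd[OF C] add.commute[of 1 k])
qed

lemma fibre_cocycle_iff:
  assumes C: "cochain_complex R C" and D: "cochain_complex R D" and f: "chain_map R C D f"
  shows "w \<in> cocycles (fibre R C D f) k \<longleftrightarrow>
    p1 w \<in> cocycles C k \<and> p2 w \<in> carrier (term_of D (k - 1)) \<and> f k (p1 w) = diff_of D (k - 1) (p2 w)"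
proof (cases "p1 w \<in> carrier (term_of C k) \<and> p2 w \<in> carrier (term_of D (k - 1))")
  case True
  interpret D: module R "term_of D k" by (rule cx_module[OF D])
  have "diff_of (fibre R C D f) k w = pr (diff_of C k (p1 w)) (f k (p1 w) \<ominus>\<^bsub>term_of D k\<^esub> diff_of D (k - 1) (p2 w))"
    using True by (intro fibre_d[OF C D f]) auto
  then show ?thesis
    using True lm_closed[OF cm_lin[OF f, of k], of "p1 w"] lm_closed[OF cx_lin'[OF D, of k], of "p2 w"]
    by (auto simp: cocycles_def)
qed (auto simp: cocycles_def)

lemma fibre_cobound_iff:
  assumes C: "cochain_complex R C" and D: "cochain_complex R D" and f: "chain_map R C D f"
  shows "w \<in> cobounds (fibre R C D f) k \<longleftrightarrow>
    (\<exists>a\<in>carrier (term_of C (k - 1)). \<exists>b\<in>carrier (term_of D (k - 2)).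
       p1 w = diff_of C (k - 1) a \<and> p2 w = f (k - 1) a \<oplus>\<^bsub>term_of D (k - 1)\<^esub> diff_of D (k - 2) b)"
proof -
  interpret D: module R "term_of D (k - 1)" by (rule cx_module[OF D])
  interpret D': module R "term_of D (k - 2)" by (rule cx_module[OF D])
  note neg = lm_neg[OF D'.module_axioms D.module_axioms cx_lin2[OF D]]
  note dcl = lm_closed[OF cx_lin2[OF D, of k]]
  note fd = fibre_d[OF C D f, of _ "k - 1", simplified]
  show ?thesis
  proof
    assume "w \<in> cobounds (fibre R C D f) k"
    then obtain v where v: "p1 v \<in> carrier (term_of C (k - 1))" "p2 v \<in> carrier (term_of D (k - 2))"
      "w = diff_of (fibre R C D f) (k - 1) v" by (auto simp: cobounds_iff)
    then show "\<exists>a\<in>carrier (term_of C (k - 1)). \<exists>b\<in>carrier (term_of D (k - 2)).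
       p1 w = diff_of C (k - 1) a \<and> p2 w = f (k - 1) a \<oplus>\<^bsub>term_of D (k - 1)\<^esub> diff_of D (k - 2) b"
      by (rule_tac bexI[of _ "p1 v"], rule_tac bexI[of _ "\<ominus>\<^bsub>term_of D (k - 2)\<^esub> p2 v"])
        (simp_all add: fd neg a_minus_def)
  next
    assume "\<exists>a\<in>carrier (term_of C (k - 1)). \<exists>b\<in>carrier (term_of D (k - 2)).
       p1 w = diff_of C (k - 1) a \<and> p2 w = f (k - 1) a \<oplus>\<^bsub>term_of D (k - 1)\<^esub> diff_of D (k - 2) b"
    then obtain a b where ab: "a \<in> carrier (term_of C (k - 1))" "b \<in> carrier (term_of D (k - 2))"
      "p1 w = diff_of C (k - 1) a" "p2 w = f (k - 1) a \<oplus>\<^bsub>term_of D (k - 1)\<^esub> diff_of D (k - 2) b" by blast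
    let ?v = "pr a (\<ominus>\<^bsub>term_of D (k - 2)\<^esub> b)"
    have "diff_of (fibre R C D f) (k - 1) ?v = pr (p1 w) (p2 w)"
      using ab dcl[OF ab(2)] unfolding ab(3,4) by (subst fd) (simp_all add: neg a_minus_def)
    then show "w \<in> cobounds (fibre R C D f) k"
      using ab(1,2) by (auto simp: cobounds_iff intro!: bexI[of _ ?v])
  qed
qed

text \<open>
  The long exact sequence of the fibre, as a chase: the first component of a cocycle bounds by
  injectivity of \<open>f\<close> on cohomology, and surjectivity corrects the second component.
\<close>

lemma fibre_exact:
  assumes C: "cochain_complex R C" and D: "cochain_complex R D" and f: "quasi_iso R C D f"
  shows "exact_complex (fibre R C D f)"
  unfolding exact_complex_def
proof (intro allI subsetI)
  note fm = qi_map[OF f]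
  fix k w assume "w \<in> cocycles (fibre R C D f) k"
  then have w: "p1 w \<in> cocycles C k" "p2 w \<in> carrier (term_of D (k - 1))" "f k (p1 w) = diff_of D (k - 1) (p2 w)"
    by (simp_all add: fibre_cocycle_iff[OF C D fm])
  then have "p1 w \<in> cobounds C k" by (intro qi_inj[OF f]) (auto simp: cobounds_iff)
  then obtain a where a: "a \<in> carrier (term_of C (k - 1))" "p1 w = diff_of C (k - 1) a" by (auto simp: cobounds_iff)
  interpret D: module R "term_of D (k - 1)" by (rule cx_module[OF D])
  have fa: "f (k - 1) a \<in> carrier (term_of D (k - 1))" by (rule lm_closed[OF cm_lin[OF fm] a(1)])
  have "diff_of D (k - 1) (p2 w) = diff_of D (k - 1) (f (k - 1) a)"
    using w(3) a by (simp add: cm_comm'[OF fm])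
  from lm_eq_split[OF cx_module[OF D] cx_module[OF D] cx_lin'[OF D] w(2) fa this]
  obtain t where t: "t \<in> carrier (term_of D (k - 1))" "p2 w = f (k - 1) a \<oplus>\<^bsub>term_of D (k - 1)\<^esub> t"
    "diff_of D (k - 1) t = \<zero>\<^bsub>term_of D k\<^esub>" .
  from t have "t \<in> cocycles D (k - 1)" by (simp add: cocycles_def)
  then obtain c e where c: "c \<in> cocycles C (k - 1)" and e: "e \<in> carrier (term_of D (k - 2))"
    "t = f (k - 1) c \<oplus>\<^bsub>term_of D (k - 1)\<^esub> diff_of D (k - 2) e"
    using qi_surj[OF f, of t "k - 1"] by auto
  have cC: "c \<in> carrier (term_of C (k - 1))" and dc: "diff_of C (k - 1) c = \<zero>\<^bsub>term_of C k\<^esub>"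
    using c by (simp_all add: cocycles_def)
  interpret C: module R "term_of C (k - 1)" by (rule cx_module[OF C])
  interpret C1: module R "term_of C k" by (rule cx_module[OF C])
  show "w \<in> cobounds (fibre R C D f) k"
    unfolding fibre_cobound_iff[OF C D fm]
  proof (rule bexI[of _ "a \<oplus>\<^bsub>term_of C (k - 1)\<^esub> c"], rule bexI[of _ e], intro conjI)
    show "p1 w = diff_of C (k - 1) (a \<oplus>\<^bsub>term_of C (k - 1)\<^esub> c)"
      using a cC dc lm_closed[OF cx_lin'[OF C] a(1)] by (simp add: lm_add[OF cx_lin'[OF C]])
    show "p2 w = f (k - 1) (a \<oplus>\<^bsub>term_of C (k - 1)\<^esub> c) \<oplus>\<^bsub>term_of D (k - 1)\<^esub> diff_of D (k - 2) e"
      using t e a cC fa lm_closed[OF cx_lin2[OF D] e(1)] lm_closed[OF cm_lin[OF fm] cC]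
      by (simp add: lm_add[OF cm_lin[OF fm]] D.M.a_assoc)
  qed (use a cC e in auto)
qed

definition scale_map :: "('a, 'm) cochain \<Rightarrow> 'a \<Rightarrow> int \<Rightarrow> 'm \<Rightarrow> 'm" where
  "scale_map C x = (\<lambda>k u. x \<odot>\<^bsub>term_of C k\<^esub> u)"

definition cone :: "('a, 'r) ring_scheme \<Rightarrow> 'a \<Rightarrow> ('a, 'm) cochain \<Rightarrow> ('a, 'm) cochain" where
  "cone R x C = fibre R C C (scale_map C x)"

definition pair_map :: "(int \<Rightarrow> 'm \<Rightarrow> 'm) \<Rightarrow> int \<Rightarrow> 'm \<Rightarrow> 'm" where
  "pair_map f = (\<lambda>k w. pr (f k (p1 w)) (f (k - 1) (p2 w)))"

lemma scale_chain_map: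
  assumes C: "cochain_complex R C" and "x \<in> carrier R"
  shows "chain_map R C C (scale_map C x)"
  unfolding chain_map_def scale_map_def
  using assms lm_scale[OF cx_module[OF C] cx_module[OF C] lm_id assms(2)]
  by (auto simp: lm_smult[OF cx_lin[OF C]])

lemma cone_complex: "cochain_complex R C \<Longrightarrow> x \<in> carrier R \<Longrightarrow> cochain_complex R (cone R x C)"
  unfolding cone_def by (intro fibre_complex scale_chain_map)

lemma cone_term [simp]: "term_of (cone R x C) k = pair_module (term_of C k) (term_of C (k - 1))"
  by (simp add: cone_def)

lemma cone_d: 
  assumes C: "cochain_complex R C" and "x \<in> carrier R"
    and w: "p1 w \<in> carrier (term_of C k)" "p2 w \<in> carrier (term_of C (k - 1))"
  shows "diff_of (cone R x C) k w =
    pr (diff_of C k (p1 w)) (x \<odot>\<^bsub>term_of C k\<^esub> p1 w \<ominus>\<^bsub>term_of C k\<^esub> diff_of C (k - 1) (p2 w))"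
  unfolding cone_def using fibre_d[OF C C scale_chain_map[OF C assms(2)] w] by (simp add: scale_map_def)

lemma cone_cocycle_iff:
  assumes "cochain_complex R C" "x \<in> carrier R"
  shows "w \<in> cocycles (cone R x C) k \<longleftrightarrow>
    p1 w \<in> cocycles C k \<and> p2 w \<in> carrier (term_of C (k - 1)) \<and> x \<odot>\<^bsub>term_of C k\<^esub> p1 w = diff_of C (k - 1) (p2 w)"
  unfolding cone_def using fibre_cocycle_iff[OF assms(1) assms(1) scale_chain_map[OF assms]] by (simp add: scale_map_def)

lemma cone_cobound_iff:
  assumes "cochain_complex R C" "x \<in> carrier R"
  shows "w \<in> cobounds (cone R x C) k \<longleftrightarrow>
    (\<exists>a\<in>carrier (term_of C (k - 1)). \<exists>b\<in>carrier (term_of C (k - 2)).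
       p1 w = diff_of C (k - 1) a \<and> p2 w = x \<odot>\<^bsub>term_of C (k - 1)\<^esub> a \<oplus>\<^bsub>term_of C (k - 1)\<^esub> diff_of C (k - 2) b)"
  unfolding cone_def using fibre_cobound_iff[OF assms(1) assms(1) scale_chain_map[OF assms]] by (simp add: scale_map_def)

lemma pair_map_chain_map:
  assumes C: "cochain_complex R C" and D: "cochain_complex R D" and f: "chain_map R C D f" and x: "x \<in> carrier R"
  shows "chain_map R (cone R x C) (cone R x D) (pair_map f)"
  unfolding chain_map_def
proof (intro conjI allI ballI)
  fix k
  show "linear_map R (term_of (cone R x C) k) (term_of (cone R x D) k) (pair_map f k)"
    using lm_closed[OF cm_lin[OF f]]
    by (intro linear_mapI) (auto simp: pair_map_def lm_add[OF cm_lin[OF f]] lm_smult[OF cm_lin[OF f]])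
  fix w assume "w \<in> carrier (term_of (cone R x C) k)"
  then have w: "p1 w \<in> carrier (term_of C k)" "p2 w \<in> carrier (term_of C (k - 1))" by simp_all
  interpret C: module R "term_of C k" by (rule cx_module[OF C])
  have "f k (x \<odot>\<^bsub>term_of C k\<^esub> p1 w \<ominus>\<^bsub>term_of C k\<^esub> diff_of C (k - 1) (p2 w)) =
      x \<odot>\<^bsub>term_of D k\<^esub> f k (p1 w) \<ominus>\<^bsub>term_of D k\<^esub> diff_of D (k - 1) (f (k - 1) (p2 w))"
    using w x lm_closed[OF cx_lin'[OF C] w(2)]
    by (simp add: lm_minus[OF cx_module[OF C] cx_module[OF D] cm_lin[OF f]] lm_smult[OF cm_lin[OF f]] cm_comm'[OF f])
  then show "pair_map f (k + 1) (diff_of (cone R x C) k w) = diff_of (cone R x D) k (pair_map f k w)"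
    using w lm_closed[OF cm_lin[OF f]]
    by (simp add: pair_map_def cone_d[OF C x] cone_d[OF D x] cm_comm[OF f])
qed

text \<open>Five lemma for the long exact sequence of a cone, by a diagram chase.\<close>

lemma pair_map_quasi_iso:
  assumes C: "cochain_complex R C" and D: "cochain_complex R D" and f: "quasi_iso R C D f" and x: "x \<in> carrier R"
  shows "quasi_iso R (cone R x C) (cone R x D) (pair_map f)"
  unfolding quasi_iso_def
proof (intro conjI allI ballI impI)
  note fm = qi_map[OF f]
  note lf = cm_lin[OF fm]
  note Cd = cx_lin'[OF C] and Dd = cx_lin'[OF D] and Dd2 = cx_lin2[OF D]
  show "chain_map R (cone R x C) (cone R x D) (pair_map f)" by (rule pair_map_chain_map[OF C D fm x])
  fix k
  interpret Ck: module R "term_of C k" by (rule cx_module[OF C])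
  interpret C1: module R "term_of C (k - 1)" by (rule cx_module[OF C])
  interpret Dk: module R "term_of D k" by (rule cx_module[OF D])
  interpret D1: module R "term_of D (k - 1)" by (rule cx_module[OF D])
  interpret D2: module R "term_of D (k - 2)" by (rule cx_module[OF D])
  { fix w assume w: "w \<in> cocycles (cone R x C) k" and b: "pair_map f k w \<in> cobounds (cone R x D) k"
    define a b where "a = p1 w" and "b = p2 w"
    have a: "a \<in> cocycles C k" and bC: "b \<in> carrier (term_of C (k - 1))"
      and xa: "x \<odot>\<^bsub>term_of C k\<^esub> a = diff_of C (k - 1) b"
      using w by (auto simp: cone_cocycle_iff[OF C x] a_def b_def)
    have aC: "a \<in> carrier (term_of C k)" using a by (rule cocyclesD)
    obtain \<alpha> \<beta> where al: "\<alpha> \<in> carrier (term_of D (k - 1))" and be: "\<beta> \<in> carrier (term_of D (k - 2))"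
      and fa: "f k a = diff_of D (k - 1) \<alpha>"
      and fb: "f (k - 1) b = x \<odot>\<^bsub>term_of D (k - 1)\<^esub> \<alpha> \<oplus>\<^bsub>term_of D (k - 1)\<^esub> diff_of D (k - 2) \<beta>"
      using b by (auto simp: cone_cobound_iff[OF D x] pair_map_def a_def b_def)
    have "a \<in> cobounds C k" by (rule qi_inj[OF f a]) (use fa al in \<open>auto simp: cobounds_iff\<close>)
    then obtain a1 where a1: "a1 \<in> carrier (term_of C (k - 1))" "a = diff_of C (k - 1) a1"
      by (auto simp: cobounds_iff)
    have fa1: "f (k - 1) a1 \<in> carrier (term_of D (k - 1))" by (rule lm_closed[OF lf a1(1)])
    have "diff_of D (k - 1) \<alpha> = diff_of D (k - 1) (f (k - 1) a1)"
      using fa a1 by (simp add: cm_comm'[OF fm])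
    from lm_eq_split[OF cx_module[OF D] cx_module[OF D] Dd al fa1 this]
    obtain t where t: "t \<in> carrier (term_of D (k - 1))" "\<alpha> = f (k - 1) a1 \<oplus>\<^bsub>term_of D (k - 1)\<^esub> t"
      "diff_of D (k - 1) t = \<zero>\<^bsub>term_of D k\<^esub>" .
    then have "t \<in> cocycles D (k - 1)" by (simp add: cocycles_def)
    then obtain c e where c: "c \<in> cocycles C (k - 1)" and e: "e \<in> carrier (term_of D (k - 2))"
      "t = f (k - 1) c \<oplus>\<^bsub>term_of D (k - 1)\<^esub> diff_of D (k - 2) e"
      using qi_surj[OF f, of t "k - 1"] by auto
    have cC: "c \<in> carrier (term_of C (k - 1))" and dc: "diff_of C (k - 1) c = \<zero>\<^bsub>term_of C k\<^esub>"
      using c by (simp_all add: cocycles_def)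
    define a2 where "a2 = a1 \<oplus>\<^bsub>term_of C (k - 1)\<^esub> c"
    have a2: "a2 \<in> carrier (term_of C (k - 1))" "diff_of C (k - 1) a2 = a"
      using a1 cC dc aC by (simp_all add: a2_def lm_add[OF Cd])
    have xa2: "x \<odot>\<^bsub>term_of C (k - 1)\<^esub> a2 \<in> carrier (term_of C (k - 1))" using x a2 by simp
    have "diff_of C (k - 1) b = diff_of C (k - 1) (x \<odot>\<^bsub>term_of C (k - 1)\<^esub> a2)"
      using xa a2 x by (simp add: lm_smult[OF Cd])
    from lm_eq_split[OF cx_module[OF C] cx_module[OF C] Cd bC xa2 this]
    obtain s where s: "s \<in> carrier (term_of C (k - 1))"
      "b = x \<odot>\<^bsub>term_of C (k - 1)\<^esub> a2 \<oplus>\<^bsub>term_of C (k - 1)\<^esub> s" "diff_of C (k - 1) s = \<zero>\<^bsub>term_of C k\<^esub>" .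
    have fa2: "f (k - 1) a2 \<in> carrier (term_of D (k - 1))" and fs: "f (k - 1) s \<in> carrier (term_of D (k - 1))"
      using lm_closed[OF lf] a2 s by auto
    have de: "diff_of D (k - 2) e \<in> carrier (term_of D (k - 1))"
      and db: "diff_of D (k - 2) \<beta> \<in> carrier (term_of D (k - 1))" using lm_closed[OF Dd2] e be by auto
    have fc: "f (k - 1) c \<in> carrier (term_of D (k - 1))" using lm_closed[OF lf cC] .
    have al2: "\<alpha> = f (k - 1) a2 \<oplus>\<^bsub>term_of D (k - 1)\<^esub> diff_of D (k - 2) e"
      using t(2) e(2) a1 cC fa1 fc de by (simp add: a2_def lm_add[OF lf] D1.M.a_assoc)
    have "x \<odot>\<^bsub>term_of D (k - 1)\<^esub> f (k - 1) a2 \<oplus>\<^bsub>term_of D (k - 1)\<^esub> f (k - 1) s = f (k - 1) b"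
      using s a2 x xa2 by (simp add: lm_add[OF lf] lm_smult[OF lf])
    also have "\<dots> = x \<odot>\<^bsub>term_of D (k - 1)\<^esub> f (k - 1) a2 \<oplus>\<^bsub>term_of D (k - 1)\<^esub>
        diff_of D (k - 2) (x \<odot>\<^bsub>term_of D (k - 2)\<^esub> e \<oplus>\<^bsub>term_of D (k - 2)\<^esub> \<beta>)"
      using x e(1) be de db fa2 unfolding fb al2
      by (simp add: lm_add[OF Dd2] lm_smult[OF Dd2] D1.smult_r_distr D1.M.a_assoc)
    finally have "f (k - 1) s = diff_of D (k - 2) (x \<odot>\<^bsub>term_of D (k - 2)\<^esub> e \<oplus>\<^bsub>term_of D (k - 2)\<^esub> \<beta>)"
      using x e(1) be fa2 fs lm_closed[OF Dd2] by (subst (asm) D1.M.add.l_cancel) auto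
    then have "s \<in> cobounds C (k - 1)"
      using s x e be by (intro qi_inj[OF f]) (auto simp: cobounds_iff cocycles_def)
    then obtain y where "y \<in> carrier (term_of C (k - 2))" "s = diff_of C (k - 2) y"
      by (auto simp: cobounds_iff)
    then show "w \<in> cobounds (cone R x C) k"
      unfolding cone_cobound_iff[OF C x] using a2 s
      by (rule_tac bexI[of _ a2], rule_tac bexI[of _ y]) (simp_all add: a_def b_def) }
  { fix w assume w: "w \<in> cocycles (cone R x D) k"
    define \<alpha> \<beta> where "\<alpha> = p1 w" and "\<beta> = p2 w"
    have al: "\<alpha> \<in> cocycles D k" and be: "\<beta> \<in> carrier (term_of D (k - 1))"
      and xal: "x \<odot>\<^bsub>term_of D k\<^esub> \<alpha> = diff_of D (k - 1) \<beta>"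
      using w by (auto simp: cone_cocycle_iff[OF D x] \<alpha>_def \<beta>_def)
    obtain a e where a: "a \<in> cocycles C k" and e: "e \<in> carrier (term_of D (k - 1))"
      "\<alpha> = f k a \<oplus>\<^bsub>term_of D k\<^esub> diff_of D (k - 1) e"
      using qi_surj[OF f al] by blast
    have aC: "a \<in> carrier (term_of C k)" using a by (rule cocyclesD)
    have fa: "f k a \<in> carrier (term_of D k)" by (rule lm_closed[OF lf aC])
    have de: "diff_of D (k - 1) e \<in> carrier (term_of D k)" by (rule lm_closed[OF Dd e(1)])
    define e' where "e' = \<ominus>\<^bsub>term_of D (k - 1)\<^esub> (x \<odot>\<^bsub>term_of D (k - 1)\<^esub> e)"
    have e': "e' \<in> carrier (term_of D (k - 1))" using e x by (simp add: e'_def)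
    have "diff_of D (k - 1) (\<beta> \<oplus>\<^bsub>term_of D (k - 1)\<^esub> e') = x \<odot>\<^bsub>term_of D k\<^esub> f k a"
    proof -
      have "diff_of D (k - 1) (\<beta> \<oplus>\<^bsub>term_of D (k - 1)\<^esub> e') =
          x \<odot>\<^bsub>term_of D k\<^esub> \<alpha> \<ominus>\<^bsub>term_of D k\<^esub> x \<odot>\<^bsub>term_of D k\<^esub> diff_of D (k - 1) e"
        using be e' e(1) x by (simp add: lm_add[OF Dd] xal e'_def lm_neg[OF cx_module[OF D] cx_module[OF D] Dd] lm_smult[OF Dd] a_minus_def)
      also have "\<dots> = x \<odot>\<^bsub>term_of D k\<^esub> f k a"
        unfolding e(2) using fa de x by (simp add: Dk.smult_r_distr a_minus_def Dk.M.a_assoc Dk.M.r_neg)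
      finally show ?thesis .
    qed
    then have "f k (x \<odot>\<^bsub>term_of C k\<^esub> a) \<in> cobounds D k"
      using be e' aC x by (auto simp: cobounds_iff lm_smult[OF lf] intro!: bexI[of _ "\<beta> \<oplus>\<^bsub>term_of D (k - 1)\<^esub> e'"])
    moreover have "x \<odot>\<^bsub>term_of C k\<^esub> a \<in> cocycles C k"
      by (rule submodule_smult[OF cocycles_submodule[OF C] x a])
    ultimately obtain b0 where b0: "b0 \<in> carrier (term_of C (k - 1))" "x \<odot>\<^bsub>term_of C k\<^esub> a = diff_of C (k - 1) b0"
      using qi_inj[OF f] by (auto simp: cobounds_iff)
    have fb0: "f (k - 1) b0 \<in> carrier (term_of D (k - 1))" by (rule lm_closed[OF lf b0(1)])
    let ?u = "f (k - 1) b0 \<oplus>\<^bsub>term_of D (k - 1)\<^esub> x \<odot>\<^bsub>term_of D (k - 1)\<^esub> e"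
    have u: "?u \<in> carrier (term_of D (k - 1))" using fb0 e x by simp
    have "diff_of D (k - 1) \<beta> = diff_of D (k - 1) ?u"
    proof -
      have "diff_of D (k - 1) \<beta> = x \<odot>\<^bsub>term_of D k\<^esub> f k a \<oplus>\<^bsub>term_of D k\<^esub> x \<odot>\<^bsub>term_of D k\<^esub> diff_of D (k - 1) e"
        using xal[symmetric] fa de x unfolding e(2) by (simp add: Dk.smult_r_distr)
      also have "x \<odot>\<^bsub>term_of D k\<^esub> f k a = diff_of D (k - 1) (f (k - 1) b0)"
        using b0 aC x cm_comm'[OF fm b0(1)] lm_smult[OF lf x aC] by simp
      finally show ?thesis using fb0 e x by (simp add: lm_add[OF Dd] lm_smult[OF Dd])
    qed
    from lm_eq_split[OF cx_module[OF D] cx_module[OF D] Dd be u this]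
    obtain t where t: "t \<in> carrier (term_of D (k - 1))" "\<beta> = ?u \<oplus>\<^bsub>term_of D (k - 1)\<^esub> t"
      "diff_of D (k - 1) t = \<zero>\<^bsub>term_of D k\<^esub>" .
    then have "t \<in> cocycles D (k - 1)" by (simp add: cocycles_def)
    then obtain c g where c: "c \<in> cocycles C (k - 1)" and g: "g \<in> carrier (term_of D (k - 2))"
      "t = f (k - 1) c \<oplus>\<^bsub>term_of D (k - 1)\<^esub> diff_of D (k - 2) g"
      using qi_surj[OF f, of t "k - 1"] by auto
    have cC: "c \<in> carrier (term_of C (k - 1))" and dc: "diff_of C (k - 1) c = \<zero>\<^bsub>term_of C k\<^esub>"
      using c by (simp_all add: cocycles_def)
    have fc: "f (k - 1) c \<in> carrier (term_of D (k - 1))" by (rule lm_closed[OF lf cC])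
    have dg: "diff_of D (k - 2) g \<in> carrier (term_of D (k - 1))" by (rule lm_closed[OF Dd2 g(1)])
    let ?v = "pr a (b0 \<oplus>\<^bsub>term_of C (k - 1)\<^esub> c)"
    have "?v \<in> cocycles (cone R x C) k"
      using a b0 cC dc lm_closed[OF Cd b0(1)] by (simp add: cone_cocycle_iff[OF C x] lm_add[OF Cd])
    moreover have "pr (diff_of D (k - 1) e) (x \<odot>\<^bsub>term_of D (k - 1)\<^esub> e \<oplus>\<^bsub>term_of D (k - 1)\<^esub> diff_of D (k - 2) g)
        \<in> cobounds (cone R x D) k"
      using e(1) g(1) by (auto simp: cone_cobound_iff[OF D x])
    then obtain y where "y \<in> carrier (term_of (cone R x D) (k - 1))" and
      y: "diff_of (cone R x D) (k - 1) y =
        pr (diff_of D (k - 1) e) (x \<odot>\<^bsub>term_of D (k - 1)\<^esub> e \<oplus>\<^bsub>term_of D (k - 1)\<^esub> diff_of D (k - 2) g)"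
      using cobounds_iff[of _ "cone R x D" k] by metis
    moreover have "w = pair_map f k ?v \<oplus>\<^bsub>term_of (cone R x D) k\<^esub> diff_of (cone R x D) (k - 1) y"
    proof -
      have "\<beta> = (f (k - 1) (b0 \<oplus>\<^bsub>term_of C (k - 1)\<^esub> c)) \<oplus>\<^bsub>term_of D (k - 1)\<^esub>
          (x \<odot>\<^bsub>term_of D (k - 1)\<^esub> e \<oplus>\<^bsub>term_of D (k - 1)\<^esub> diff_of D (k - 2) g)"
        using t(2) g(2) b0(1) cC fb0 fc dg e(1) x by (simp add: lm_add[OF lf] D1.M.a_ac)
      then have "pr \<alpha> \<beta> = pair_map f k ?v \<oplus>\<^bsub>term_of (cone R x D) k\<^esub> diff_of (cone R x D) (k - 1) y"
        unfolding y using e(2) by (simp add: pair_map_def)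
      then show ?thesis by (simp add: \<alpha>_def \<beta>_def)
    qed
    ultimately show "\<exists>a\<in>cocycles (cone R x C) k. \<exists>e\<in>carrier (term_of (cone R x D) (k - 1)).
        w = pair_map f k a \<oplus>\<^bsub>term_of (cone R x D) k\<^esub> diff_of (cone R x D) (k - 1) e" by blast }
qed

end

section \<open>Acyclicity modulo a Serre subcategory\<close>

definition acyclic_mod ::
  "('a, 'r) ring_scheme \<Rightarrow> ('a, 'm) module set \<Rightarrow> ('a, 'm) cochain \<Rightarrow> bool" where
  "acyclic_mod R S C \<longleftrightarrow> (\<forall>k. subquotient_in R S (term_of C k) (cocycles C k) (cobounds C k))"

definition short_exact_complexes ::
  "('a, 'r) ring_scheme \<Rightarrow> ('a, 'm) cochain \<Rightarrow> (int \<Rightarrow> 'm \<Rightarrow> 'm) \<Rightarrow> ('a, 'm) cochain \<Rightarrow>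
   (int \<Rightarrow> 'm \<Rightarrow> 'm) \<Rightarrow> ('a, 'm) cochain \<Rightarrow> bool" where
  "short_exact_complexes R A f C g D \<longleftrightarrow> chain_map R A C f \<and> chain_map R C D g \<and>
     (\<forall>k. \<forall>x\<in>carrier (term_of A k). f k x = \<zero>\<^bsub>term_of C k\<^esub> \<longrightarrow> x = \<zero>\<^bsub>term_of A k\<^esub>) \<and>
     (\<forall>k. \<forall>x\<in>carrier (term_of A k). g k (f k x) = \<zero>\<^bsub>term_of D k\<^esub>) \<and>
     (\<forall>k. \<forall>y\<in>carrier (term_of C k). g k y = \<zero>\<^bsub>term_of D k\<^esub> \<longrightarrow> (\<exists>x\<in>carrier (term_of A k). y = f k x)) \<and>
     (\<forall>k. \<forall>z\<in>carrier (term_of D k). \<exists>y\<in>carrier (term_of C k). z = g k y)"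

lemma short_exact_complexesD:
  assumes "short_exact_complexes R A f C g D"
  shows "chain_map R A C f" "chain_map R C D g"
    "\<And>k x. x \<in> carrier (term_of A k) \<Longrightarrow> f k x = \<zero>\<^bsub>term_of C k\<^esub> \<Longrightarrow> x = \<zero>\<^bsub>term_of A k\<^esub>"
    "\<And>k x. x \<in> carrier (term_of A k) \<Longrightarrow> g k (f k x) = \<zero>\<^bsub>term_of D k\<^esub>"
    "\<And>k y. y \<in> carrier (term_of C k) \<Longrightarrow> g k y = \<zero>\<^bsub>term_of D k\<^esub> \<Longrightarrow> \<exists>x\<in>carrier (term_of A k). y = f k x"
    "\<And>k z. z \<in> carrier (term_of D k) \<Longrightarrow> \<exists>y\<in>carrier (term_of C k). z = g k y"
  using assms by (simp_all add: short_exact_complexes_def)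

context serre_class
begin

lemma acyclic_mod_quasi_iso:
  assumes C: "cochain_complex R C" and D: "cochain_complex R D" and f: "quasi_iso R C D f"
  shows "acyclic_mod R S C \<longleftrightarrow> acyclic_mod R S D"
proof
  note fm = qi_map[OF f]
  note res = cm_restrict_cocycles[OF C D fm]
  { assume D': "acyclic_mod R S D"
    show "acyclic_mod R S C" unfolding acyclic_mod_def
    proof
      fix k
      show "subquotient_in R S (term_of C k) (cocycles C k) (cobounds C k)"
        by (rule subquotient_in_mono[OF _ cx_module[OF C] cocycles_submodule[OF C] res])
          (use D' qi_inj[OF f] cm_cobound[OF fm] in \<open>auto simp: acyclic_mod_def\<close>)
    qed }
  { assume C': "acyclic_mod R S C"
    show "acyclic_mod R S D" unfolding acyclic_mod_def
    proof
      fix k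
      show "subquotient_in R S (term_of D k) (cocycles D k) (cobounds D k)"
      proof (rule subquotient_in_image[OF _ cx_module[OF C] cocycles_submodule[OF C]
            cx_module[OF D] cocycles_submodule[OF D] cobounds_submodule[OF D] cobounds_cocycles[OF D] res cm_cobound[OF fm]])
        show "subquotient_in R S (term_of C k) (cocycles C k) (cobounds C k)"
          using C' by (simp add: acyclic_mod_def)
        fix y assume "y \<in> cocycles D k"
        then show "\<exists>z\<in>cocycles C k. \<exists>b\<in>cobounds D k. y = f k z \<oplus>\<^bsub>term_of D k\<^esub> b"
          using qi_surj[OF f, of y k] by (auto simp: cobounds_def)
      qed
    qed }
qed

lemma acyclic_mod_middle:
  assumes A: "cochain_complex R A" and C: "cochain_complex R C" and D: "cochain_complex R D"
    and ses: "short_exact_complexes R A f C g D"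
    and A': "acyclic_mod R S A" and D': "acyclic_mod R S D"
  shows "acyclic_mod R S C"
  unfolding acyclic_mod_def
proof
  fix k
  note s = short_exact_complexesD[OF ses]
  note fm = s(1) and gm = s(2)
  interpret Ck: module R "term_of C k" by (rule cx_module[OF C])
  interpret C1: module R "term_of C (k + 1)" by (rule cx_module[OF C])
  show "subquotient_in R S (term_of C k) (cocycles C k) (cobounds C k)"
  proof (rule subquotient_in_exact[OF _ _ cx_module[OF A] cx_module[OF C] cx_module[OF D]
        cocycles_submodule[OF A] cocycles_submodule[OF C] cocycles_submodule[OF D]
        cobounds_submodule[OF C] cobounds_cocycles[OF C] cobounds_submodule[OF D]
        cm_restrict_cocycles[OF A C fm] cm_restrict_cocycles[OF C D gm] cm_cobound[OF fm] cm_cobound[OF gm]])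
    show "subquotient_in R S (term_of A k) (cocycles A k) (cobounds A k)"
      "subquotient_in R S (term_of D k) (cocycles D k) (cobounds D k)"
      using A' D' by (simp_all add: acyclic_mod_def)
    show "g k (f k z) \<in> cobounds D k" if "z \<in> cocycles A k" for z
      using s(4)[OF cocyclesD(1)[OF that]] submodule_zero[OF cobounds_submodule[OF D]] by simp
    fix z assume z: "z \<in> cocycles C k" "g k z \<in> cobounds D k"
    then have zC: "z \<in> carrier (term_of C k)" by (simp add: cocyclesD)
    obtain w where w: "w \<in> carrier (term_of D (k - 1))" "g k z = diff_of D (k - 1) w"
      using z(2) by (auto simp: cobounds_iff)
    obtain y where y: "y \<in> carrier (term_of C (k - 1))" "w = g (k - 1) y" using s(6)[OF w(1)] by blast
    have dy: "diff_of C (k - 1) y \<in> carrier (term_of C k)" by (rule lm_closed[OF cx_lin'[OF C] y(1)])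
    have "g k z = g k (diff_of C (k - 1) y)" using w(2) y by (simp add: cm_comm'[OF gm])
    from lm_eq_split[OF cx_module[OF C] cx_module[OF D] cm_lin[OF gm] zC dy this]
    obtain t where t: "t \<in> carrier (term_of C k)" "z = diff_of C (k - 1) y \<oplus>\<^bsub>term_of C k\<^esub> t"
      "g k t = \<zero>\<^bsub>term_of D k\<^esub>" .
    obtain x where x: "x \<in> carrier (term_of A k)" "t = f k x" using s(5)[OF t(1,3)] by blast
    have "diff_of C k z = diff_of C k t"
      using t(1) dy y(1) lm_closed[OF cx_lin[OF C] t(1)] unfolding t(2) by (simp add: lm_add[OF cx_lin[OF C]] cx_dd'[OF C])
    then have "f (k + 1) (diff_of A k x) = \<zero>\<^bsub>term_of C (k + 1)\<^esub>"
      using z(1) x by (simp add: cocyclesD cm_comm[OF fm])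
    then have "diff_of A k x = \<zero>\<^bsub>term_of A (k + 1)\<^esub>" by (rule s(3)[OF lm_closed[OF cx_lin[OF A] x(1)]])
    then have "x \<in> cocycles A k" using x(1) by (intro cocyclesI)
    moreover have "z = f k x \<oplus>\<^bsub>term_of C k\<^esub> diff_of C (k - 1) y"
      using t(1,2) x(2) dy by (simp add: Ck.M.a_comm)
    moreover have "diff_of C (k - 1) y \<in> cobounds C k" using y(1) by (auto simp: cobounds_iff)
    ultimately show "\<exists>a\<in>cocycles A k. \<exists>b\<in>cobounds C k. z = f k a \<oplus>\<^bsub>term_of C k\<^esub> b" by blast
  qed
qed

end

section \<open>Koszul complexes\<close>

context pairing
begin

text \<open>
  The Koszul complex \<open>Hom(K(xs), C)\<close>, with the last element of the list innermost.
\<close>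

fun koszul :: "('a, 'r) ring_scheme \<Rightarrow> 'a list \<Rightarrow> ('a, 'm) cochain \<Rightarrow> ('a, 'm) cochain" where
  "koszul R [] C = C"
| "koszul R (x # xs) C = cone R x (koszul R xs C)"

fun koszul_map :: "'a list \<Rightarrow> (int \<Rightarrow> 'm \<Rightarrow> 'm) \<Rightarrow> int \<Rightarrow> 'm \<Rightarrow> 'm" where
  "koszul_map [] f = f"
| "koszul_map (x # xs) f = pair_map (koszul_map xs f)"

lemma koszul_complex: "cochain_complex R C \<Longrightarrow> set xs \<subseteq> carrier R \<Longrightarrow> cochain_complex R (koszul R xs C)"
  by (induction xs) (auto intro: cone_complex)

lemma koszul_map_quasi_iso:
  "cochain_complex R C \<Longrightarrow> cochain_complex R D \<Longrightarrow> quasi_iso R C D f \<Longrightarrow> set xs \<subseteq> carrier R \<Longrightarrow>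
   quasi_iso R (koszul R xs C) (koszul R xs D) (koszul_map xs f)"
  by (induction xs) (auto intro: pair_map_quasi_iso koszul_complex)

lemma pair_map_short_exact:
  assumes A: "cochain_complex R A" and C: "cochain_complex R C" and D: "cochain_complex R D"
    and ses: "short_exact_complexes R A f C g D" and x: "x \<in> carrier R"
  shows "short_exact_complexes R (cone R x A) (pair_map f) (cone R x C) (pair_map g) (cone R x D)"
proof -
  note s = short_exact_complexesD[OF ses]
  have "\<exists>v\<in>carrier (term_of (cone R x A) k). w = pair_map f k v"
    if w: "w \<in> carrier (term_of (cone R x C) k)" "pair_map g k w = \<zero>\<^bsub>term_of (cone R x D) k\<^esub>" for k w
  proof -
    obtain a b where "a \<in> carrier (term_of A k)" "p1 w = f k a" "b \<in> carrier (term_of A (k - 1))" "p2 w = f (k - 1) b"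
      using w s(5)[of "p1 w" k] s(5)[of "p2 w" "k - 1"] by (auto simp: pair_map_def)
    moreover from this have "w = pr (f k a) (f (k - 1) b)" by (metis pr_p)
    ultimately show ?thesis by (intro bexI[of _ "pr a b"]) (auto simp: pair_map_def)
  qed
  moreover have "\<exists>v\<in>carrier (term_of (cone R x C) k). w = pair_map g k v"
    if w: "w \<in> carrier (term_of (cone R x D) k)" for k w
  proof -
    obtain a b where "a \<in> carrier (term_of C k)" "p1 w = g k a" "b \<in> carrier (term_of C (k - 1))" "p2 w = g (k - 1) b"
      using w s(6)[of "p1 w" k] s(6)[of "p2 w" "k - 1"] by auto
    moreover from this have "w = pr (g k a) (g (k - 1) b)" by (metis pr_p)
    ultimately show ?thesis by (intro bexI[of _ "pr a b"]) (auto simp: pair_map_def)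
  qed
  moreover have "w = \<zero>\<^bsub>term_of (cone R x A) k\<^esub>"
    if w: "w \<in> carrier (term_of (cone R x A) k)" "pair_map f k w = \<zero>\<^bsub>term_of (cone R x C) k\<^esub>" for k w
  proof -
    have "p1 w = \<zero>\<^bsub>term_of A k\<^esub>" "p2 w = \<zero>\<^bsub>term_of A (k - 1)\<^esub>"
      using w s(3)[of "p1 w" k] s(3)[of "p2 w" "k - 1"] by (auto simp: pair_map_def)
    then show ?thesis using pr_p[of w] by simp
  qed
  ultimately show ?thesis
    unfolding short_exact_complexes_def
    using pair_map_chain_map[OF A C s(1) x] pair_map_chain_map[OF C D s(2) x]
    by (simp add: pair_map_def s(4))
qed

lemma koszul_map_short_exact:
  "cochain_complex R A \<Longrightarrow> cochain_complex R C \<Longrightarrow> cochain_complex R D \<Longrightarrow>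
   short_exact_complexes R A f C g D \<Longrightarrow> set xs \<subseteq> carrier R \<Longrightarrow>
   short_exact_complexes R (koszul R xs A) (koszul_map xs f) (koszul R xs C) (koszul_map xs g) (koszul R xs D)"
  by (induction xs) (auto intro: pair_map_short_exact koszul_complex)

text \<open>
  A Koszul complex in degree \<open>k\<close> involves \<open>C\<close> in degrees up to \<open>k\<close> only, so in a given degree \<open>C\<close> may be
  replaced by a truncation.
\<close>

lemma koszul_cong:
  assumes "\<And>k. k \<le> m \<Longrightarrow> term_of C k = term_of D k" "\<And>k. k \<le> m \<Longrightarrow> diff_of C k = diff_of D k" "k \<le> m"
  shows "term_of (koszul R xs C) k = term_of (koszul R xs D) k \<and> diff_of (koszul R xs C) k = diff_of (koszul R xs D) k"
  using assms(3)
proof (induction xs arbitrary: k)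
  case (Cons x xs)
  then have "k - 1 \<le> m" by simp
  with Cons show ?case by (simp add: cone_def fibre_def scale_map_def)
qed (use assms in simp)

lemma koszul_zero:
  assumes "\<And>k. carrier (term_of C k) \<subseteq> {\<zero>\<^bsub>term_of C k\<^esub>}"
  shows "carrier (term_of (koszul R xs C) k) \<subseteq> {\<zero>\<^bsub>term_of (koszul R xs C) k\<^esub>}"
proof (induction xs arbitrary: k)
  case (Cons x xs)
  show ?case
  proof
    fix w assume "w \<in> carrier (term_of (koszul R (x # xs) C) k)"
    then have "p1 w = \<zero>\<^bsub>term_of (koszul R xs C) k\<^esub>" "p2 w = \<zero>\<^bsub>term_of (koszul R xs C) (k - 1)\<^esub>"
      using Cons.IH[of k] Cons.IH[of "k - 1"] by auto
    then have "w = pr \<zero>\<^bsub>term_of (koszul R xs C) k\<^esub> \<zero>\<^bsub>term_of (koszul R xs C) (k - 1)\<^esub>"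
      by (metis pr_p)
    then show "w \<in> {\<zero>\<^bsub>term_of (koszul R (x # xs) C) k\<^esub>}" by simp
  qed
qed (use assms in simp)

end

section \<open>Truncation\<close>

definition subcomplex :: "('a, 'm) cochain \<Rightarrow> (int \<Rightarrow> 'm set) \<Rightarrow> ('a, 'm) cochain" where
  "subcomplex C K = (\<lambda>k. (term_of C k)\<lparr>carrier := K k\<rparr>, diff_of C)"

lemma subcomplex_simps [simp]:
  "term_of (subcomplex C K) k = (term_of C k)\<lparr>carrier := K k\<rparr>"
  "diff_of (subcomplex C K) = diff_of C"
  by (simp_all add: subcomplex_def)

lemma subcomplex_complex:
  assumes C: "cochain_complex R C" and K: "\<And>k. submodule (K k) R (term_of C k)"
    and d: "\<And>k x. x \<in> K k \<Longrightarrow> diff_of C k x \<in> K (k + 1)"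
  shows "cochain_complex R (subcomplex C K)"
  unfolding cochain_complex_def
proof (intro conjI allI ballI)
  fix k
  show "module R (term_of (subcomplex C K) k)"
    by (simp add: submodule_module[OF cx_module[OF C] K])
  show "linear_map R (term_of (subcomplex C K) k) (term_of (subcomplex C K) (k + 1)) (diff_of (subcomplex C K) k)"
    using d by (auto intro!: lm_restrict2[OF cx_lin[OF C]] submodule_mem[OF K])
  show "diff_of (subcomplex C K) (k + 1) (diff_of (subcomplex C K) k x) = \<zero>\<^bsub>term_of (subcomplex C K) (k + 1 + 1)\<^esub>"
    if "x \<in> carrier (term_of (subcomplex C K) k)" for x
    using cx_dd[OF C submodule_mem[OF K]] that by simp
qed

definition concentrated :: "int \<Rightarrow> ('a, 'm) module \<Rightarrow> ('a, 'm) cochain" where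
  "concentrated j M = (\<lambda>k. if k = j then M else M\<lparr>carrier := {\<zero>\<^bsub>M\<^esub>}\<rparr>, \<lambda>k u. \<zero>\<^bsub>M\<^esub>)"

lemma concentrated_complex:
  assumes M: "module R M"
  shows "cochain_complex R (concentrated j M)"
proof -
  interpret M: module R M by fact
  show ?thesis
    unfolding cochain_complex_def concentrated_def
    using submodule_module[OF M submodule_zero_set[OF M]] M
    by (auto intro!: linear_mapI)
qed

text \<open>
  The truncation keeps \<open>T\<close> in degree \<open>j\<close>. Two choices of \<open>T\<close> are used: the cocycles, which give the
  canonical truncation, and the coboundaries, which give a complex that also loses \<open>H\<^sup>j\<close>.
\<close>

definition trunc_terms :: "int \<Rightarrow> 'm set \<Rightarrow> ('a, 'm) cochain \<Rightarrow> int \<Rightarrow> 'm set" where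
  "trunc_terms j T C k = (if k < j then carrier (term_of C k) else if k = j then T else {\<zero>\<^bsub>term_of C k\<^esub>})"

definition trunc_below :: "int \<Rightarrow> 'm set \<Rightarrow> ('a, 'm) cochain \<Rightarrow> ('a, 'm) cochain" where
  "trunc_below j T C = subcomplex C (trunc_terms j T C)"

lemma trunc_below_complex:
  assumes C: "cochain_complex R C" and T: "submodule T R (term_of C j)" "cobounds C j \<subseteq> T" "T \<subseteq> cocycles C j"
  shows "cochain_complex R (trunc_below j T C)"
  unfolding trunc_below_def
proof (rule subcomplex_complex[OF C])
  fix k
  show "submodule (trunc_terms j T C k) R (term_of C k)"
    by (simp add: trunc_terms_def T(1) submodule_carrier submodule_zero_set cx_module[OF C])
  fix x assume x: "x \<in> trunc_terms j T C k"
  consider "k + 1 < j" | "k + 1 = j" | "k = j" | "k > j" by linarith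
  then show "diff_of C k x \<in> trunc_terms j T C (k + 1)"
  proof cases
    case 1
    then show ?thesis using x lm_closed[OF cx_lin[OF C]] by (simp add: trunc_terms_def)
  next
    case 2
    then have "j - 1 = k" by simp
    then have "diff_of C k x \<in> cobounds C j" using x 2 unfolding cobounds_def \<open>j - 1 = k\<close> by (simp add: trunc_terms_def)
    then show ?thesis using 2 T(2) by (auto simp: trunc_terms_def)
  next
    case 3
    then show ?thesis using x T(3) by (auto simp: trunc_terms_def cocycles_def)
  next
    case 4
    then show ?thesis using x lm_zero[OF cx_module[OF C] cx_module[OF C] cx_lin[OF C]] by (simp add: trunc_terms_def)
  qed
qed

lemma cocycles_iff: "x \<in> cocycles C k \<longleftrightarrow> x \<in> carrier (term_of C k) \<and> diff_of C k x = \<zero>\<^bsub>term_of C (k + 1)\<^esub>"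
  by (simp add: cocycles_def)

text \<open>
  The complexes differ in degrees \<open>j - 1\<close> and \<open>j\<close>, by \<open>C\<^sup>j\<^sup>-\<^sup>1/Z\<^sup>j\<^sup>-\<^sup>1 \<rightarrow> B\<^sup>j\<close>, which is an isomorphism.
\<close>

lemma trunc_quasi_iso:
  assumes C: "cochain_complex R C"
  shows "quasi_iso R (trunc_below (j - 1) (cocycles C (j - 1)) C) (trunc_below j (cobounds C j) C) (\<lambda>k u. u)"
    (is "quasi_iso R ?A ?D _")
proof -
  have A: "cochain_complex R ?A"
    by (rule trunc_below_complex[OF C cocycles_submodule[OF C] cobounds_cocycles[OF C]]) simp
  have D: "cochain_complex R ?D"
    by (rule trunc_below_complex[OF C cobounds_submodule[OF C] _ cobounds_cocycles[OF C]]) simp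
  have tA: "term_of ?A k = (term_of C k)\<lparr>carrier := trunc_terms (j - 1) (cocycles C (j - 1)) C k\<rparr>"
    and tD: "term_of ?D k = (term_of C k)\<lparr>carrier := trunc_terms j (cobounds C j) C k\<rparr>" for k
    by (simp_all add: trunc_below_def)
  have dA: "diff_of ?A = diff_of C" and dD: "diff_of ?D = diff_of C" by (simp_all add: trunc_below_def)
  have z: "\<zero>\<^bsub>term_of C k\<^esub> \<in> carrier (term_of C k)" for k by (rule submodule_zero[OF submodule_carrier[OF cx_module[OF C]]])
  have sub: "trunc_terms (j - 1) (cocycles C (j - 1)) C k \<subseteq> trunc_terms j (cobounds C j) C k" for k
    using submodule_zero[OF cobounds_submodule[OF C, of j]] cocyclesD(1)[of _ C k]
    by (cases "k = j - 1") (auto simp: trunc_terms_def)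
  have cm: "chain_map R ?A ?D (\<lambda>k u. u)"
    unfolding chain_map_def tA tD dA dD using subsetD[OF sub] by (auto intro!: linear_mapI)
  have zA: "\<zero>\<^bsub>term_of C k\<^esub> \<in> cobounds ?A k" for k
    using submodule_zero[OF cobounds_submodule[OF A, of k]] by (simp add: tA)
  have zA': "\<zero>\<^bsub>term_of C k\<^esub> \<in> cocycles ?A k" for k
    using submodule_zero[OF cocycles_submodule[OF A, of k]] by (simp add: tA)
  have zD: "\<zero>\<^bsub>term_of C k\<^esub> \<in> carrier (term_of ?D k)" for k
    using submodule_zero[OF submodule_carrier[OF cx_module[OF D], of k]] by (simp add: tD)
  have d0: "diff_of C (k - 1) \<zero>\<^bsub>term_of C (k - 1)\<^esub> = \<zero>\<^bsub>term_of C k\<^esub>" for k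
    by (rule lm_zero[OF cx_module[OF C] cx_module[OF C] cx_lin'[OF C]])
  have zero_r: "x \<oplus>\<^bsub>term_of C k\<^esub> \<zero>\<^bsub>term_of C k\<^esub> = x" "\<zero>\<^bsub>term_of C k\<^esub> \<oplus>\<^bsub>term_of C k\<^esub> x = x" if "x \<in> carrier (term_of C k)" for k x
  proof -
    interpret module R "term_of C k" by (rule cx_module[OF C])
    show "x \<oplus>\<^bsub>term_of C k\<^esub> \<zero>\<^bsub>term_of C k\<^esub> = x" "\<zero>\<^bsub>term_of C k\<^esub> \<oplus>\<^bsub>term_of C k\<^esub> x = x" using that by simp_all
  qed
  show ?thesis
    unfolding quasi_iso_def
  proof (intro conjI cm allI ballI impI)
    fix k a assume a: "a \<in> cocycles ?A k" "a \<in> cobounds ?D k"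
    show "a \<in> cobounds ?A k"
    proof (cases "k < j")
      case True
      then show ?thesis using a(2) unfolding cobounds_iff tA tD dA dD by (simp add: trunc_terms_def)
    next
      case False
      then have "a = \<zero>\<^bsub>term_of C k\<^esub>" using a(1) by (simp add: cocycles_iff tA trunc_terms_def)
      then show ?thesis using zA by simp
    qed
  next
    fix k b assume b: "b \<in> cocycles ?D k"
    consider "k < j" | "k = j" | "k > j" by linarith
    then show "\<exists>a\<in>cocycles ?A k. \<exists>e\<in>carrier (term_of ?D (k - 1)). b = a \<oplus>\<^bsub>term_of ?D k\<^esub> diff_of ?D (k - 1) e"
    proof cases
      case 1
      then have "b \<in> cocycles ?A k"
        using b by (cases "k = j - 1") (auto simp: cocycles_iff tA tD dA dD trunc_terms_def)
      moreover have "b = b \<oplus>\<^bsub>term_of ?D k\<^esub> diff_of ?D (k - 1) \<zero>\<^bsub>term_of C (k - 1)\<^esub>"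
        using b 1 by (simp add: dD d0 tD zero_r cocycles_iff trunc_terms_def)
      ultimately show ?thesis using zD by blast
    next
      case 2
      then obtain y where y: "y \<in> carrier (term_of C (k - 1))" "b = diff_of C (k - 1) y"
        using b by (auto simp: cocycles_iff tD trunc_terms_def cobounds_iff[of _ C])
      then have "b = \<zero>\<^bsub>term_of C k\<^esub> \<oplus>\<^bsub>term_of ?D k\<^esub> diff_of ?D (k - 1) y"
        using lm_closed[OF cx_lin'[OF C] y(1)] by (simp add: dD tD zero_r)
      moreover have "y \<in> carrier (term_of ?D (k - 1))" using 2 y by (simp add: tD trunc_terms_def)
      ultimately show ?thesis using zA' by blast
    next
      case 3
      then have "b = \<zero>\<^bsub>term_of C k\<^esub>" using b by (simp add: cocycles_iff tD trunc_terms_def)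
      then have "b = \<zero>\<^bsub>term_of C k\<^esub> \<oplus>\<^bsub>term_of ?D k\<^esub> diff_of ?D (k - 1) \<zero>\<^bsub>term_of C (k - 1)\<^esub>"
        by (simp add: dD d0 tD zero_r z)
      then show ?thesis using zA' zD by blast
    qed
  qed
qed

lemma trunc_short_exact:
  assumes C: "cochain_complex R C" and H: "module R H"
    and p: "linear_map R ((term_of C j)\<lparr>carrier := cocycles C j\<rparr>) H p" "p ` cocycles C j = carrier H"
    "\<And>z. z \<in> cocycles C j \<Longrightarrow> p z = \<zero>\<^bsub>H\<^esub> \<longleftrightarrow> z \<in> cobounds C j"
  shows "short_exact_complexes R (trunc_below j (cobounds C j) C) (\<lambda>k u. u) (trunc_below j (cocycles C j) C)
    (\<lambda>k u. if k = j then p u else \<zero>\<^bsub>H\<^esub>) (concentrated j H)"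
    (is "short_exact_complexes R ?A _ ?C ?g ?D")
proof -
  interpret H: module R H by fact
  have tA: "term_of ?A k = (term_of C k)\<lparr>carrier := trunc_terms j (cobounds C j) C k\<rparr>"
    and tC: "term_of ?C k = (term_of C k)\<lparr>carrier := trunc_terms j (cocycles C j) C k\<rparr>" for k
    by (simp_all add: trunc_below_def)
  have dA: "diff_of ?A = diff_of C" and dC: "diff_of ?C = diff_of C" by (simp_all add: trunc_below_def)
  have sub: "trunc_terms j (cobounds C j) C k \<subseteq> trunc_terms j (cocycles C j) C k" for k
    using cobounds_cocycles[OF C, of j] by (auto simp: trunc_terms_def)
  have z: "\<zero>\<^bsub>term_of C k\<^esub> \<in> trunc_terms j (cocycles C j) C k" for k
    using submodule_zero[OF cocycles_submodule[OF C, of j]] submodule_zero[OF submodule_carrier[OF cx_module[OF C]]]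
    by (auto simp: trunc_terms_def)
  have "chain_map R ?A ?C (\<lambda>k u. u)"
    unfolding chain_map_def tA tC dA dC using subsetD[OF sub] by (auto intro!: linear_mapI)
  moreover have "chain_map R ?C ?D ?g"
    unfolding chain_map_def
  proof (intro conjI allI ballI)
    fix k
    show "linear_map R (term_of ?C k) (term_of ?D k) (?g k)"
    proof (cases "k = j")
      case True
      then show ?thesis using p(1) by (simp add: tC concentrated_def trunc_terms_def)
    next
      case False
      then show ?thesis by (auto simp: concentrated_def intro!: linear_mapI)
    qed
    fix x assume x: "x \<in> carrier (term_of ?C k)"
    show "?g (k + 1) (diff_of ?C k x) = diff_of ?D k (?g k x)"
    proof (cases "k + 1 = j")
      case True
      then have k: "k = j - 1" by simp
      then have "diff_of C k x \<in> cobounds C j" using x by (simp add: tC trunc_terms_def cobounds_def)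
      then show ?thesis using True p(3) cobounds_cocycles[OF C, of j] by (auto simp: dC concentrated_def)
    qed (simp add: concentrated_def)
  qed
  moreover have "\<exists>x\<in>carrier (term_of ?A k). y = x"
    if "y \<in> carrier (term_of ?C k)" "?g k y = \<zero>\<^bsub>term_of ?D k\<^esub>" for k y
    using that p(3)[of y] by (auto simp: tA tC trunc_terms_def concentrated_def split: if_splits)
  moreover have "?g k x = \<zero>\<^bsub>term_of ?D k\<^esub>" if "x \<in> carrier (term_of ?A k)" for k x
    using that p(3)[of x] cobounds_cocycles[OF C, of j] by (auto simp: tA trunc_terms_def concentrated_def split: if_splits)
  moreover have "\<exists>y\<in>carrier (term_of ?C k). w = ?g k y" if "w \<in> carrier (term_of ?D k)" for k w
  proof (cases "k = j")
    case True
    then show ?thesis using that p(2) by (auto simp: tC trunc_terms_def concentrated_def)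
  next
    case False
    then show ?thesis using that z[of k] by (auto simp: tC concentrated_def)
  qed
  ultimately show ?thesis unfolding short_exact_complexes_def by (simp add: tA tC)
qed

locale serre_koszul = serre_class R S + pairing pr p1 p2
  for R :: "('a, 'r) ring_scheme" and S :: "('a, 'm) module set"
    and pr :: "'m \<Rightarrow> 'm \<Rightarrow> 'm" and p1 p2 :: "'m \<Rightarrow> 'm" +
  assumes S_nonempty: "S \<noteq> {}"
begin

text \<open>
  The replacement for the spectral sequence that starts from the Koszul cohomology of the cohomology
  modules of \<open>C\<close>. The canonical truncations \<open>T\<^sub>j\<close> of \<open>C\<close> are treated by induction on \<open>j\<close>: the subcomplex
  of \<open>T\<^sub>j\<close> with the coboundaries in degree \<open>j\<close> is quasi-isomorphic to \<open>T\<^sub>j\<^sub>-\<^sub>1\<close>, and the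
  quotient by it is \<open>H\<^sup>j(C)\<close>.
\<close>

lemma koszul_acyclic_mod:
  fixes C :: "('a, 'm) cochain"
  assumes C: "cochain_complex R C" and xs: "set xs \<subseteq> carrier R"
    and bounded: "\<And>k. k < b \<Longrightarrow> carrier (term_of C k) = {\<zero>\<^bsub>term_of C k\<^esub>}"
    and H: "\<And>j. b \<le> j \<Longrightarrow> \<exists>H p. module R H \<and> linear_map R ((term_of C j)\<lparr>carrier := cocycles C j\<rparr>) H p \<and>
       p ` cocycles C j = carrier H \<and> (\<forall>z\<in>cocycles C j. p z = \<zero>\<^bsub>H\<^esub> \<longleftrightarrow> z \<in> cobounds C j) \<and>
       acyclic_mod R S (koszul R xs (concentrated j H))"
  shows "acyclic_mod R S (koszul R xs C)"
proof -
  let ?T = "\<lambda>j. trunc_below j (cocycles C j) C"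
  have T: "cochain_complex R (?T j)" for j
    by (rule trunc_below_complex[OF C cocycles_submodule[OF C] cobounds_cocycles[OF C]]) simp
  have trunc: "acyclic_mod R S (koszul R xs (?T (b - 1 + int n)))" for n
  proof (induction n)
    case 0
    have "carrier (term_of (?T (b - 1)) k) \<subseteq> {\<zero>\<^bsub>term_of (?T (b - 1)) k\<^esub>}" for k
      using bounded[of k] bounded[of "b - 1"] by (auto simp: trunc_below_def trunc_terms_def cocycles_def)
    then have z: "carrier (term_of (koszul R xs (?T (b - 1))) k) \<subseteq> {\<zero>\<^bsub>term_of (koszul R xs (?T (b - 1))) k\<^esub>}" for k
      by (rule koszul_zero)
    have K: "cochain_complex R (koszul R xs (?T (b - 1)))" by (rule koszul_complex[OF T xs])
    show ?case
      unfolding acyclic_mod_def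
    proof
      fix k
      have "cocycles (koszul R xs (?T (b - 1))) k \<subseteq> cobounds (koszul R xs (?T (b - 1))) k"
        using z[of k] submodule_zero[OF cobounds_submodule[OF K, of k]] by (auto simp: cocycles_def)
      then show "subquotient_in R S (term_of (koszul R xs (?T (b - 1 + int 0))) k)
          (cocycles (koszul R xs (?T (b - 1 + int 0))) k) (cobounds (koszul R xs (?T (b - 1 + int 0))) k)"
        using subquotient_in_trivial[OF S_nonempty cx_module[OF K] cocycles_submodule[OF K] cobounds_submodule[OF K]]
        by simp
    qed
  next
    case (Suc n)
    define j where "j = b - 1 + int (Suc n)"
    have j1: "b - 1 + int n = j - 1" and bj: "b \<le> j" by (simp_all add: j_def)
    let ?B = "trunc_below j (cobounds C j) C"
    have B: "cochain_complex R ?B"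
      by (rule trunc_below_complex[OF C cobounds_submodule[OF C] _ cobounds_cocycles[OF C]]) simp
    have "quasi_iso R (koszul R xs (?T (j - 1))) (koszul R xs ?B) (koszul_map xs (\<lambda>k u. u))"
      by (rule koszul_map_quasi_iso[OF T B trunc_quasi_iso[OF C] xs])
    then have aB: "acyclic_mod R S (koszul R xs ?B)"
      using acyclic_mod_quasi_iso[OF koszul_complex[OF T xs] koszul_complex[OF B xs]] Suc.IH j1 by simp
    obtain H p where H: "module R H" "linear_map R ((term_of C j)\<lparr>carrier := cocycles C j\<rparr>) H p"
       "p ` cocycles C j = carrier H" "\<And>z. z \<in> cocycles C j \<Longrightarrow> p z = \<zero>\<^bsub>H\<^esub> \<longleftrightarrow> z \<in> cobounds C j"
       "acyclic_mod R S (koszul R xs (concentrated j H))" using assms(4)[OF bj] by blast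
    have "acyclic_mod R S (koszul R xs (?T j))"
      by (rule acyclic_mod_middle[OF koszul_complex[OF B xs] koszul_complex[OF T xs]
            koszul_complex[OF concentrated_complex[OF H(1)] xs]
            koszul_map_short_exact[OF B T concentrated_complex[OF H(1)] trunc_short_exact[OF C H(1-4)] xs] aB H(5)])
    then show ?case by (simp add: j_def)
  qed
  show ?thesis
    unfolding acyclic_mod_def
  proof
    fix k
    (* A truncation in degree at least k + 2 agrees with C up to degree k + 1, which the cohomology in degree k requires. *)
    define n where "n = nat (k + 3 - b)"
    define j where "j = b - 1 + int n"
    have j: "k + 1 < j" by (simp add: j_def n_def)
    have eq: "term_of (koszul R xs (?T j)) l = term_of (koszul R xs C) l \<and>
        diff_of (koszul R xs (?T j)) l = diff_of (koszul R xs C) l" if "l \<le> k + 1" for l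
      using that j by (intro koszul_cong[of "k + 1"]) (auto simp: trunc_below_def trunc_terms_def)
    have "subquotient_in R S (term_of (koszul R xs (?T j)) k) (cocycles (koszul R xs (?T j)) k) (cobounds (koszul R xs (?T j)) k)"
      using trunc[of n] by (simp add: acyclic_mod_def j_def)
    then show "subquotient_in R S (term_of (koszul R xs C) k) (cocycles (koszul R xs C) k) (cobounds (koszul R xs C) k)"
      using eq[of k] eq[of "k - 1"] eq[of "k + 1"] by (simp add: cocycles_def cobounds_def)
  qed
qed

end

section \<open>Resolutions as complexes\<close>

definition shifted :: "int \<Rightarrow> (nat \<Rightarrow> ('a, 'm) module) \<Rightarrow> (nat \<Rightarrow> 'm \<Rightarrow> 'm) \<Rightarrow> ('a, 'm) cochain" where
  "shifted n E d =
     (\<lambda>k. if k < n then (E 0)\<lparr>carrier := {\<zero>\<^bsub>E 0\<^esub>}\<rparr> else E (nat (k - n)),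
      \<lambda>k u. if k < n then \<zero>\<^bsub>E 0\<^esub> else d (nat (k - n)) u)"

lemma shifted_simps:
  "k < n \<Longrightarrow> term_of (shifted n E d) k = (E 0)\<lparr>carrier := {\<zero>\<^bsub>E 0\<^esub>}\<rparr>"
  "n \<le> k \<Longrightarrow> term_of (shifted n E d) k = E (nat (k - n))"
  "k < n \<Longrightarrow> diff_of (shifted n E d) k u = \<zero>\<^bsub>E 0\<^esub>"
  "n \<le> k \<Longrightarrow> diff_of (shifted n E d) k u = d (nat (k - n)) u"
  by (simp_all add: shifted_def)

lemma shifted_complex:
  assumes E: "\<And>i. module R (E i)" and d: "\<And>i. linear_map R (E i) (E (Suc i)) (d i)"
    and dd: "\<And>i x. x \<in> carrier (E i) \<Longrightarrow> d (Suc i) (d i x) = \<zero>\<^bsub>E (Suc (Suc i))\<^esub>"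
  shows "cochain_complex R (shifted n E d)"
  unfolding cochain_complex_def
proof (intro conjI allI ballI)
  fix k
  interpret E0: module R "E 0" by (rule E)
  show "module R (term_of (shifted n E d) k)"
    using submodule_module[OF E submodule_zero_set[OF E]] E by (simp add: shifted_def)
  have suc: "nat (k + 1 - n) = Suc (nat (k - n))" if "n \<le> k" using that by simp
  show "linear_map R (term_of (shifted n E d) k) (term_of (shifted n E d) (k + 1)) (diff_of (shifted n E d) k)"
  proof (cases "k < n")
    case True
    then consider "k + 1 < n" | "k + 1 = n" by linarith
    then show ?thesis using True by cases (auto simp: shifted_def intro!: linear_mapI)
  next
    case False
    then show ?thesis using d[of "nat (k - n)"] suc by (simp add: shifted_def)
  qed
  fix x assume x: "x \<in> carrier (term_of (shifted n E d) k)"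
  show "diff_of (shifted n E d) (k + 1) (diff_of (shifted n E d) k x) = \<zero>\<^bsub>term_of (shifted n E d) (k + 1 + 1)\<^esub>"
  proof (cases "k < n")
    case True
    then consider "k + 1 < n" | "k + 1 = n" by linarith
    then show ?thesis
      using True lm_zero[OF E E d, of 0] by cases (auto simp: shifted_def)
  next
    case False
    moreover have "nat (k + 1 + 1 - n) = Suc (Suc (nat (k - n)))" using False by simp
    ultimately show ?thesis using dd[of x "nat (k - n)"] x suc by (simp add: shifted_def)
  qed
qed

locale resolution =
  fixes R :: "('a, 'r) ring_scheme" and M :: "('a, 'b) module" and e :: "'b \<Rightarrow> 'm"
    and E :: "nat \<Rightarrow> ('a, 'm) module" and d :: "nat \<Rightarrow> 'm \<Rightarrow> 'm"
  assumes M: "module R M" and res: "is_injective_resolution R M e E d"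
begin

lemma injective: "injective_module R (E i)"
  and e_lin: "linear_map R M (E 0) e"
  and d_lin: "linear_map R (E i) (E (Suc i)) (d i)"
  and e_inj: "inj_on e (carrier M)"
  and e_image: "e ` carrier M = {x \<in> carrier (E 0). d 0 x = \<zero>\<^bsub>E 1\<^esub>}"
  and d_image: "d i ` carrier (E i) = {x \<in> carrier (E (Suc i)). d (Suc i) x = \<zero>\<^bsub>E (Suc (Suc i))\<^esub>}"
  using res by (auto simp: is_injective_resolution_def a_kernel_eq)

lemma E_module: "module R (E i)" using injective by (simp add: injective_module_def)

lemma complex: "cochain_complex R (shifted n E d)"
  using d_image by (intro shifted_complex E_module d_lin) blast

lemma shifted_injective: "injective_module R (term_of (shifted n E d) k)"
proof (cases "k < n")
  case True
  then have t: "term_of (shifted n E d) k = (E 0)\<lparr>carrier := {\<zero>\<^bsub>E 0\<^esub>}\<rparr>" by (simp add: shifted_def)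
  show ?thesis
    unfolding injective_module_def t
  proof (intro conjI allI impI submodule_module[OF E_module submodule_zero_set[OF E_module]])
    fix A B :: "('a, 'm) module" and u f
    assume "linear_map R A ((E 0)\<lparr>carrier := {\<zero>\<^bsub>E 0\<^esub>}\<rparr>) f"
    then show "\<exists>g. linear_map R B ((E 0)\<lparr>carrier := {\<zero>\<^bsub>E 0\<^esub>}\<rparr>) g \<and> (\<forall>x\<in>carrier A. g (u x) = f x)"
      using lm_codom[OF lm_const_zero[OF E_module[of 0]], of B "{\<zero>\<^bsub>E 0\<^esub>}"]
      by (intro exI[of _ "\<lambda>_. \<zero>\<^bsub>E 0\<^esub>"]) (auto dest: lm_closed)
  qed
qed (simp add: shifted_def injective)

lemma shifted_bounded: "k < n \<Longrightarrow> carrier (term_of (shifted n E d) k) = {\<zero>\<^bsub>term_of (shifted n E d) k\<^esub>}"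
  by (simp add: shifted_def)

lemma shifted_cocycles:
  "cocycles (shifted n E d) k = (if k < n then {\<zero>\<^bsub>E 0\<^esub>} else if k = n then e ` carrier M else
     d (nat (k - n) - 1) ` carrier (E (nat (k - n) - 1)))"
proof -
  consider "k + 1 < n" | "k + 1 = n" | "k = n" | "k > n" by linarith
  then show ?thesis
  proof cases
    case 3
    then show ?thesis by (auto simp: cocycles_def shifted_def e_image)
  next
    case 4
    define i where "i = nat (k - n) - 1"
    have "nat (k - n) = Suc i" "nat (k + 1 - n) = Suc (Suc i)" using 4 by (auto simp: i_def)
    then show ?thesis using 4 d_image[of i] by (auto simp: cocycles_def shifted_def)
  qed (auto simp: cocycles_def shifted_def)
qed

lemma shifted_cobounds:
  "cobounds (shifted n E d) k = (if k \<le> n then {\<zero>\<^bsub>E 0\<^esub>} else d (nat (k - n) - 1) ` carrier (E (nat (k - n) - 1)))"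
proof (cases "k \<le> n")
  case False
  then have "nat (k - 1 - n) = nat (k - n) - 1" by simp
  then show ?thesis using False by (simp add: cobounds_def shifted_def)
qed (auto simp: cobounds_def shifted_def)

end

lemma resolution_iso:
  assumes r: "is_injective_resolution R M e E d" and M: "module R M" and N: "module R N"
    and h: "linear_map R M N h" "bij_betw h (carrier M) (carrier N)"
  shows "is_injective_resolution R N (\<lambda>x. e (inv_into (carrier M) h x)) E d"
proof -
  let ?g = "inv_into (carrier M) h"
  have b: "bij_betw ?g (carrier N) (carrier M)" by (rule bij_betw_inv_into[OF h(2)])
  have "linear_map R N (E 0) (\<lambda>x. e (?g x))"
    using r by (intro lm_comp[OF lm_inverse[OF M h]]) (simp add: is_injective_resolution_def)
  moreover have "inj_on (\<lambda>x. e (?g x)) (carrier N)"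
    using comp_inj_on[of ?g "carrier N" e] b r by (auto simp: bij_betw_def is_injective_resolution_def comp_def)
  moreover have "(\<lambda>x. e (?g x)) ` carrier N = e ` carrier M"
    using b by (metis bij_betw_def image_image)
  ultimately show ?thesis using r by (simp add: is_injective_resolution_def)
qed

text \<open>
  Exactness of the augmented resolution, with \<open>H\<close> viewed as a complex in degree \<open>j\<close>.
\<close>

lemma concentrated_quasi_iso:
  assumes H: "module R H" and r: "is_injective_resolution R H e E d"
  shows "quasi_iso R (concentrated j H) (shifted j E d)
    (\<lambda>k u. if k = j then e u else \<zero>\<^bsub>term_of (shifted j E d) k\<^esub>)" (is "quasi_iso R ?C ?D ?f")
proof -
  interpret r: resolution R H e E d by (rule resolution.intro[OF H r])
  interpret H: module R H by fact
  interpret E0: module R "E 0" by (rule r.E_module)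
  have D: "cochain_complex R ?D" by (rule r.complex)
  have zD: "\<zero>\<^bsub>term_of ?D k\<^esub> \<in> carrier (term_of ?D k)" for k
    by (rule submodule_zero[OF submodule_carrier[OF cx_module[OF D]]])
  have dz: "diff_of ?D k \<zero>\<^bsub>term_of ?D k\<^esub> = \<zero>\<^bsub>term_of ?D (k + 1)\<^esub>" for k
    by (rule lm_zero[OF cx_module[OF D] cx_module[OF D] cx_lin[OF D]])
  have e0: "e \<zero>\<^bsub>H\<^esub> = \<zero>\<^bsub>E 0\<^esub>" by (rule lm_zero[OF H r.E_module r.e_lin])
  have cC: "carrier (term_of ?C k) = (if k = j then carrier H else {\<zero>\<^bsub>H\<^esub>})" for k
    by (simp add: concentrated_def)
  have Dj: "term_of ?D j = E 0" by (simp add: shifted_def)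
  have f0: "?f k \<zero>\<^bsub>H\<^esub> = \<zero>\<^bsub>term_of ?D k\<^esub>" for k using e0 by (simp add: Dj)
  have Hz: "\<zero>\<^bsub>H\<^esub> \<in> cocycles ?C k" "\<zero>\<^bsub>H\<^esub> \<in> cobounds ?C k" for k
    by (auto simp: cocycles_def cobounds_def concentrated_def)
  have zero_l: "\<zero>\<^bsub>term_of ?D k\<^esub> \<oplus>\<^bsub>term_of ?D k\<^esub> u = u" if "u \<in> carrier (term_of ?D k)" for k u
  proof -
    interpret module R "term_of ?D k" by (rule cx_module[OF D])
    show ?thesis using that by simp
  qed
  have cm: "chain_map R ?C ?D ?f"
    unfolding chain_map_def
  proof (intro conjI allI ballI)
    fix k
    show "linear_map R (term_of ?C k) (term_of ?D k) (?f k)"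
    proof (cases "k = j")
      case True
      then show ?thesis using r.e_lin by (simp add: concentrated_def Dj)
    next
      case False
      then show ?thesis using lm_const_zero[OF cx_module[OF D]] by simp
    qed
    fix x assume x: "x \<in> carrier (term_of ?C k)"
    have "?f (k + 1) (diff_of ?C k x) = \<zero>\<^bsub>term_of ?D (k + 1)\<^esub>"
      using f0[of "k + 1"] by (auto simp: concentrated_def e0 Dj)
    moreover have "diff_of ?D k (?f k x) = \<zero>\<^bsub>term_of ?D (k + 1)\<^esub>"
    proof (cases "k = j")
      case True
      then have "e x \<in> {x \<in> carrier (E 0). d 0 x = \<zero>\<^bsub>E 1\<^esub>}" using x r.e_image cC by auto
      then show ?thesis using True by (simp add: shifted_def)
    qed (simp add: dz)
    ultimately show "?f (k + 1) (diff_of ?C k x) = diff_of ?D k (?f k x)" by simp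
  qed
  show ?thesis
    unfolding quasi_iso_def
  proof (intro conjI cm allI ballI impI)
    fix k a assume a: "a \<in> cocycles ?C k" "?f k a \<in> cobounds ?D k"
    have "a = \<zero>\<^bsub>H\<^esub>"
    proof (cases "k = j")
      case True
      then have "e a = e \<zero>\<^bsub>H\<^esub>" "a \<in> carrier H" using a by (simp_all add: r.shifted_cobounds e0 cocycles_def cC)
      then show ?thesis using r.e_inj by (simp add: inj_on_eq_iff)
    qed (use a in \<open>simp add: cocycles_def cC\<close>)
    then show "a \<in> cobounds ?C k" using Hz by simp
  next
    fix k b assume b: "b \<in> cocycles ?D k"
    have bD: "b \<in> carrier (term_of ?D k)" using b by (rule cocyclesD)
    consider "k < j" | "k = j" | "k > j" by linarith
    then show "\<exists>a\<in>cocycles ?C k. \<exists>y\<in>carrier (term_of ?D (k - 1)). b = ?f k a \<oplus>\<^bsub>term_of ?D k\<^esub> diff_of ?D (k - 1) y"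
    proof cases
      case 2
      then obtain a where a: "a \<in> carrier H" "b = e a" using b by (auto simp: r.shifted_cocycles)
      then have "a \<in> cocycles ?C k" using 2 by (simp add: cocycles_def concentrated_def)
      moreover have "b = ?f k a \<oplus>\<^bsub>term_of ?D k\<^esub> diff_of ?D (k - 1) \<zero>\<^bsub>term_of ?D (k - 1)\<^esub>"
        using 2 a lm_closed[OF r.e_lin a(1)] dz[of "k - 1"] by (simp add: Dj)
      ultimately show ?thesis using zD by blast
    next
      case 1
      then have "b \<in> cobounds ?D k" using b by (simp add: r.shifted_cocycles r.shifted_cobounds)
      then obtain y where y: "y \<in> carrier (term_of ?D (k - 1))" "b = diff_of ?D (k - 1) y" by (auto simp: cobounds_iff)
      then have "b = ?f k \<zero>\<^bsub>H\<^esub> \<oplus>\<^bsub>term_of ?D k\<^esub> diff_of ?D (k - 1) y" using f0 zero_l[OF bD] by simp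
      then show ?thesis using y(1) Hz(1) by blast
    next
      case 3
      then have "b \<in> cobounds ?D k" using b by (simp add: r.shifted_cocycles r.shifted_cobounds)
      then obtain y where y: "y \<in> carrier (term_of ?D (k - 1))" "b = diff_of ?D (k - 1) y" by (auto simp: cobounds_iff)
      then have "b = ?f k \<zero>\<^bsub>H\<^esub> \<oplus>\<^bsub>term_of ?D k\<^esub> diff_of ?D (k - 1) y" using f0 zero_l[OF bD] by simp
      then show ?thesis using y(1) Hz(1) by blast
    qed
  qed
qed

lemma quasi_iso_comp:
  assumes A: "cochain_complex R A" and C: "cochain_complex R C" and D: "cochain_complex R D"
    and f: "quasi_iso R A C f" and g: "quasi_iso R C D g"
  shows "quasi_iso R A D (\<lambda>k u. g k (f k u))"
  unfolding quasi_iso_def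
proof (intro conjI allI ballI impI)
  note fm = qi_map[OF f] and gm = qi_map[OF g]
  show "chain_map R A D (\<lambda>k u. g k (f k u))"
    unfolding chain_map_def using lm_comp[OF cm_lin[OF fm] cm_lin[OF gm]] lm_closed[OF cm_lin[OF fm]]
    by (simp add: cm_comm[OF fm] cm_comm[OF gm])
  fix k
  { fix a assume "a \<in> cocycles A k" "g k (f k a) \<in> cobounds D k"
    then show "a \<in> cobounds A k" using qi_inj[OF f] qi_inj[OF g] cm_cocycle[OF A C fm] by blast }
  { fix b assume "b \<in> cocycles D k"
    then obtain c y where c: "c \<in> cocycles C k" and y: "y \<in> carrier (term_of D (k - 1))"
      "b = g k c \<oplus>\<^bsub>term_of D k\<^esub> diff_of D (k - 1) y" using qi_surj[OF g] by blast
    obtain a z where a: "a \<in> cocycles A k" and z: "z \<in> carrier (term_of C (k - 1))"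
      "c = f k a \<oplus>\<^bsub>term_of C k\<^esub> diff_of C (k - 1) z" using qi_surj[OF f c] by blast
    interpret D: module R "term_of D k" by (rule cx_module[OF D])
    interpret D1: module R "term_of D (k - 1)" by (rule cx_module[OF D])
    have fa: "f k a \<in> carrier (term_of C k)" by (rule lm_closed[OF cm_lin[OF fm] cocyclesD(1)[OF a]])
    have dz: "diff_of C (k - 1) z \<in> carrier (term_of C k)" by (rule lm_closed[OF cx_lin'[OF C] z(1)])
    have gz: "g (k - 1) z \<in> carrier (term_of D (k - 1))" by (rule lm_closed[OF cm_lin[OF gm] z(1)])
    have "b = g k (f k a) \<oplus>\<^bsub>term_of D k\<^esub> diff_of D (k - 1) (g (k - 1) z \<oplus>\<^bsub>term_of D (k - 1)\<^esub> y)"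
      using y z(1) fa dz gz lm_closed[OF cm_lin[OF gm] fa] lm_closed[OF cx_lin'[OF D]]
      unfolding y(2) z(2) by (simp add: lm_add[OF cm_lin[OF gm]] lm_add[OF cx_lin'[OF D]] cm_comm'[OF gm] D.M.a_assoc)
    then show "\<exists>a\<in>cocycles A k. \<exists>e\<in>carrier (term_of D (k - 1)). b = g k (f k a) \<oplus>\<^bsub>term_of D k\<^esub> diff_of D (k - 1) e"
      using a gz y(1) by blast }
qed

section \<open>Koszul complexes of divisible complexes\<close>

definition ann_set :: "('a, 'm) module \<Rightarrow> 'a list \<Rightarrow> 'm set" where
  "ann_set M xs = {u \<in> carrier M. \<forall>x\<in>set xs. x \<odot>\<^bsub>M\<^esub> u = \<zero>\<^bsub>M\<^esub>}"

lemma ann_submodule: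
  assumes M: "module R M" and "set xs \<subseteq> carrier R"
  shows "submodule (ann_set M xs) R M"
proof -
  interpret module R M by fact
  show ?thesis
    unfolding ann_set_def
  proof (rule submodule_intro[OF M])
    fix a u assume a: "a \<in> carrier R" and u: "u \<in> {u \<in> carrier M. \<forall>x\<in>set xs. x \<odot>\<^bsub>M\<^esub> u = \<zero>\<^bsub>M\<^esub>}"
    have "x \<odot>\<^bsub>M\<^esub> (a \<odot>\<^bsub>M\<^esub> u) = a \<odot>\<^bsub>M\<^esub> (x \<odot>\<^bsub>M\<^esub> u)" if "x \<in> set xs" for x
    proof -
      have "x \<in> carrier R" using that assms(2) by auto
      then show ?thesis using a u by (simp add: m_comm[of x a] flip: smult_assoc1)
    qed
    then show "a \<odot>\<^bsub>M\<^esub> u \<in> {u \<in> carrier M. \<forall>x\<in>set xs. x \<odot>\<^bsub>M\<^esub> u = \<zero>\<^bsub>M\<^esub>}" using a u by auto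
  qed (use assms(2) in \<open>auto simp: subset_iff smult_r_distr\<close>)
qed

lemma ann_ideal:
  fixes R (structure)
  assumes M: "module R M" and xs: "set xs \<subseteq> carrier R" and u: "u \<in> ann_set M xs" and r: "r \<in> Idl (set xs)"
  shows "r \<odot>\<^bsub>M\<^esub> u = \<zero>\<^bsub>M\<^esub>"
proof -
  interpret module R M by fact
  have uM: "u \<in> carrier M" using u by (simp add: ann_set_def)
  have "ideal {r \<in> carrier R. r \<odot>\<^bsub>M\<^esub> u = \<zero>\<^bsub>M\<^esub>} R"
    using uM by (intro ideal_intro[OF cring_axioms]) (auto simp: smult_l_distr smult_assoc1)
  then have "Idl (set xs) \<subseteq> {r \<in> carrier R. r \<odot>\<^bsub>M\<^esub> u = \<zero>\<^bsub>M\<^esub>}"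
    using xs u by (intro genideal_minimal) (auto simp: ann_set_def)
  then show ?thesis using r by auto
qed

definition ann_complex :: "'a list \<Rightarrow> ('a, 'm) cochain \<Rightarrow> ('a, 'm) cochain" where
  "ann_complex xs C = subcomplex C (\<lambda>k. ann_set (term_of C k) xs)"

lemma ann_complex_simps [simp]:
  "term_of (ann_complex xs C) k = (term_of C k)\<lparr>carrier := ann_set (term_of C k) xs\<rparr>"
  "diff_of (ann_complex xs C) = diff_of C"
  by (simp_all add: ann_complex_def)

lemma ann_lin:
  assumes "module R M" "module R N" "linear_map R M N f" "set xs \<subseteq> carrier R" "u \<in> ann_set M xs"
  shows "f u \<in> ann_set N xs"
  using assms by (auto simp: ann_set_def lm_closed lm_smult[OF assms(3), symmetric] subset_iff lm_zero[OF assms(1-3)])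

lemma ann_complex_complex:
  assumes C: "cochain_complex R C" and xs: "set xs \<subseteq> carrier R"
  shows "cochain_complex R (ann_complex xs C)"
  unfolding ann_complex_def
  by (rule subcomplex_complex[OF C ann_submodule[OF cx_module[OF C] xs]])
    (rule ann_lin[OF cx_module[OF C] cx_module[OF C] cx_lin[OF C] xs])

context pairing
begin

text \<open>
  If multiplication by \<open>x\<close> is surjective on a complex, its cone is the kernel of this multiplication
  up to quasi-isomorphism.
\<close>

lemma ann_cone_quasi_iso:
  assumes A: "cochain_complex R A" and x: "x \<in> carrier R"
    and div: "\<And>k u. u \<in> carrier (term_of A k) \<Longrightarrow> \<exists>v\<in>carrier (term_of A k). x \<odot>\<^bsub>term_of A k\<^esub> v = u"
  shows "quasi_iso R (ann_complex [x] A) (cone R x A) (\<lambda>k u. pr u \<zero>\<^bsub>term_of A (k - 1)\<^esub>)"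
    (is "quasi_iso R ?K ?C ?f")
proof -
  have K: "cochain_complex R ?K" by (rule ann_complex_complex[OF A]) (use x in simp)
  have C: "cochain_complex R ?C" by (rule cone_complex[OF A x])
  have tK: "u \<in> carrier (term_of ?K k) \<longleftrightarrow> u \<in> carrier (term_of A k) \<and> x \<odot>\<^bsub>term_of A k\<^esub> u = \<zero>\<^bsub>term_of A k\<^esub>" for u k
    by (simp add: ann_set_def)
  have dz: "diff_of A (k - 1) \<zero>\<^bsub>term_of A (k - 1)\<^esub> = \<zero>\<^bsub>term_of A k\<^esub>" for k
    by (rule lm_zero[OF cx_module[OF A] cx_module[OF A] cx_lin'[OF A]])
  have zA: "\<zero>\<^bsub>term_of A k\<^esub> \<in> carrier (term_of A k)" for k
    by (rule submodule_zero[OF submodule_carrier[OF cx_module[OF A]]])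
  have cm: "chain_map R ?K ?C ?f"
    unfolding chain_map_def
  proof (intro conjI allI ballI)
    fix k
    interpret A: module R "term_of A k" by (rule cx_module[OF A])
    interpret A1: module R "term_of A (k - 1)" by (rule cx_module[OF A])
    show "linear_map R (term_of ?K k) (term_of ?C k) (?f k)"
      by (rule linear_mapI) (auto simp: ann_set_def)
    fix u assume "u \<in> carrier (term_of ?K k)"
    then show "?f (k + 1) (diff_of ?K k u) = diff_of ?C k (?f k u)"
      by (subst cone_d[OF A x]) (simp_all add: ann_set_def dz)
  qed
  show ?thesis
    unfolding quasi_iso_def
  proof (intro conjI cm allI ballI impI)
    fix k u assume u: "u \<in> cocycles ?K k" "?f k u \<in> cobounds ?C k"
    interpret A1: module R "term_of A (k - 1)" by (rule cx_module[OF A])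
    interpret A2: module R "term_of A (k - 2)" by (rule cx_module[OF A])
    obtain a b where a: "a \<in> carrier (term_of A (k - 1))" and b: "b \<in> carrier (term_of A (k - 2))"
      and ab: "u = diff_of A (k - 1) a"
        "\<zero>\<^bsub>term_of A (k - 1)\<^esub> = x \<odot>\<^bsub>term_of A (k - 1)\<^esub> a \<oplus>\<^bsub>term_of A (k - 1)\<^esub> diff_of A (k - 2) b"
      using u(2) by (auto simp: cone_cobound_iff[OF A x])
    obtain b' where b': "b' \<in> carrier (term_of A (k - 2))" "x \<odot>\<^bsub>term_of A (k - 2)\<^esub> b' = b" using div[OF b] by blast
    let ?a = "a \<oplus>\<^bsub>term_of A (k - 1)\<^esub> diff_of A (k - 2) b'"
    have db': "diff_of A (k - 2) b' \<in> carrier (term_of A (k - 1))" by (rule lm_closed[OF cx_lin2[OF A] b'(1)])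
    have "x \<odot>\<^bsub>term_of A (k - 1)\<^esub> ?a = \<zero>\<^bsub>term_of A (k - 1)\<^esub>"
      using ab(2) a b' db' x by (simp add: A1.smult_r_distr lm_smult[OF cx_lin2[OF A], symmetric])
    then have "?a \<in> carrier (term_of ?K (k - 1))" using a db' unfolding tK by simp
    moreover have "diff_of A (k - 1) (diff_of A (k - 2) b') = \<zero>\<^bsub>term_of A k\<^esub>"
      using cx_dd'[OF A, of b' "k - 1"] b' by simp
    then have "u = diff_of ?K (k - 1) ?a"
      using ab(1) a db' lm_closed[OF cx_lin'[OF A] a] module.axioms(2)[OF cx_module[OF A]]
      by (simp add: lm_add[OF cx_lin'[OF A]] abelian_group_def abelian_monoid.r_zero)
    ultimately show "u \<in> cobounds ?K k" unfolding cobounds_iff by blast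
  next
    fix k w assume "w \<in> cocycles ?C k"
    then have a: "p1 w \<in> cocycles A k" and b: "p2 w \<in> carrier (term_of A (k - 1))"
      and ab: "x \<odot>\<^bsub>term_of A k\<^esub> p1 w = diff_of A (k - 1) (p2 w)" by (simp_all add: cone_cocycle_iff[OF A x])
    interpret A0: module R "term_of A k" by (rule cx_module[OF A])
    interpret A1: module R "term_of A (k - 1)" by (rule cx_module[OF A])
    interpret A3: module R "term_of A (k + 1)" by (rule cx_module[OF A])
    obtain b' where b': "b' \<in> carrier (term_of A (k - 1))" "x \<odot>\<^bsub>term_of A (k - 1)\<^esub> b' = p2 w" using div[OF b] by blast
    have db': "diff_of A (k - 1) b' \<in> carrier (term_of A k)" by (rule lm_closed[OF cx_lin'[OF A] b'(1)])
    have "x \<odot>\<^bsub>term_of A k\<^esub> p1 w = x \<odot>\<^bsub>term_of A k\<^esub> diff_of A (k - 1) b'"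
      using ab b' x by (simp add: lm_smult[OF cx_lin'[OF A], symmetric])
    from lm_eq_split[OF cx_module[OF A] cx_module[OF A] lm_scale[OF cx_module[OF A] cx_module[OF A] lm_id x] cocyclesD(1)[OF a] db' this]
    obtain t where t: "t \<in> carrier (term_of A k)" "p1 w = diff_of A (k - 1) b' \<oplus>\<^bsub>term_of A k\<^esub> t"
      "x \<odot>\<^bsub>term_of A k\<^esub> t = \<zero>\<^bsub>term_of A k\<^esub>" .
    have "diff_of A k t = diff_of A k (p1 w)"
      unfolding t(2) using t(1) db' b' lm_closed[OF cx_lin[OF A] t(1)] by (simp add: lm_add[OF cx_lin[OF A]] cx_dd'[OF A])
    then have "t \<in> cocycles ?K k" using t a by (simp add: cocycles_def ann_set_def)
    moreover have "pr b' \<zero>\<^bsub>term_of A (k - 2)\<^esub> \<in> carrier (term_of ?C (k - 1))" using b' zA by simp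
    moreover have "diff_of ?C (k - 1) (pr b' \<zero>\<^bsub>term_of A (k - 2)\<^esub>) = pr (diff_of A (k - 1) b') (p2 w)"
      using cone_d[OF A x, of "pr b' \<zero>\<^bsub>term_of A (k - 2)\<^esub>" "k - 1"] b' zA[of "k - 2"] dz[of "k - 1"] b by simp
    then have "w = ?f k t \<oplus>\<^bsub>term_of ?C k\<^esub> diff_of ?C (k - 1) (pr b' \<zero>\<^bsub>term_of A (k - 2)\<^esub>)"
      using t db' b pr_p[of w] by (simp add: A0.M.a_comm)
    ultimately show "\<exists>a\<in>cocycles ?K k. \<exists>e\<in>carrier (term_of ?C (k - 1)). w = ?f k a \<oplus>\<^bsub>term_of ?C k\<^esub> diff_of ?C (k - 1) e"
      by blast
  qed
qed

text \<open>
  Surjectivity of \<open>x\<close> on the elements killed by the elements that follow it in the list: these have been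
  used when \<open>koszul\<close> reaches \<open>x\<close>.
\<close>

fun divisible_along :: "('a, 'm) cochain \<Rightarrow> 'a list \<Rightarrow> bool" where
  "divisible_along C [] \<longleftrightarrow> True"
| "divisible_along C (x # xs) \<longleftrightarrow> divisible_along C xs \<and>
     (\<forall>k. \<forall>u\<in>ann_set (term_of C k) xs. \<exists>v\<in>ann_set (term_of C k) xs. x \<odot>\<^bsub>term_of C k\<^esub> v = u)"

lemma ann_koszul_quasi_iso:
  assumes C: "cochain_complex R C" and "set xs \<subseteq> carrier R" "divisible_along C xs"
  shows "\<exists>f. quasi_iso R (ann_complex xs C) (koszul R xs C) f"
  using assms(2,3)
proof (induction xs)
  case Nil
  have "ann_complex [] C = C"
    by (rule prod_eqI) (auto simp: fun_eq_iff ann_complex_def subcomplex_def ann_set_def)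
  moreover have "quasi_iso R C C (\<lambda>k u. u)"
    unfolding quasi_iso_def
  proof (intro conjI allI ballI)
    show "chain_map R C C (\<lambda>k u. u)" by (simp add: chain_map_def lm_id)
    fix k b assume b: "b \<in> cocycles C k"
    interpret module R "term_of C k" by (rule cx_module[OF C])
    have "b = b \<oplus>\<^bsub>term_of C k\<^esub> diff_of C (k - 1) \<zero>\<^bsub>term_of C (k - 1)\<^esub>"
      using b by (simp add: lm_zero[OF cx_module[OF C] cx_module[OF C] cx_lin'[OF C]] cocyclesD)
    then show "\<exists>a\<in>cocycles C k. \<exists>e\<in>carrier (term_of C (k - 1)). b = a \<oplus>\<^bsub>term_of C k\<^esub> diff_of C (k - 1) e"
      using b submodule_zero[OF submodule_carrier[OF cx_module[OF C]]] by blast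
  qed simp
  ultimately show ?case by auto
next
  case (Cons x xs)
  then have x: "x \<in> carrier R" and xs: "set xs \<subseteq> carrier R" by auto
  let ?A = "ann_complex xs C"
  have A: "cochain_complex R ?A" by (rule ann_complex_complex[OF C xs])
  have K: "cochain_complex R (koszul R xs C)" by (rule koszul_complex[OF C xs])
  obtain f where f: "quasi_iso R ?A (koszul R xs C) f" using Cons by auto
  have "ann_complex [x] ?A = ann_complex (x # xs) C"
    by (rule prod_eqI) (auto simp: fun_eq_iff ann_complex_def subcomplex_def ann_set_def conj_ac)
  moreover have "quasi_iso R (ann_complex [x] ?A) (cone R x ?A) (\<lambda>k u. pr u \<zero>\<^bsub>term_of ?A (k - 1)\<^esub>)"
    by (rule ann_cone_quasi_iso[OF A x]) (use Cons.prems(2) in auto)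
  ultimately have g: "quasi_iso R (ann_complex (x # xs) C) (cone R x ?A) (\<lambda>k u. pr u \<zero>\<^bsub>term_of ?A (k - 1)\<^esub>)" by simp
  have h: "quasi_iso R (cone R x ?A) (cone R x (koszul R xs C)) (pair_map f)"
    by (rule pair_map_quasi_iso[OF A K f x])
  show ?case
    using quasi_iso_comp[OF ann_complex_complex[OF C Cons.prems(1)] cone_complex[OF A x] cone_complex[OF K x] g h] by auto
qed

end

section \<open>Regular sequences\<close>

lemma regular_module_module: "cring R \<Longrightarrow> module R (regular_module R)"
proof -
  assume "cring R"
  then interpret cring R .
  have "abelian_group (regular_module R)"
  proof (rule abelian_groupI)
    fix x assume "x \<in> carrier (regular_module R)"
    then show "\<exists>y\<in>carrier (regular_module R). y \<oplus>\<^bsub>regular_module R\<^esub> x = \<zero>\<^bsub>regular_module R\<^esub>"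
      by (intro bexI[of _ "\<ominus>\<^bsub>R\<^esub> x"]) (auto simp: regular_module_def l_neg)
  qed (auto simp: regular_module_def a_ac)
  then show ?thesis
    by (rule moduleI[OF cring_axioms]) (auto simp: regular_module_def l_distr r_distr m_assoc)
qed

lemma regular_module_simps [simp]:
  "carrier (regular_module R) = carrier R" "x \<oplus>\<^bsub>regular_module R\<^esub> y = x \<oplus>\<^bsub>R\<^esub> y"
  "a \<odot>\<^bsub>regular_module R\<^esub> x = a \<otimes>\<^bsub>R\<^esub> x" "\<zero>\<^bsub>regular_module R\<^esub> = \<zero>\<^bsub>R\<^esub>"
  by (simp_all add: regular_module_def)

lemma ideal_submodule:
  assumes "cring R" "ideal J R"
  shows "submodule J R (regular_module R)"
proof -
  interpret J: ideal J R by fact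
  show ?thesis
    by (rule submodule_intro[OF regular_module_module[OF assms(1)]]) (auto simp: J.Icarr J.I_l_closed)
qed

lemma residue_module_module: "cring R \<Longrightarrow> ideal J R \<Longrightarrow> module R (residue_module R J)"
  unfolding residue_module_def by (rule quotient_module_module[OF regular_module_module ideal_submodule])

definition residue :: "('a, 'r) ring_scheme \<Rightarrow> 'a set \<Rightarrow> 'a \<Rightarrow> 'a set" where
  "residue R J r = J +>\<^bsub>regular_module R\<^esub> r"

lemma residue_facts:
  assumes R: "cring R" and J: "ideal J R"
  shows residue_lin: "linear_map R (regular_module R) (residue_module R J) (residue R J)"
    and residue_surj: "residue R J ` carrier R = carrier (residue_module R J)"
    and residue_zero_iff: "\<And>r. r \<in> carrier R \<Longrightarrow> residue R J r = \<zero>\<^bsub>residue_module R J\<^esub> \<longleftrightarrow> r \<in> J"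
proof -
  have "residue R J = (\<lambda>r. J +>\<^bsub>regular_module R\<^esub> r)" by (simp add: residue_def fun_eq_iff)
  then show "linear_map R (regular_module R) (residue_module R J) (residue R J)"
    "residue R J ` carrier R = carrier (residue_module R J)"
    "\<And>r. r \<in> carrier R \<Longrightarrow> residue R J r = \<zero>\<^bsub>residue_module R J\<^esub> \<longleftrightarrow> r \<in> J"
    using quotient_projection[OF regular_module_module[OF R] ideal_submodule[OF R J]]
    by (simp_all add: residue_module_def quotient_module_carrier)
qed

text \<open>
  A regular sequence in the order in which \<open>koszul\<close> consumes a list: each element is regular modulo the ideal
  generated by those that follow it.
\<close>

fun regular_along :: "('a, 'r) ring_scheme \<Rightarrow> 'a list \<Rightarrow> bool" where
  "regular_along R [] \<longleftrightarrow> True"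
| "regular_along R (x # xs) \<longleftrightarrow> regular_along R xs \<and>
     (\<forall>r\<in>carrier R. x \<otimes>\<^bsub>R\<^esub> r \<in> Idl\<^bsub>R\<^esub> (set xs) \<longrightarrow> r \<in> Idl\<^bsub>R\<^esub> (set xs))"

lemma regular_along_rev:
  assumes R: "cring R" and reg: "regular_sequence R xs"
  shows "regular_along R (rev xs)"
proof -
  interpret cring R by fact
  have xs: "set xs \<subseteq> carrier R" using reg by (simp add: regular_sequence_def)
  have "m \<le> length xs \<Longrightarrow> regular_along R (rev (take m xs))" for m
  proof (induction m)
    case (Suc m)
    let ?J = "Idl\<^bsub>R\<^esub> (set (take m xs))" and ?x = "xs ! m"
    have J: "ideal ?J R" using xs set_take_subset[of m xs] by (intro genideal_ideal) auto
    have x: "?x \<in> carrier R" using Suc.prems xs by auto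
    have nz: "nonzerodivisor_on (residue_module R ?J) ?x"
      using reg Suc.prems by (simp add: regular_sequence_def)
    have "r \<in> ?J" if r: "r \<in> carrier R" "?x \<otimes>\<^bsub>R\<^esub> r \<in> ?J" for r
    proof -
      have "?x \<odot>\<^bsub>residue_module R ?J\<^esub> residue R ?J r = residue R ?J (?x \<otimes>\<^bsub>R\<^esub> r)"
        using lm_smult[OF residue_lin[OF R J] x, of r] r by simp
      also have "\<dots> = \<zero>\<^bsub>residue_module R ?J\<^esub>" using residue_zero_iff[OF R J] r x by simp
      finally have "residue R ?J r = \<zero>\<^bsub>residue_module R ?J\<^esub>"
        using nz residue_surj[OF R J] r(1) by (auto simp: nonzerodivisor_on_def)
      then show ?thesis using residue_zero_iff[OF R J r(1)] by simp
    qed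
    then show ?case using Suc by (simp add: take_Suc_conv_app_nth)
  qed simp
  from this[of "length xs"] show ?thesis by simp
qed

text \<open>
  Multiplication by \<open>x\<close> on \<open>R/(xs)\<close> is injective, and \<open>r \<mapsto> r u\<close> is a map from \<open>R/(xs)\<close> to \<open>E\<close>.
  An extension \<open>k\<close> of the latter along the former satisfies \<open>x k(1) = u\<close>.
\<close>

lemma injective_divisible:
  fixes R (structure) and E :: "('a, 'm) module"
  assumes R: "cring R" and cR: "carrier R \<lesssim> (UNIV :: 'm set)" and E: "injective_module R E"
    and xs: "set xs \<subseteq> carrier R" and x: "x \<in> carrier R"
    and reg: "\<And>r. r \<in> carrier R \<Longrightarrow> x \<otimes> r \<in> Idl (set xs) \<Longrightarrow> r \<in> Idl (set xs)"
    and u: "u \<in> ann_set E xs"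
  shows "\<exists>v\<in>ann_set E xs. x \<odot>\<^bsub>E\<^esub> v = u"
proof -
  have mE: "module R E" using E by (simp add: injective_module_def)
  interpret cring R by fact
  interpret E: module R E by fact
  let ?A = "regular_module R"
  have A: "module R ?A" by (rule regular_module_module[OF R])
  have J: "ideal (Idl (set xs)) R" by (rule genideal_ideal[OF xs])
  have uE: "u \<in> carrier E" using u by (simp add: ann_set_def)
  have "carrier ?A \<lesssim> (UNIV :: 'm set)" using cR by simp
  then obtain Q :: "('a, 'm) module" and q where Q: "module R Q" "linear_map R ?A Q q"
    "\<And>r. r \<in> carrier R \<Longrightarrow> q r = \<zero>\<^bsub>Q\<^esub> \<longleftrightarrow> r \<in> Idl (set xs)"
    using quotient_in_universe[OF A ideal_submodule[OF R J]] by (metis regular_module_simps(1))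
  have g: "linear_map R ?A Q (\<lambda>r. q (x \<otimes> r))"
    using lm_comp[OF lm_scale[OF A A lm_id x] Q(2)] by simp
  have h: "linear_map R ?A E (\<lambda>r. r \<odot>\<^bsub>E\<^esub> u)"
    using uE by (intro linear_mapI) (auto simp: E.smult_l_distr E.smult_assoc1)
  obtain k where k: "linear_map R Q E k" "\<And>r. r \<in> carrier R \<Longrightarrow> k (q (x \<otimes> r)) = r \<odot>\<^bsub>E\<^esub> u"
  proof (rule injective_extend[OF E A Q(1) g h])
    fix r assume "r \<in> carrier ?A" "q (x \<otimes> r) = \<zero>\<^bsub>Q\<^esub>"
    then have "r \<in> Idl (set xs)" using Q(3) reg x by simp
    then show "r \<odot>\<^bsub>E\<^esub> u = \<zero>\<^bsub>E\<^esub>" by (rule ann_ideal[OF mE xs u])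
  qed auto
  let ?v = "k (q \<one>)"
  have q1: "q \<one> \<in> carrier Q" using lm_closed[OF Q(2)] by simp
  have sm: "y \<odot>\<^bsub>E\<^esub> ?v = k (q y)" if "y \<in> carrier R" for y
    using that lm_smult[OF Q(2) that, of \<one>] lm_smult[OF k(1) that q1] by simp
  have "y \<odot>\<^bsub>E\<^esub> ?v = \<zero>\<^bsub>E\<^esub>" if "y \<in> set xs" for y
  proof -
    have "y \<in> carrier R" "y \<in> Idl (set xs)" using that xs genideal_self[OF xs] by auto
    moreover from this have "q y = \<zero>\<^bsub>Q\<^esub>" using Q(3) by simp
    ultimately show ?thesis using sm lm_zero[OF Q(1) mE k(1)] by simp
  qed
  moreover have "?v \<in> carrier E" by (rule lm_closed[OF k(1) q1])
  moreover have "x \<odot>\<^bsub>E\<^esub> ?v = u" using sm[OF x] k(2)[of \<one>] x uE by simp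
  ultimately show ?thesis by (auto simp: ann_set_def)
qed

lemma (in pairing) injective_divisible_along:
  fixes R (structure) and C :: "('a, 'm) cochain"
  assumes R: "cring R" and cR: "carrier R \<lesssim> (UNIV :: 'm set)" and E: "\<And>k. injective_module R (term_of C k)"
  shows "set xs \<subseteq> carrier R \<Longrightarrow> regular_along R xs \<Longrightarrow> divisible_along C xs"
  by (induction xs) (auto intro!: injective_divisible[OF R cR E])

section \<open>Cohomology concentrated in one degree\<close>

definition concentrated_cohomology ::
  "('a, 'r) ring_scheme \<Rightarrow> ('a, 'm) cochain \<Rightarrow> int \<Rightarrow> ('a, 'b) module \<Rightarrow> bool" where
  "concentrated_cohomology R C n M \<longleftrightarrow>
     (\<forall>k. k \<noteq> n \<longrightarrow> cocycles C k \<subseteq> cobounds C k) \<and>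
     (\<exists>p. linear_map R ((term_of C n)\<lparr>carrier := cocycles C n\<rparr>) M p \<and> p ` cocycles C n = carrier M \<and>
        (\<forall>z\<in>cocycles C n. p z = \<zero>\<^bsub>M\<^esub> \<longleftrightarrow> z \<in> cobounds C n))"

lemma (in resolution) concentrated_shifted:
  fixes N :: "('a, 'c) module"
  assumes N: "module R N" and h: "linear_map R M N h" "bij_betw h (carrier M) (carrier N)"
  shows "concentrated_cohomology R (shifted n E d) n N"
  unfolding concentrated_cohomology_def
proof (intro conjI allI impI exI)
  interpret M: module R M by (rule M)
  let ?p = "\<lambda>z. h (inv_into (carrier M) e z)"
  have Z: "cocycles (shifted n E d) n = e ` carrier M" and B: "cobounds (shifted n E d) n = {\<zero>\<^bsub>E 0\<^esub>}"
    by (simp_all add: shifted_cocycles shifted_cobounds)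
  have En: "term_of (shifted n E d) n = E 0" by (simp add: shifted_def)
  have "linear_map R ((E 0)\<lparr>carrier := e ` carrier M\<rparr>) M (inv_into (carrier M) e)"
    using e_inj by (intro lm_inverse[OF M lm_codom[OF e_lin]]) (auto simp: bij_betw_def)
  then show "linear_map R ((term_of (shifted n E d) n)\<lparr>carrier := cocycles (shifted n E d) n\<rparr>) N ?p"
    unfolding Z En by (rule lm_comp[OF _ h(1)])
  note [simp] = inv_into_f_f[OF e_inj]
  show "?p ` cocycles (shifted n E d) n = carrier N"
    using h(2) unfolding Z by (auto simp: image_image bij_betw_def)
  have inj: "inj_on h (carrier M)" using h(2) by (simp add: bij_betw_def)
  show "\<forall>z\<in>cocycles (shifted n E d) n. ?p z = \<zero>\<^bsub>N\<^esub> \<longleftrightarrow> z \<in> cobounds (shifted n E d) n"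
  proof
    fix z assume "z \<in> cocycles (shifted n E d) n"
    then obtain m where m: "m \<in> carrier M" "z = e m" unfolding Z by auto
    have "?p z = \<zero>\<^bsub>N\<^esub> \<longleftrightarrow> h m = h \<zero>\<^bsub>M\<^esub>" using m lm_zero[OF M N h(1)] by simp
    also have "\<dots> \<longleftrightarrow> m = \<zero>\<^bsub>M\<^esub>" using inj m(1) by (simp add: inj_on_eq_iff)
    also have "\<dots> \<longleftrightarrow> e m = e \<zero>\<^bsub>M\<^esub>" using e_inj m(1) by (simp add: inj_on_eq_iff)
    finally show "?p z = \<zero>\<^bsub>N\<^esub> \<longleftrightarrow> z \<in> cobounds (shifted n E d) n"
      using m lm_zero[OF M E_module e_lin] B by simp
  qed
  show "cocycles (shifted n E d) k \<subseteq> cobounds (shifted n E d) k" if "k \<noteq> n" for k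
    using that by (auto simp: shifted_cocycles shifted_cobounds)
qed

context pairing
begin

text \<open>
  The long exact sequence of the cone reduces to the multiplication by \<open>x\<close> on \<open>M\<close>, whose kernel is zero
  and whose cokernel \<open>N\<close> appears one degree higher. The isomorphism sends a cocycle \<open>w\<close> to the class of
  \<open>p2 w - x a\<close>, where \<open>a\<close> is any element with coboundary \<open>p1 w\<close>.
\<close>

lemma concentrated_cohomology_cone:
  fixes M :: "('a, 'b) module" and N :: "('a, 'c) module"
  assumes C: "cochain_complex R C" and M: "module R M" and N: "module R N" and x: "x \<in> carrier R"
    and cc: "concentrated_cohomology R C n M" and nz: "nonzerodivisor_on M x"
    and q: "linear_map R M N q" "q ` carrier M = carrier N"
    "\<And>m. m \<in> carrier M \<Longrightarrow> q m = \<zero>\<^bsub>N\<^esub> \<longleftrightarrow> (\<exists>m'\<in>carrier M. m = x \<odot>\<^bsub>M\<^esub> m')"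
  shows "concentrated_cohomology R (cone R x C) (n + 1) N"
proof -
  have ex: "\<And>k. k \<noteq> n \<Longrightarrow> cocycles C k \<subseteq> cobounds C k" using cc by (simp add: concentrated_cohomology_def)
  obtain p where p: "linear_map R ((term_of C n)\<lparr>carrier := cocycles C n\<rparr>) M p" "p ` cocycles C n = carrier M"
    "\<And>z. z \<in> cocycles C n \<Longrightarrow> p z = \<zero>\<^bsub>M\<^esub> \<longleftrightarrow> z \<in> cobounds C n"
    using cc by (auto simp: concentrated_cohomology_def)
  have Zn: "submodule (cocycles C n) R (term_of C n)" by (rule cocycles_submodule[OF C])
  have mZ: "module R ((term_of C n)\<lparr>carrier := cocycles C n\<rparr>)" by (rule submodule_module[OF cx_module[OF C] Zn])
  let ?K = "cone R x C"
  have K: "cochain_complex R ?K" by (rule cone_complex[OF C x])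
  interpret N: module R N by fact
  interpret M: module R M by fact
  have padd: "p (u \<oplus>\<^bsub>term_of C n\<^esub> v) = p u \<oplus>\<^bsub>M\<^esub> p v" if "u \<in> cocycles C n" "v \<in> cocycles C n" for u v
    using lm_add[OF p(1), of u v] that by simp
  have psm: "p (a \<odot>\<^bsub>term_of C n\<^esub> u) = a \<odot>\<^bsub>M\<^esub> p u" if "a \<in> carrier R" "u \<in> cocycles C n" for u a
    using lm_smult[OF p(1), of a u] that by simp
  have pcl: "p u \<in> carrier M" if "u \<in> cocycles C n" for u using lm_closed[OF p(1), of u] that by simp
  (* If the first component of a cocycle of the cone bounds, subtracting a boundary makes it
     vanish and leaves a cocycle of C in the second component. *)
  have split: "\<exists>a t. a \<in> carrier (term_of C (k - 1)) \<and> t \<in> cocycles C (k - 1) \<and> p1 w = diff_of C (k - 1) a \<and>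
      p2 w = x \<odot>\<^bsub>term_of C (k - 1)\<^esub> a \<oplus>\<^bsub>term_of C (k - 1)\<^esub> t"
    if w: "w \<in> cocycles ?K k" and b: "p1 w \<in> cobounds C k" for w k
  proof -
    obtain a where a: "a \<in> carrier (term_of C (k - 1))" "p1 w = diff_of C (k - 1) a" using b by (auto simp: cobounds_iff)
    interpret C1: module R "term_of C (k - 1)" by (rule cx_module[OF C])
    have w2: "p2 w \<in> carrier (term_of C (k - 1))" and eq: "x \<odot>\<^bsub>term_of C k\<^esub> p1 w = diff_of C (k - 1) (p2 w)"
      using w by (simp_all add: cone_cocycle_iff[OF C x])
    have xa: "x \<odot>\<^bsub>term_of C (k - 1)\<^esub> a \<in> carrier (term_of C (k - 1))" using a x by simp
    have "diff_of C (k - 1) (p2 w) = diff_of C (k - 1) (x \<odot>\<^bsub>term_of C (k - 1)\<^esub> a)"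
      using eq a x by (simp add: lm_smult[OF cx_lin'[OF C]])
    from lm_eq_split[OF cx_module[OF C] cx_module[OF C] cx_lin'[OF C] w2 xa this]
    obtain t where "t \<in> carrier (term_of C (k - 1))" "p2 w = x \<odot>\<^bsub>term_of C (k - 1)\<^esub> a \<oplus>\<^bsub>term_of C (k - 1)\<^esub> t"
      "diff_of C (k - 1) t = \<zero>\<^bsub>term_of C k\<^esub>" .
    then show ?thesis using a by (intro exI[of _ a] exI[of _ t]) (auto simp: cocycles_def)
  qed
  have first: "p1 w \<in> cobounds C k" if w: "w \<in> cocycles ?K k" for w k
  proof (cases "k = n")
    case False
    then show ?thesis using ex w by (auto simp: cone_cocycle_iff[OF C x])
  next
    case True
    have a: "p1 w \<in> cocycles C n" and "x \<odot>\<^bsub>term_of C n\<^esub> p1 w \<in> cobounds C n"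
      using w True by (auto simp: cone_cocycle_iff[OF C x] cobounds_iff)
    moreover have "x \<odot>\<^bsub>term_of C n\<^esub> p1 w \<in> cocycles C n" by (rule submodule_smult[OF Zn x a])
    ultimately have "x \<odot>\<^bsub>M\<^esub> p (p1 w) = \<zero>\<^bsub>M\<^esub>" using p(3) psm[OF x a] by metis
    then have "p (p1 w) = \<zero>\<^bsub>M\<^esub>" using nz pcl[OF a] by (simp add: nonzerodivisor_on_def)
    then show ?thesis using p(3)[OF a] True by simp
  qed
  have "cocycles ?K k \<subseteq> cobounds ?K k" if k: "k \<noteq> n + 1" for k
  proof
    fix w assume w: "w \<in> cocycles ?K k"
    obtain a t where at: "a \<in> carrier (term_of C (k - 1))" "t \<in> cocycles C (k - 1)" "p1 w = diff_of C (k - 1) a"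
      "p2 w = x \<odot>\<^bsub>term_of C (k - 1)\<^esub> a \<oplus>\<^bsub>term_of C (k - 1)\<^esub> t"
      using split[OF w first[OF w]] by blast
    have "t \<in> cobounds C (k - 1)" using ex[of "k - 1"] k at(2) by auto
    then obtain b where "b \<in> carrier (term_of C (k - 2))" "t = diff_of C (k - 2) b" by (auto simp: cobounds_iff)
    then show "w \<in> cobounds ?K k" unfolding cone_cobound_iff[OF C x] using at by blast
  qed
  moreover
  define Z where "Z = cocycles ?K (n + 1)"
  have Z: "submodule Z R (term_of ?K (n + 1))" unfolding Z_def by (rule cocycles_submodule[OF K])
  interpret C0: module R "term_of C n" by (rule cx_module[OF C])
  interpret C1: module R "term_of C (n + 1)" by (rule cx_module[OF C])
  have Zsplit: "\<exists>a t. a \<in> carrier (term_of C n) \<and> t \<in> cocycles C n \<and> p1 w = diff_of C n a \<and>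
      p2 w = x \<odot>\<^bsub>term_of C n\<^esub> a \<oplus>\<^bsub>term_of C n\<^esub> t" if "w \<in> Z" for w
    using split[of w "n + 1"] first[of w "n + 1"] that unfolding Z_def by simp
  (* The class of t modulo x depends on w only: another choice of a changes a by a cocycle s,
     and t by x s. *)
  define r where "r w = (SOME y. \<exists>a t. a \<in> carrier (term_of C n) \<and> t \<in> cocycles C n \<and> p1 w = diff_of C n a \<and>
      p2 w = x \<odot>\<^bsub>term_of C n\<^esub> a \<oplus>\<^bsub>term_of C n\<^esub> t \<and> y = q (p t))" for w
  have uniq: "q (p t) = q (p t')"
    if a: "a \<in> carrier (term_of C n)" "a' \<in> carrier (term_of C n)" and t: "t \<in> cocycles C n" "t' \<in> cocycles C n"
      and d: "diff_of C n a = diff_of C n a'"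
      and eq: "x \<odot>\<^bsub>term_of C n\<^esub> a \<oplus>\<^bsub>term_of C n\<^esub> t = x \<odot>\<^bsub>term_of C n\<^esub> a' \<oplus>\<^bsub>term_of C n\<^esub> t'" for a a' t t'
  proof -
    from lm_eq_split[OF cx_module[OF C] cx_module[OF C] cx_lin[OF C] a d]
    obtain s where s: "s \<in> carrier (term_of C n)" "a = a' \<oplus>\<^bsub>term_of C n\<^esub> s"
      "diff_of C n s = \<zero>\<^bsub>term_of C (n + 1)\<^esub>" .
    have sZ: "s \<in> cocycles C n" using s by (simp add: cocycles_def)
    have tC: "t \<in> carrier (term_of C n)" "t' \<in> carrier (term_of C n)" using t by (simp_all add: cocyclesD)
    have "x \<odot>\<^bsub>term_of C n\<^esub> a' \<oplus>\<^bsub>term_of C n\<^esub> t' = x \<odot>\<^bsub>term_of C n\<^esub> a' \<oplus>\<^bsub>term_of C n\<^esub> (x \<odot>\<^bsub>term_of C n\<^esub> s \<oplus>\<^bsub>term_of C n\<^esub> t)"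
      using eq[symmetric] a s(1) x tC unfolding s(2) by (simp add: C0.smult_r_distr C0.M.a_assoc)
    then have "t' = x \<odot>\<^bsub>term_of C n\<^esub> s \<oplus>\<^bsub>term_of C n\<^esub> t"
      using a(2) s(1) x tC by (subst (asm) C0.M.add.l_cancel) auto
    then have "p t' = x \<odot>\<^bsub>M\<^esub> p s \<oplus>\<^bsub>M\<^esub> p t"
      using padd[OF submodule_smult[OF Zn x sZ] t(1)] psm[OF x sZ] by simp
    moreover have "q (x \<odot>\<^bsub>M\<^esub> p s) = \<zero>\<^bsub>N\<^esub>" using q(3)[of "x \<odot>\<^bsub>M\<^esub> p s"] pcl[OF sZ] x by auto
    ultimately show ?thesis using pcl[OF sZ] pcl[OF t(1)] x lm_closed[OF q(1)] by (simp add: lm_add[OF q(1)])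
  qed
  have r: "r w = q (p t)" if "a \<in> carrier (term_of C n)" "t \<in> cocycles C n" "p1 w = diff_of C n a"
      "p2 w = x \<odot>\<^bsub>term_of C n\<^esub> a \<oplus>\<^bsub>term_of C n\<^esub> t" for w a t
    unfolding r_def
  proof (rule some_equality)
    show "\<exists>a' t'. a' \<in> carrier (term_of C n) \<and> t' \<in> cocycles C n \<and> p1 w = diff_of C n a' \<and>
      p2 w = x \<odot>\<^bsub>term_of C n\<^esub> a' \<oplus>\<^bsub>term_of C n\<^esub> t' \<and> q (p t) = q (p t')" using that by blast
    fix y assume "\<exists>a t. a \<in> carrier (term_of C n) \<and> t \<in> cocycles C n \<and> p1 w = diff_of C n a \<and>
      p2 w = x \<odot>\<^bsub>term_of C n\<^esub> a \<oplus>\<^bsub>term_of C n\<^esub> t \<and> y = q (p t)"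
    then obtain a' t' where "a' \<in> carrier (term_of C n)" "t' \<in> cocycles C n" "p1 w = diff_of C n a'"
      "p2 w = x \<odot>\<^bsub>term_of C n\<^esub> a' \<oplus>\<^bsub>term_of C n\<^esub> t'" "y = q (p t')" by blast
    then show "y = q (p t)" using uniq[of a' a t' t] that by simp
  qed
  have "linear_map R ((term_of ?K (n + 1))\<lparr>carrier := Z\<rparr>) N r"
  proof (rule linear_mapI)
    fix w assume "w \<in> carrier ((term_of ?K (n + 1))\<lparr>carrier := Z\<rparr>)"
    then have "w \<in> Z" by simp
    then obtain a t where w: "a \<in> carrier (term_of C n)" "t \<in> cocycles C n" "p1 w = diff_of C n a"
      "p2 w = x \<odot>\<^bsub>term_of C n\<^esub> a \<oplus>\<^bsub>term_of C n\<^esub> t" using Zsplit by blast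
    have tC: "t \<in> carrier (term_of C n)" using w(2) by (rule cocyclesD)
    show "r w \<in> carrier N" using r[OF w] lm_closed[OF q(1) pcl[OF w(2)]] by simp
    { fix v assume "v \<in> carrier ((term_of ?K (n + 1))\<lparr>carrier := Z\<rparr>)"
      then have "v \<in> Z" by simp
      then obtain a' t' where v: "a' \<in> carrier (term_of C n)" "t' \<in> cocycles C n" "p1 v = diff_of C n a'"
        "p2 v = x \<odot>\<^bsub>term_of C n\<^esub> a' \<oplus>\<^bsub>term_of C n\<^esub> t'" using Zsplit by blast
      have tC': "t' \<in> carrier (term_of C n)" using v(2) by (rule cocyclesD)
      have "r (w \<oplus>\<^bsub>term_of ?K (n + 1)\<^esub> v) = q (p (t \<oplus>\<^bsub>term_of C n\<^esub> t'))"
      proof (rule r)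
        show "a \<oplus>\<^bsub>term_of C n\<^esub> a' \<in> carrier (term_of C n)" using w v by simp
        show "t \<oplus>\<^bsub>term_of C n\<^esub> t' \<in> cocycles C n" by (rule submodule_add[OF Zn w(2) v(2)])
        show "p1 (w \<oplus>\<^bsub>term_of ?K (n + 1)\<^esub> v) = diff_of C n (a \<oplus>\<^bsub>term_of C n\<^esub> a')"
          using w v by (simp add: lm_add[OF cx_lin[OF C]])
        show "p2 (w \<oplus>\<^bsub>term_of ?K (n + 1)\<^esub> v) =
            x \<odot>\<^bsub>term_of C n\<^esub> (a \<oplus>\<^bsub>term_of C n\<^esub> a') \<oplus>\<^bsub>term_of C n\<^esub> (t \<oplus>\<^bsub>term_of C n\<^esub> t')"
          using w v tC tC' x by (simp add: C0.smult_r_distr C0.M.a_ac)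
      qed
      then show "r (w \<oplus>\<^bsub>(term_of ?K (n + 1))\<lparr>carrier := Z\<rparr>\<^esub> v) = r w \<oplus>\<^bsub>N\<^esub> r v"
        using r[OF w] r[OF v] padd[OF w(2) v(2)] lm_add[OF q(1) pcl[OF w(2)] pcl[OF v(2)]] by simp }
    { fix b assume b: "b \<in> carrier R"
      have "r (b \<odot>\<^bsub>term_of ?K (n + 1)\<^esub> w) = q (p (b \<odot>\<^bsub>term_of C n\<^esub> t))"
      proof (rule r)
        show "b \<odot>\<^bsub>term_of C n\<^esub> a \<in> carrier (term_of C n)" using w b by simp
        show "b \<odot>\<^bsub>term_of C n\<^esub> t \<in> cocycles C n" by (rule submodule_smult[OF Zn b w(2)])
        show "p1 (b \<odot>\<^bsub>term_of ?K (n + 1)\<^esub> w) = diff_of C n (b \<odot>\<^bsub>term_of C n\<^esub> a)"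
          using w b by (simp add: lm_smult[OF cx_lin[OF C]])
        have "b \<odot>\<^bsub>term_of C n\<^esub> (x \<odot>\<^bsub>term_of C n\<^esub> a) = x \<odot>\<^bsub>term_of C n\<^esub> (b \<odot>\<^bsub>term_of C n\<^esub> a)"
          using b x w(1) by (simp add: N.m_comm[of b x] flip: C0.smult_assoc1)
        then show "p2 (b \<odot>\<^bsub>term_of ?K (n + 1)\<^esub> w) =
            x \<odot>\<^bsub>term_of C n\<^esub> (b \<odot>\<^bsub>term_of C n\<^esub> a) \<oplus>\<^bsub>term_of C n\<^esub> b \<odot>\<^bsub>term_of C n\<^esub> t"
          using w tC x b by (simp add: C0.smult_r_distr)
      qed
      then show "r (b \<odot>\<^bsub>(term_of ?K (n + 1))\<lparr>carrier := Z\<rparr>\<^esub> w) = b \<odot>\<^bsub>N\<^esub> r w"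
        using r[OF w] psm[OF b w(2)] lm_smult[OF q(1) b pcl[OF w(2)]] by simp }
  qed
  moreover have "r ` Z = carrier N"
  proof
    show "r ` Z \<subseteq> carrier N" using Zsplit r lm_closed[OF q(1) pcl] by force
    show "carrier N \<subseteq> r ` Z"
    proof
      fix y assume "y \<in> carrier N"
      then have "y \<in> q ` p ` cocycles C n" unfolding p(2) q(2) .
      then obtain t where t: "t \<in> cocycles C n" "y = q (p t)" by blast
      have tC: "t \<in> carrier (term_of C n)" "diff_of C n t = \<zero>\<^bsub>term_of C (n + 1)\<^esub>" using t(1) by (simp_all add: cocyclesD)
      let ?w = "pr \<zero>\<^bsub>term_of C (n + 1)\<^esub> t"
      have "?w \<in> Z"
        using tC x submodule_zero[OF cocycles_submodule[OF C, of "n + 1"]] by (simp add: Z_def cone_cocycle_iff[OF C x])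
      moreover have "r ?w = q (p t)"
        using tC x by (intro r[of "\<zero>\<^bsub>term_of C n\<^esub>"] t) (simp_all add: lm_zero[OF cx_module[OF C] cx_module[OF C] cx_lin[OF C]])
      ultimately show "y \<in> r ` Z" using t(2) by (metis imageI)
    qed
  qed
  moreover have "r w = \<zero>\<^bsub>N\<^esub> \<longleftrightarrow> w \<in> cobounds ?K (n + 1)" if wZ: "w \<in> Z" for w
  proof
    assume "r w = \<zero>\<^bsub>N\<^esub>"
    obtain a t where w: "a \<in> carrier (term_of C n)" "t \<in> cocycles C n" "p1 w = diff_of C n a"
      "p2 w = x \<odot>\<^bsub>term_of C n\<^esub> a \<oplus>\<^bsub>term_of C n\<^esub> t" using Zsplit[OF wZ] by blast
    then have "q (p t) = \<zero>\<^bsub>N\<^esub>" using r[OF w] \<open>r w = \<zero>\<^bsub>N\<^esub>\<close> by simp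
    then have "\<exists>m\<in>p ` cocycles C n. p t = x \<odot>\<^bsub>M\<^esub> m" using q(3)[OF pcl[OF w(2)]] unfolding p(2) by simp
    then obtain s where s: "s \<in> cocycles C n" "p t = x \<odot>\<^bsub>M\<^esub> p s" by blast
    have xs: "x \<odot>\<^bsub>term_of C n\<^esub> s \<in> cocycles C n" by (rule submodule_smult[OF Zn x s(1)])
    have "p t = p (x \<odot>\<^bsub>term_of C n\<^esub> s)" using s psm[OF x s(1)] by simp
    from lm_eq_split[OF mZ M p(1) _ _ this]
    obtain y where y: "y \<in> cocycles C n" "t = x \<odot>\<^bsub>term_of C n\<^esub> s \<oplus>\<^bsub>term_of C n\<^esub> y" "p y = \<zero>\<^bsub>M\<^esub>"
      using w(2) xs by auto
    then obtain b where b: "b \<in> carrier (term_of C (n - 1))" "y = diff_of C (n - 1) b"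
      using p(3) by (auto simp: cobounds_iff)
    have sC: "s \<in> carrier (term_of C n)" "diff_of C n s = \<zero>\<^bsub>term_of C (n + 1)\<^esub>" using s(1) by (simp_all add: cocyclesD)
    have yC: "y \<in> carrier (term_of C n)" using y(1) by (rule cocyclesD)
    have "p1 w = diff_of C n (a \<oplus>\<^bsub>term_of C n\<^esub> s)"
      using w sC lm_closed[OF cx_lin[OF C] w(1)] by (simp add: lm_add[OF cx_lin[OF C]])
    moreover have "p2 w = x \<odot>\<^bsub>term_of C n\<^esub> (a \<oplus>\<^bsub>term_of C n\<^esub> s) \<oplus>\<^bsub>term_of C n\<^esub> diff_of C (n - 1) b"
      using w sC yC x unfolding y(2) b(2)[symmetric] by (simp add: C0.smult_r_distr C0.M.a_assoc)
    moreover have "a \<oplus>\<^bsub>term_of C n\<^esub> s \<in> carrier (term_of C n)" using w sC by simp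
    ultimately show "w \<in> cobounds ?K (n + 1)"
      using b(1) cone_cobound_iff[OF C x, of w "n + 1"] by auto
  next
    assume "w \<in> cobounds ?K (n + 1)"
    then obtain a b where ab: "a \<in> carrier (term_of C n)" "b \<in> carrier (term_of C (n - 1))" "p1 w = diff_of C n a"
      "p2 w = x \<odot>\<^bsub>term_of C n\<^esub> a \<oplus>\<^bsub>term_of C n\<^esub> diff_of C (n - 1) b"
      using cone_cobound_iff[OF C x, of w "n + 1"] by auto
    have db: "diff_of C (n - 1) b \<in> cobounds C n" using ab(2) by (auto simp: cobounds_iff)
    have dbZ: "diff_of C (n - 1) b \<in> cocycles C n" using db cobounds_cocycles[OF C] by auto
    show "r w = \<zero>\<^bsub>N\<^esub>"
      using r[OF ab(1) dbZ ab(3,4)] p(3)[OF dbZ] db lm_zero[OF M N q(1)] by simp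
  qed
  ultimately show ?thesis unfolding concentrated_cohomology_def Z_def by blast
qed

lemma Idl_insert:
  fixes R (structure)
  assumes R: "cring R" and x: "x \<in> carrier R" and A: "A \<subseteq> carrier R"
  shows "Idl (insert x A) = {x \<otimes> s \<oplus> a | s a. s \<in> carrier R \<and> a \<in> Idl A}"
proof
  interpret cring R by fact
  let ?K = "{x \<otimes> s \<oplus> a | s a. s \<in> carrier R \<and> a \<in> Idl A}"
  interpret J: ideal "Idl A" R by (rule genideal_ideal[OF A])
  interpret I: ideal "Idl (insert x A)" R by (rule genideal_ideal) (use x A in auto)
  show "Idl (insert x A) \<subseteq> ?K"
  proof (rule genideal_minimal)
    show "ideal ?K R"
    proof (rule ideal_intro[OF R])
      show "?K \<subseteq> carrier R" using x J.Icarr by auto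
      show "\<zero> \<in> ?K" using x J.zero_closed by (auto intro!: exI[of _ \<zero>])
      fix u assume "u \<in> ?K"
      then obtain s a where u: "u = x \<otimes> s \<oplus> a" "s \<in> carrier R" "a \<in> Idl A" by blast
      { fix v assume "v \<in> ?K"
        then obtain t b where v: "v = x \<otimes> t \<oplus> b" "t \<in> carrier R" "b \<in> Idl A" by blast
        have "u \<oplus> v = x \<otimes> (s \<oplus> t) \<oplus> (a \<oplus> b)"
          using u v x J.Icarr by (simp add: r_distr a_ac)
        then show "u \<oplus> v \<in> ?K" using u v J.a_closed by blast }
      { fix c assume c: "c \<in> carrier R"
        have "c \<otimes> u = x \<otimes> (c \<otimes> s) \<oplus> c \<otimes> a"
          using u x c J.Icarr by (simp add: r_distr m_lcomm)
        then show "c \<otimes> u \<in> ?K" using u c J.I_l_closed by blast }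
    qed
    have "x = x \<otimes> \<one> \<oplus> \<zero>" using x by simp
    then have "x \<in> ?K" using J.zero_closed by blast
    moreover have "a \<in> ?K" if "a \<in> A" for a
    proof -
      have "a \<in> Idl A" using genideal_self[OF A] that by auto
      moreover have "a = x \<otimes> \<zero> \<oplus> a" using x A that by auto
      ultimately show ?thesis by blast
    qed
    ultimately show "insert x A \<subseteq> ?K" by blast
  qed
  show "?K \<subseteq> Idl (insert x A)"
  proof
    fix u assume "u \<in> ?K"
    then obtain s a where u: "u = x \<otimes> s \<oplus> a" "s \<in> carrier R" "a \<in> Idl A" by blast
    have "insert x A \<subseteq> Idl (insert x A)" by (rule genideal_self) (use x A in auto)
    moreover from this have "Idl A \<subseteq> Idl (insert x A)"
      using I.ideal_axioms by (intro genideal_minimal) auto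
    ultimately show "u \<in> Idl (insert x A)" using u by (auto intro!: I.a_closed I.I_r_closed)
  qed
qed

lemma concentrated_cohomology_koszul:
  fixes R (structure)
  assumes R: "cring R" and C: "cochain_complex R C"
    and c0: "concentrated_cohomology R C 0 (residue_module R (Idl {}))"
  shows "set xs \<subseteq> carrier R \<Longrightarrow> regular_along R xs \<Longrightarrow>
    concentrated_cohomology R (koszul R xs C) (int (length xs)) (residue_module R (Idl (set xs)))"
proof (induction xs)
  case Nil
  then show ?case using c0 by simp
next
  case (Cons x xs)
  interpret cring R by fact
  have x: "x \<in> carrier R" and xs: "set xs \<subseteq> carrier R" using Cons.prems by auto
  let ?J = "Idl (set xs)" and ?K = "Idl (set (x # xs))"
  have J: "ideal ?J R" and K: "ideal ?K R" using Cons.prems(1) by (auto intro!: genideal_ideal)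
  interpret J: ideal ?J R by (rule J)
  note rJ = residue_facts[OF R J] and rK = residue_facts[OF R K]
  have mJ: "module R (residue_module R ?J)" and mK: "module R (residue_module R ?K)"
    by (rule residue_module_module[OF R J], rule residue_module_module[OF R K])
  interpret MJ: module R "residue_module R ?J" by (rule mJ)
  have Keq: "?K = {x \<otimes> s \<oplus> a | s a. s \<in> carrier R \<and> a \<in> ?J}" using Idl_insert[OF R x xs] by simp
  have JK: "?J \<subseteq> ?K"
  proof
    fix a assume "a \<in> ?J"
    moreover from this have "a = x \<otimes> \<zero> \<oplus> a" using x J.Icarr by simp
    ultimately show "a \<in> ?K" unfolding Keq by blast
  qed
  obtain q where q: "linear_map R (residue_module R ?J) (residue_module R ?K) q"
    "\<And>r. r \<in> carrier R \<Longrightarrow> q (residue R ?J r) = residue R ?K r"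
  proof (rule linear_factor[OF regular_module_module[OF R] mJ mK rJ(1) rK(1)])
    show "residue R ?J ` carrier (regular_module R) = carrier (residue_module R ?J)" using rJ(2) by simp
    show "residue R ?K z = \<zero>\<^bsub>residue_module R ?K\<^esub>"
      if "z \<in> carrier (regular_module R)" "residue R ?J z = \<zero>\<^bsub>residue_module R ?J\<^esub>" for z
      using that rJ(3)[of z] rK(3)[of z] JK by auto
  qed simp
  have add: "residue R ?J (r \<oplus> s) = residue R ?J r \<oplus>\<^bsub>residue_module R ?J\<^esub> residue R ?J s"
    if "r \<in> carrier R" "s \<in> carrier R" for r s using lm_add[OF rJ(1), of r s] that by simp
  have sm: "residue R ?J (r \<otimes> s) = r \<odot>\<^bsub>residue_module R ?J\<^esub> residue R ?J s"
    if "r \<in> carrier R" "s \<in> carrier R" for r s using lm_smult[OF rJ(1), of r s] that by simp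
  have cl: "residue R ?J r \<in> carrier (residue_module R ?J)" if "r \<in> carrier R" for r using rJ(2) that by auto
  have "concentrated_cohomology R (cone R x (koszul R xs C)) (int (length xs) + 1) (residue_module R ?K)"
  proof (rule concentrated_cohomology_cone[OF koszul_complex[OF C xs] mJ mK x])
    show "concentrated_cohomology R (koszul R xs C) (int (length xs)) (residue_module R ?J)"
      using Cons by simp
    show "nonzerodivisor_on (residue_module R ?J) x"
      unfolding nonzerodivisor_on_def
    proof (intro ballI impI)
      fix m assume "m \<in> carrier (residue_module R ?J)" and m: "x \<odot>\<^bsub>residue_module R ?J\<^esub> m = \<zero>\<^bsub>residue_module R ?J\<^esub>"
      then obtain r where r: "r \<in> carrier R" "m = residue R ?J r" unfolding rJ(2)[symmetric] by blast
      then have "x \<otimes> r \<in> ?J" using m sm[OF x r(1)] rJ(3)[of "x \<otimes> r"] x by simp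
      then show "m = \<zero>\<^bsub>residue_module R ?J\<^esub>" using Cons.prems(2) r rJ(3) by simp
    qed
    show "linear_map R (residue_module R ?J) (residue_module R ?K) q" by (rule q)
    show "q ` carrier (residue_module R ?J) = carrier (residue_module R ?K)"
      unfolding rJ(2)[symmetric] rK(2)[symmetric] using q(2) by (auto simp: image_image)
    fix m assume "m \<in> carrier (residue_module R ?J)"
    then obtain r where r: "r \<in> carrier R" "m = residue R ?J r" using rJ(2) by auto
    have "q m = \<zero>\<^bsub>residue_module R ?K\<^esub> \<longleftrightarrow> r \<in> ?K" using r q(2) rK(3) by simp
    also have "\<dots> \<longleftrightarrow> (\<exists>m'\<in>carrier (residue_module R ?J). m = x \<odot>\<^bsub>residue_module R ?J\<^esub> m')"
    proof
      assume "r \<in> ?K"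
      then obtain s a where s: "r = x \<otimes> s \<oplus> a" "s \<in> carrier R" "a \<in> ?J" unfolding Keq by blast
      then have "m = x \<odot>\<^bsub>residue_module R ?J\<^esub> residue R ?J s"
        using r x J.Icarr rJ(3)[of a] cl[of s] by (simp add: add sm)
      then show "\<exists>m'\<in>carrier (residue_module R ?J). m = x \<odot>\<^bsub>residue_module R ?J\<^esub> m'" using cl[OF s(2)] by blast
    next
      assume "\<exists>m'\<in>carrier (residue_module R ?J). m = x \<odot>\<^bsub>residue_module R ?J\<^esub> m'"
      then obtain s where s: "s \<in> carrier R" "residue R ?J r = residue R ?J (x \<otimes> s)"
        unfolding rJ(2)[symmetric] using r x sm by auto
      from lm_eq_split[OF regular_module_module[OF R] mJ rJ(1) _ _ s(2)] r s x
      obtain a where a: "a \<in> carrier R" "r = x \<otimes> s \<oplus> a" "residue R ?J a = \<zero>\<^bsub>residue_module R ?J\<^esub>" by auto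
      then have "a \<in> ?J" using rJ(3) by simp
      then show "r \<in> ?K" unfolding Keq using a(2) s(1) by blast
    qed
    finally show "q m = \<zero>\<^bsub>residue_module R ?K\<^esub> \<longleftrightarrow> (\<exists>m'\<in>carrier (residue_module R ?J). m = x \<odot>\<^bsub>residue_module R ?J\<^esub> m')" .
  qed
  then show ?case by (simp add: add.commute)
qed

end

section \<open>Comparison with a resolution\<close>

text \<open>
  The comparison theorem. Below degree \<open>n\<close> the map is zero, in degree \<open>n\<close> it extends
  \<open>Z\<^sup>n \<rightarrow> M \<rightarrow> E\<^sup>0\<close>, and in the following degrees it is prescribed on coboundaries, which agree with the
  cocycles there, and extended by injectivity.
\<close>

lemma (in resolution) quasi_iso_to_shifted:
  fixes C :: "('a, 'm) cochain"
  assumes C: "cochain_complex R C" and cc: "concentrated_cohomology R C n M"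
  shows "\<exists>f. quasi_iso R C (shifted n E d) f"
proof -
  have ex: "\<And>k. k \<noteq> n \<Longrightarrow> cocycles C k \<subseteq> cobounds C k" using cc by (simp add: concentrated_cohomology_def)
  obtain p where p: "linear_map R ((term_of C n)\<lparr>carrier := cocycles C n\<rparr>) M p" "p ` cocycles C n = carrier M"
    "\<And>z. z \<in> cocycles C n \<Longrightarrow> p z = \<zero>\<^bsub>M\<^esub> \<longleftrightarrow> z \<in> cobounds C n"
    using cc by (auto simp: concentrated_cohomology_def)
  note mC = cx_module[OF C]
  have mZ: "module R ((term_of C n)\<lparr>carrier := cocycles C n\<rparr>)"
    by (rule submodule_module[OF mC cocycles_submodule[OF C]])
  let ?D = "shifted n E d"
  have D: "cochain_complex R ?D" by (rule complex)
  define P where "P m f \<longleftrightarrow> linear_map R (term_of C (n + int m)) (E m) f \<and>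
      (\<forall>a\<in>cocycles C (n + int m). d m (f a) = \<zero>\<^bsub>E (Suc m)\<^esub>) \<and>
      (m = 0 \<longrightarrow> (\<forall>z\<in>cocycles C n. f z = e (p z)))" for m f
  define Q where "Q m f g \<longleftrightarrow> (\<forall>a\<in>carrier (term_of C (n + int m)). g (diff_of C (n + int m) a) = d m (f a))"
    for m and f g :: "'m \<Rightarrow> 'm"
  have "\<exists>F. \<forall>m. P m (F m) \<and> Q m (F m) (F (Suc m))"
  proof (rule dependent_nat_choice)
    have "linear_map R ((term_of C n)\<lparr>carrier := cocycles C n\<rparr>) (term_of C n) (\<lambda>x. x)"
      by (rule lm_restrict[OF lm_id submodule_subset[OF cocycles_submodule[OF C]]])
    then obtain f where f: "linear_map R (term_of C n) (E 0) f" "\<And>z. z \<in> cocycles C n \<Longrightarrow> f z = e (p z)"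
    proof (rule injective_extend[OF injective mZ mC _ lm_comp[OF p(1) e_lin]])
      fix x assume "x \<in> carrier ((term_of C n)\<lparr>carrier := cocycles C n\<rparr>)" "x = \<zero>\<^bsub>term_of C n\<^esub>"
      then show "e (p x) = \<zero>\<^bsub>E 0\<^esub>"
        using lm_zero[OF mZ M p(1)] lm_zero[OF M E_module e_lin] by simp
    qed auto
    have "d 0 (f a) = \<zero>\<^bsub>E (Suc 0)\<^esub>" if "a \<in> cocycles C n" for a
    proof -
      have "e (p a) \<in> e ` carrier M" using lm_closed[OF p(1), of a] that by simp
      then show ?thesis using f(2)[OF that] e_image by simp
    qed
    then show "\<exists>f. P 0 f" using f by (auto simp: P_def)
  next
    fix f m assume Pf: "P m f"
    let ?k = "n + int m"
    have k1: "n + int (Suc m) = ?k + 1" by simp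
    have f: "linear_map R (term_of C ?k) (E m) f" and fZ: "\<And>a. a \<in> cocycles C ?k \<Longrightarrow> d m (f a) = \<zero>\<^bsub>E (Suc m)\<^esub>"
      using Pf by (auto simp: P_def)
    obtain g where g: "linear_map R (term_of C (?k + 1)) (E (Suc m)) g"
      "\<And>a. a \<in> carrier (term_of C ?k) \<Longrightarrow> g (diff_of C ?k a) = d m (f a)"
      using injective_extend[OF injective mC mC cx_lin[OF C] lm_comp[OF f d_lin]] fZ
      by (metis cocyclesI)
    have "d (Suc m) (g a) = \<zero>\<^bsub>E (Suc (Suc m))\<^esub>" if aZ: "a \<in> cocycles C (?k + 1)" for a
    proof -
      have "a \<in> cobounds C (?k + 1)" using ex[of "?k + 1"] aZ by auto
      then obtain b where b: "b \<in> carrier (term_of C ?k)" "a = diff_of C ?k b"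
        by (auto simp: cobounds_iff)
      have "d m (f b) \<in> d m ` carrier (E m)" using lm_closed[OF f b(1)] by simp
      then show ?thesis using g(2) b d_image by simp
    qed
    then show "\<exists>g. P (Suc m) g \<and> Q m f g" using g unfolding P_def Q_def k1 by auto
  qed
  then obtain F where F: "\<And>m. P m (F m)" "\<And>m. Q m (F m) (F (Suc m))" by blast
  have Fl: "linear_map R (term_of C (n + int m)) (E m) (F m)" for m using F(1) by (simp add: P_def)
  have F0: "F 0 z = e (p z)" if "z \<in> cocycles C n" for z using F(1)[of 0] that by (simp add: P_def)
  have Fd: "F (Suc m) (diff_of C (n + int m) a) = d m (F m a)" if "a \<in> carrier (term_of C (n + int m))" for m a
    using F(2)[of m] that by (simp add: Q_def)
  define f where "f k u = (if k < n then \<zero>\<^bsub>term_of ?D k\<^esub> else F (nat (k - n)) u)" for k u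
  have zD: "\<zero>\<^bsub>term_of ?D k\<^esub> \<in> carrier (term_of ?D k)" for k
    by (rule submodule_zero[OF submodule_carrier[OF cx_module[OF D]]])
  have dz: "diff_of ?D k \<zero>\<^bsub>term_of ?D k\<^esub> = \<zero>\<^bsub>term_of ?D (k + 1)\<^esub>" for k
    by (rule lm_zero[OF cx_module[OF D] cx_module[OF D] cx_lin[OF D]])
  have cm: "chain_map R C ?D f"
    unfolding chain_map_def
  proof (intro conjI allI ballI)
    fix k
    show "linear_map R (term_of C k) (term_of ?D k) (f k)"
    proof (cases "k < n")
      case True
      have "linear_map R (term_of C k) (term_of ?D k) (\<lambda>_. \<zero>\<^bsub>term_of ?D k\<^esub>)"
        by (rule lm_const_zero[OF cx_module[OF D]])
      moreover have "f k = (\<lambda>_. \<zero>\<^bsub>term_of ?D k\<^esub>)" using True by (simp add: f_def fun_eq_iff)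
      ultimately show ?thesis by simp
    next
      case False
      then have "n + int (nat (k - n)) = k" by simp
      moreover have "f k = F (nat (k - n))" using False by (simp add: f_def fun_eq_iff)
      ultimately show ?thesis using Fl[of "nat (k - n)"] False by (simp add: shifted_simps)
    qed
    fix x assume x: "x \<in> carrier (term_of C k)"
    consider "k + 1 < n" | "k + 1 = n" | "n \<le> k" by linarith
    then show "f (k + 1) (diff_of C k x) = diff_of ?D k (f k x)"
    proof cases
      case 1
      then show ?thesis using dz[of k] by (simp add: f_def)
    next
      case 2
      then have k: "k = n - 1" by simp
      have b: "diff_of C (n - 1) x \<in> cobounds C n" using x unfolding k by (auto simp: cobounds_iff)
      then have bZ: "diff_of C (n - 1) x \<in> cocycles C n" using cobounds_cocycles[OF C] by auto
      have "p (diff_of C (n - 1) x) = \<zero>\<^bsub>M\<^esub>" using p(3)[OF bZ] b by simp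
      then have "F 0 (diff_of C (n - 1) x) = \<zero>\<^bsub>E 0\<^esub>"
        using F0[OF bZ] lm_zero[OF M E_module e_lin] by simp
      then show ?thesis using dz[of k] k by (simp add: f_def shifted_simps)
    next
      case 3
      then obtain m where m: "k = n + int m" using zle_iff_zadd by blast
      then have "nat (k + 1 - n) = Suc m" "nat (k - n) = m" by simp_all
      then show ?thesis using Fd[of x m] x m by (simp add: f_def shifted_simps)
    qed
  qed
  have sur: "\<exists>a\<in>cocycles C k. \<exists>y\<in>carrier (term_of ?D (k - 1)). b = f k a \<oplus>\<^bsub>term_of ?D k\<^esub> diff_of ?D (k - 1) y"
    if b: "b \<in> cocycles ?D k" for k b
  proof -
    interpret Dk: module R "term_of ?D k" by (rule cx_module[OF D])
    have bD: "b \<in> carrier (term_of ?D k)" using b by (rule cocyclesD)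
    show ?thesis
    proof (cases "k = n")
      case True
      then obtain m where "m \<in> carrier M" "b = e m" using b by (auto simp: shifted_cocycles)
      then have "b \<in> e ` p ` cocycles C n" unfolding p(2) by simp
      then obtain a where a: "a \<in> cocycles C n" "b = e (p a)" by blast
      have "f k a = b" using True a F0 by (simp add: f_def)
      then have "b = f k a \<oplus>\<^bsub>term_of ?D k\<^esub> diff_of ?D (k - 1) \<zero>\<^bsub>term_of ?D (k - 1)\<^esub>"
        using dz[of "k - 1"] bD by simp
      then show ?thesis using a(1) zD True by blast
    next
      case False
      then have "b \<in> cobounds ?D k" using b by (auto simp: shifted_cocycles shifted_cobounds)
      then obtain y where y: "y \<in> carrier (term_of ?D (k - 1))" "b = diff_of ?D (k - 1) y" by (auto simp: cobounds_iff)
      have "f k \<zero>\<^bsub>term_of C k\<^esub> = \<zero>\<^bsub>term_of ?D k\<^esub>" by (rule lm_zero[OF mC cx_module[OF D] cm_lin[OF cm]])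
      then have "b = f k \<zero>\<^bsub>term_of C k\<^esub> \<oplus>\<^bsub>term_of ?D k\<^esub> diff_of ?D (k - 1) y" using y bD by simp
      then show ?thesis using y(1) submodule_zero[OF cocycles_submodule[OF C]] by blast
    qed
  qed
  have inj: "a \<in> cobounds C k" if a: "a \<in> cocycles C k" "f k a \<in> cobounds ?D k" for k a
  proof (cases "k = n")
    case False
    then show ?thesis using ex a by auto
  next
    case True
    interpret M: module R M by (rule M)
    have aZ: "a \<in> cocycles C n" using a True by simp
    have "e (p a) = e \<zero>\<^bsub>M\<^esub>" using a True F0 lm_zero[OF M E_module e_lin] by (simp add: f_def shifted_cobounds)
    then have "p a = \<zero>\<^bsub>M\<^esub>" using e_inj lm_closed[OF p(1), of a] aZ by (simp add: inj_on_eq_iff)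
    then show ?thesis using p(3)[OF aZ] True by simp
  qed
  show ?thesis using cm sur inj unfolding quasi_iso_def by blast
qed

section \<open>Torsion\<close>

definition torsion_set :: "('a, 'r) ring_scheme \<Rightarrow> 'a set \<Rightarrow> ('a, 'b) module \<Rightarrow> 'b set" where
  "torsion_set R I M = {x \<in> carrier M. \<exists>t::nat. \<forall>a \<in> I [^]\<^bsub>ideals_set R\<^esub> t. a \<odot>\<^bsub>M\<^esub> x = \<zero>\<^bsub>M\<^esub>}"

lemma torsion_submodule_eq: "torsion_submodule R I M = M\<lparr>carrier := torsion_set R I M\<rparr>"
  by (simp add: torsion_submodule_def torsion_set_def)

lemma ideal_powers:
  fixes R (structure)
  assumes R: "cring R" and I: "ideal I R"
  shows "ideal (I [^]\<^bsub>ideals_set R\<^esub> (t::nat)) R" "s \<le> t \<Longrightarrow> I [^]\<^bsub>ideals_set R\<^esub> t \<subseteq> I [^]\<^bsub>ideals_set R\<^esub> s"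
proof -
  interpret cring R by fact
  have Suc: "I [^]\<^bsub>ideals_set R\<^esub> Suc t = (I [^]\<^bsub>ideals_set R\<^esub> t) \<cdot>\<^bsub>R\<^esub> I" for t :: nat
    by (simp add: ideals_set_def)
  have 0: "I [^]\<^bsub>ideals_set R\<^esub> (0::nat) = carrier R" by (simp add: ideals_set_def)
  show id: "ideal (I [^]\<^bsub>ideals_set R\<^esub> t) R" for t :: nat
    by (induction t) (simp_all only: Suc 0 oneideal ideal_prod_is_ideal I)
  have "I [^]\<^bsub>ideals_set R\<^esub> Suc t \<subseteq> I [^]\<^bsub>ideals_set R\<^esub> t" for t :: nat
    unfolding Suc using ideal_prod_inter[OF id I] by blast
  then show "s \<le> t \<Longrightarrow> I [^]\<^bsub>ideals_set R\<^esub> t \<subseteq> I [^]\<^bsub>ideals_set R\<^esub> s"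
    by (rule lift_Suc_antimono_le)
qed

text \<open>
  The powers of \<open>I\<close> decrease, so the larger of two exponents serves both elements.
\<close>

lemma torsion_set_pair:
  assumes R: "cring R" and I: "ideal I R" and x: "x \<in> torsion_set R I M" and y: "y \<in> torsion_set R I N"
  shows "\<exists>t::nat. \<forall>a \<in> I [^]\<^bsub>ideals_set R\<^esub> t. a \<odot>\<^bsub>M\<^esub> x = \<zero>\<^bsub>M\<^esub> \<and> a \<odot>\<^bsub>N\<^esub> y = \<zero>\<^bsub>N\<^esub>"
proof -
  obtain s t :: nat where "\<forall>a \<in> I [^]\<^bsub>ideals_set R\<^esub> s. a \<odot>\<^bsub>M\<^esub> x = \<zero>\<^bsub>M\<^esub>" "\<forall>a \<in> I [^]\<^bsub>ideals_set R\<^esub> t. a \<odot>\<^bsub>N\<^esub> y = \<zero>\<^bsub>N\<^esub>"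
    using x y by (auto simp: torsion_set_def)
  then show ?thesis
    using ideal_powers(2)[OF R I, of s "max s t"] ideal_powers(2)[OF R I, of t "max s t"]
    by (intro exI[of _ "max s t"]) auto
qed

lemma torsion_set_submodule:
  assumes M: "module R M" and I: "ideal I R"
  shows "submodule (torsion_set R I M) R M"
proof -
  interpret module R M by fact
  show ?thesis
  proof (rule submodule_intro[OF M])
    show "torsion_set R I M \<subseteq> carrier M" by (auto simp: torsion_set_def)
    show "\<zero>\<^bsub>M\<^esub> \<in> torsion_set R I M"
      using ideal.Icarr[OF ideal_powers(1)[OF cring_axioms I]] by (auto simp: torsion_set_def)
    fix x assume x: "x \<in> torsion_set R I M"
    then have xM: "x \<in> carrier M" by (simp add: torsion_set_def)
    { fix y assume y: "y \<in> torsion_set R I M"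
      then have yM: "y \<in> carrier M" by (simp add: torsion_set_def)
      obtain t :: nat where t: "\<And>a. a \<in> I [^]\<^bsub>ideals_set R\<^esub> t \<Longrightarrow> a \<odot>\<^bsub>M\<^esub> x = \<zero>\<^bsub>M\<^esub>"
        "\<And>a. a \<in> I [^]\<^bsub>ideals_set R\<^esub> t \<Longrightarrow> a \<odot>\<^bsub>M\<^esub> y = \<zero>\<^bsub>M\<^esub>"
        using torsion_set_pair[OF cring_axioms I x y] by blast
      have "a \<odot>\<^bsub>M\<^esub> (x \<oplus>\<^bsub>M\<^esub> y) = \<zero>\<^bsub>M\<^esub>" if "a \<in> I [^]\<^bsub>ideals_set R\<^esub> t" for a
        using t[OF that] xM yM ideal.Icarr[OF ideal_powers(1)[OF cring_axioms I] that] by (simp add: smult_r_distr)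
      then show "x \<oplus>\<^bsub>M\<^esub> y \<in> torsion_set R I M" using xM yM by (auto simp: torsion_set_def) }
    { fix b assume b: "b \<in> carrier R"
      obtain t :: nat where t: "\<And>a. a \<in> I [^]\<^bsub>ideals_set R\<^esub> t \<Longrightarrow> a \<odot>\<^bsub>M\<^esub> x = \<zero>\<^bsub>M\<^esub>"
        using x by (auto simp: torsion_set_def)
      have "a \<odot>\<^bsub>M\<^esub> (b \<odot>\<^bsub>M\<^esub> x) = \<zero>\<^bsub>M\<^esub>" if "a \<in> I [^]\<^bsub>ideals_set R\<^esub> t" for a
      proof -
        have "a \<in> carrier R" by (rule ideal.Icarr[OF ideal_powers(1)[OF cring_axioms I] that])
        then have "a \<odot>\<^bsub>M\<^esub> (b \<odot>\<^bsub>M\<^esub> x) = b \<odot>\<^bsub>M\<^esub> (a \<odot>\<^bsub>M\<^esub> x)" using b xM by (simp add: m_comm[of a b] flip: smult_assoc1)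
        then show ?thesis using t[OF that] b by simp
      qed
      then show "b \<odot>\<^bsub>M\<^esub> x \<in> torsion_set R I M" using xM b by (auto simp: torsion_set_def) }
  qed
qed

lemma torsion_set_map:
  assumes M: "module R M" and N: "module R N" and f: "linear_map R M N f" and I: "ideal I R" and x: "x \<in> torsion_set R I M"
  shows "f x \<in> torsion_set R I N"
proof -
  have xM: "x \<in> carrier M" using x by (simp add: torsion_set_def)
  obtain t :: nat where t: "\<And>a. a \<in> I [^]\<^bsub>ideals_set R\<^esub> t \<Longrightarrow> a \<odot>\<^bsub>M\<^esub> x = \<zero>\<^bsub>M\<^esub>"
    using x by (auto simp: torsion_set_def)
  have "a \<odot>\<^bsub>N\<^esub> f x = \<zero>\<^bsub>N\<^esub>" if "a \<in> I [^]\<^bsub>ideals_set R\<^esub> t" for a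
    using t[OF that] lm_smult[OF f ideal.Icarr[OF ideal_powers(1)[OF module_cring[OF M] I] that] xM] lm_zero[OF M N f] by simp
  then show ?thesis using lm_closed[OF f xM] by (auto simp: torsion_set_def)
qed

definition torsion_complex :: "('a, 'r) ring_scheme \<Rightarrow> 'a set \<Rightarrow> ('a, 'm) cochain \<Rightarrow> ('a, 'm) cochain" where
  "torsion_complex R I C = subcomplex C (\<lambda>k. torsion_set R I (term_of C k))"

lemma torsion_complex_simps [simp]:
  "term_of (torsion_complex R I C) k = (term_of C k)\<lparr>carrier := torsion_set R I (term_of C k)\<rparr>"
  "diff_of (torsion_complex R I C) = diff_of C"
  by (simp_all add: torsion_complex_def)

lemma torsion_complex_complex:
  assumes C: "cochain_complex R C" and I: "ideal I R"
  shows "cochain_complex R (torsion_complex R I C)"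
  unfolding torsion_complex_def
  by (rule subcomplex_complex[OF C torsion_set_submodule[OF cx_module[OF C] I]])
    (rule torsion_set_map[OF cx_module[OF C] cx_module[OF C] cx_lin[OF C] I])

text \<open>
  An exact complex of injectives that is bounded below is contractible. The contraction \<open>s\<close> is built upwards:
  \<open>u - d (s u)\<close> vanishes on cocycles, so it factors through the next differential, and the
  factor extends by injectivity. The statement records how \<open>s\<close> acts on cocycles; this suffices to
  construct the next map and to write each cocycle as a coboundary.
\<close>

lemma exact_injective_section:
  fixes C :: "('a, 'm) cochain"
  assumes C: "cochain_complex R C" and inj: "\<And>k. injective_module R (term_of C k)"
    and bounded: "\<And>k. k < b \<Longrightarrow> carrier (term_of C k) = {\<zero>\<^bsub>term_of C k\<^esub>}" and ex: "exact_complex C"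
  shows "\<exists>s. linear_map R (term_of C k) (term_of C (k - 1)) s \<and> (\<forall>z\<in>cocycles C k. diff_of C (k - 1) (s z) = z)"
proof -
  note mC = cx_module[OF C]
  have step: "\<exists>s. linear_map R (term_of C k) (term_of C (k - 1)) s \<and> (\<forall>z\<in>cocycles C k. diff_of C (k - 1) (s z) = z)"
    if "k < b + int m" for m k
    using that
  proof (induction m arbitrary: k)
    case 0
    then have "z = \<zero>\<^bsub>term_of C k\<^esub>" if "z \<in> cocycles C k" for z using bounded[of k] cocyclesD(1)[OF that] by simp
    then show ?case
      using lm_const_zero[OF mC] lm_zero[OF mC mC cx_lin'[OF C]]
      by (intro exI[of _ "\<lambda>_. \<zero>\<^bsub>term_of C (k - 1)\<^esub>"]) auto
  next
    case (Suc m)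
    define l where "l = k - 1"
    have kl: "k = l + 1" by (simp add: l_def)
    have "l < b + int m" using Suc.prems by (simp add: l_def)
    then obtain s where s: "linear_map R (term_of C l) (term_of C (l - 1)) s"
      "\<And>z. z \<in> cocycles C l \<Longrightarrow> diff_of C (l - 1) (s z) = z" using Suc.IH[of l] by auto
    interpret L: module R "term_of C l" by (rule mC)
    interpret L1: module R "term_of C (l + 1)" by (rule mC)
    have h: "linear_map R (term_of C l) (term_of C l) (\<lambda>u. u \<ominus>\<^bsub>term_of C l\<^esub> diff_of C (l - 1) (s u))"
      by (rule lm_diff[OF mC mC lm_id lm_comp[OF s(1) cx_lin'[OF C]]])
    obtain s' where s': "linear_map R (term_of C (l + 1)) (term_of C l) s'"
      "\<And>u. u \<in> carrier (term_of C l) \<Longrightarrow> s' (diff_of C l u) = u \<ominus>\<^bsub>term_of C l\<^esub> diff_of C (l - 1) (s u)"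
    proof (rule injective_extend[OF inj mC mC cx_lin[OF C] h])
      fix u assume u: "u \<in> carrier (term_of C l)" "diff_of C l u = \<zero>\<^bsub>term_of C (l + 1)\<^esub>"
      then have "diff_of C (l - 1) (s u) = u" by (intro s(2) cocyclesI)
      then show "u \<ominus>\<^bsub>term_of C l\<^esub> diff_of C (l - 1) (s u) = \<zero>\<^bsub>term_of C l\<^esub>" using u(1) by simp
    qed blast
    have "diff_of C l (s' z) = z" if zZ: "z \<in> cocycles C (l + 1)" for z
    proof -
      have "z \<in> cobounds C (l + 1)" using ex zZ by (auto simp: exact_complex_def)
      then obtain u where u: "u \<in> carrier (term_of C l)" "z = diff_of C l u" by (auto simp: cobounds_iff)
      have su: "s u \<in> carrier (term_of C (l - 1))" by (rule lm_closed[OF s(1) u(1)])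
      show ?thesis
        using u lm_closed[OF cx_lin'[OF C] su] lm_closed[OF cx_lin[OF C] u(1)]
        by (simp add: s'(2) lm_minus[OF mC mC cx_lin[OF C]] cx_dd'[OF C su])
    qed
    then show ?case using s'(1) unfolding kl by auto
  qed
  have "k < b + int (nat (k - b + 1))" by linarith
  then show ?thesis by (rule step)
qed

text \<open>
  A linear map preserves torsion, so the contraction restricts to the torsion complex.
\<close>

lemma torsion_exact:
  fixes C :: "('a, 'm) cochain"
  assumes C: "cochain_complex R C" and inj: "\<And>k. injective_module R (term_of C k)"
    and bounded: "\<And>k. k < b \<Longrightarrow> carrier (term_of C k) = {\<zero>\<^bsub>term_of C k\<^esub>}" and ex: "exact_complex C"
    and I: "ideal I R"
  shows "exact_complex (torsion_complex R I C)"
  unfolding exact_complex_def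
proof (intro allI subsetI)
  fix k z assume z: "z \<in> cocycles (torsion_complex R I C) k"
  then have zT: "z \<in> torsion_set R I (term_of C k)" and "z \<in> cocycles C k"
    by (auto simp: cocycles_def torsion_set_def)
  moreover obtain s where s: "linear_map R (term_of C k) (term_of C (k - 1)) s"
    "\<forall>z\<in>cocycles C k. diff_of C (k - 1) (s z) = z"
    using exact_injective_section[OF C inj bounded ex] by blast
  moreover have "s z \<in> torsion_set R I (term_of C (k - 1))"
    by (rule torsion_set_map[OF cx_module[OF C] cx_module[OF C] s(1) I zT])
  ultimately show "z \<in> cobounds (torsion_complex R I C) k"
    unfolding cobounds_iff by (intro bexI[of _ "s z"]) simp_all
qed

context pairing
begin

lemma pair_module_injective:
  assumes M: "injective_module R M" and N: "injective_module R N"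
  shows "injective_module R (pair_module M N)"
  unfolding injective_module_def
proof (intro conjI allI impI)
  have mM: "module R M" and mN: "module R N" using M N by (simp_all add: injective_module_def)
  show "module R (pair_module M N)" by (rule pair_module_module[OF mM mN])
  fix A B :: "('a, 'm) module" and u f
  assume A: "module R A" and B: "module R B" and u: "linear_map R A B u" "inj_on u (carrier A)"
    and f: "linear_map R A (pair_module M N) f"
  have f1: "linear_map R A M (\<lambda>x. p1 (f x))" and f2: "linear_map R A N (\<lambda>x. p2 (f x))"
    using lm_closed[OF f] lm_add[OF f] lm_smult[OF f] by (auto intro!: linear_mapI)
  obtain g where g: "linear_map R B M g" "\<forall>x\<in>carrier A. g (u x) = p1 (f x)"
    using M[unfolded injective_module_def, THEN conjunct2, rule_format, OF A B u f1] by blast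
  obtain h where h: "linear_map R B N h" "\<forall>x\<in>carrier A. h (u x) = p2 (f x)"
    using N[unfolded injective_module_def, THEN conjunct2, rule_format, OF A B u f2] by blast
  have "linear_map R B (pair_module M N) (\<lambda>x. pr (g x) (h x))"
    using lm_closed[OF g(1)] lm_closed[OF h(1)]
    by (auto intro!: linear_mapI simp: lm_add[OF g(1)] lm_add[OF h(1)] lm_smult[OF g(1)] lm_smult[OF h(1)])
  then show "\<exists>g. linear_map R B (pair_module M N) g \<and> (\<forall>x\<in>carrier A. g (u x) = f x)"
    using g(2) h(2) by (intro exI[of _ "\<lambda>x. pr (g x) (h x)"]) simp
qed

lemma koszul_injective:
  "(\<And>k. injective_module R (term_of C k)) \<Longrightarrow> injective_module R (term_of (koszul R xs C) k)"
  by (induction xs arbitrary: k) (auto intro: pair_module_injective)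

lemma pair_module_zero:
  assumes "carrier M = {\<zero>\<^bsub>M\<^esub>}" "carrier N = {\<zero>\<^bsub>N\<^esub>}"
  shows "carrier (pair_module M N) = {\<zero>\<^bsub>pair_module M N\<^esub>}"
proof (intro equalityI subsetI)
  fix w assume "w \<in> carrier (pair_module M N)"
  then show "w \<in> {\<zero>\<^bsub>pair_module M N\<^esub>}" using assms pr_p[of w] by simp
qed (use assms in simp)

lemma koszul_bounded:
  assumes "\<And>k. k < b \<Longrightarrow> carrier (term_of C k) = {\<zero>\<^bsub>term_of C k\<^esub>}" "k < b"
  shows "carrier (term_of (koszul R xs C) k) = {\<zero>\<^bsub>term_of (koszul R xs C) k\<^esub>}"
  using assms(2)
proof (induction xs arbitrary: k)
  case (Cons x xs)
  then have "k - 1 < b" by simp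
  with Cons show ?case unfolding koszul.simps cone_term by (intro pair_module_zero) auto
qed (use assms(1) in simp)

lemma torsion_set_pair_module:
  assumes R: "cring R" and I: "ideal I R"
  shows "w \<in> torsion_set R I (pair_module M N) \<longleftrightarrow> p1 w \<in> torsion_set R I M \<and> p2 w \<in> torsion_set R I N"
proof
  assume "p1 w \<in> torsion_set R I M \<and> p2 w \<in> torsion_set R I N"
  then have w: "p1 w \<in> torsion_set R I M" "p2 w \<in> torsion_set R I N" by simp_all
  obtain t :: nat where t: "\<forall>a \<in> I [^]\<^bsub>ideals_set R\<^esub> t. a \<odot>\<^bsub>M\<^esub> p1 w = \<zero>\<^bsub>M\<^esub> \<and> a \<odot>\<^bsub>N\<^esub> p2 w = \<zero>\<^bsub>N\<^esub>"
    using torsion_set_pair[OF R I w] by blast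
  show "w \<in> torsion_set R I (pair_module M N)"
    unfolding torsion_set_def
  proof (intro CollectI conjI exI ballI)
    show "w \<in> carrier (pair_module M N)" using w by (simp add: torsion_set_def)
    show "a \<odot>\<^bsub>pair_module M N\<^esub> w = \<zero>\<^bsub>pair_module M N\<^esub>" if "a \<in> I [^]\<^bsub>ideals_set R\<^esub> t" for a
      using t that by simp
  qed
next
  assume "w \<in> torsion_set R I (pair_module M N)"
  then obtain t :: nat where "p1 w \<in> carrier M" "p2 w \<in> carrier N"
    "\<forall>a \<in> I [^]\<^bsub>ideals_set R\<^esub> t. a \<odot>\<^bsub>M\<^esub> p1 w = \<zero>\<^bsub>M\<^esub> \<and> a \<odot>\<^bsub>N\<^esub> p2 w = \<zero>\<^bsub>N\<^esub>"
    unfolding torsion_set_def by auto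
  then show "p1 w \<in> torsion_set R I M \<and> p2 w \<in> torsion_set R I N"
    unfolding torsion_set_def by blast
qed

text \<open>
  An element of a cone is torsion if and only if both components are. The equality is literal because the
  differential of a cone does not refer to the carriers.
\<close>

lemma koszul_torsion:
  assumes R: "cring R" and I: "ideal I R"
  shows "koszul R xs (torsion_complex R I C) = torsion_complex R I (koszul R xs C)"
proof (induction xs)
  case (Cons x xs)
  have "cone R x (torsion_complex R I D) = torsion_complex R I (cone R x D)" for D
  proof (rule prod_eqI)
    have "term_of (cone R x (torsion_complex R I D)) k = term_of (torsion_complex R I (cone R x D)) k" for k
      by (simp add: pair_module_def torsion_set_pair_module[OF R I, unfolded pair_module_def] set_eq_iff)
    then show "term_of (cone R x (torsion_complex R I D)) = term_of (torsion_complex R I (cone R x D))" by blast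
    show "diff_of (cone R x (torsion_complex R I D)) = diff_of (torsion_complex R I (cone R x D))"
      by (simp add: cone_def fibre_def scale_map_def)
  qed
  then show ?case using Cons by simp
qed simp

text \<open>Torsion preserves quasi-isomorphisms between bounded below complexes of injectives: the fibre is exact.\<close>

lemma torsion_quasi_iso:
  fixes C D :: "('a, 'm) cochain"
  assumes C: "cochain_complex R C" and D: "cochain_complex R D" and f: "quasi_iso R C D f"
    and injC: "\<And>k. injective_module R (term_of C k)" and injD: "\<And>k. injective_module R (term_of D k)"
    and bC: "\<And>k. k < b \<Longrightarrow> carrier (term_of C k) = {\<zero>\<^bsub>term_of C k\<^esub>}"
    and bD: "\<And>k. k < b \<Longrightarrow> carrier (term_of D k) = {\<zero>\<^bsub>term_of D k\<^esub>}"
    and I: "ideal I R"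
  shows "quasi_iso R (torsion_complex R I C) (torsion_complex R I D) f"
proof -
  let ?F = "fibre R C D f"
  note fm = qi_map[OF f]
  have R: "cring R" by (rule module_cring[OF cx_module[OF C]])
  have F: "cochain_complex R ?F" by (rule fibre_complex[OF C D fm])
  have ex: "exact_complex (torsion_complex R I ?F)"
  proof (rule torsion_exact[OF F _ _ fibre_exact[OF C D f] I])
    show "injective_module R (term_of ?F k)" for k by (simp add: pair_module_injective injC injD)
    show "carrier (term_of ?F k) = {\<zero>\<^bsub>term_of ?F k\<^esub>}" if "k < b" for k
      unfolding fibre_term using that by (intro pair_module_zero bC bD) auto
  qed
  have lift: "\<exists>v. p1 v \<in> torsion_set R I (term_of C (k - 1)) \<and> p2 v \<in> torsion_set R I (term_of D (k - 2)) \<and>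
      diff_of ?F (k - 1) v = w"
    if "w \<in> cocycles ?F k" "w \<in> torsion_set R I (term_of ?F k)" for w k
  proof -
    have "w \<in> cocycles (torsion_complex R I ?F) k" using that by (simp add: cocycles_def)
    then have "w \<in> cobounds (torsion_complex R I ?F) k" using ex by (auto simp: exact_complex_def)
    then obtain v where "v \<in> torsion_set R I (term_of ?F (k - 1))" "w = diff_of ?F (k - 1) v"
      by (auto simp: cobounds_iff)
    then show ?thesis using torsion_set_pair_module[OF R I, of v "term_of C (k - 1)" "term_of D (k - 1 - 1)"]
      by (intro exI[of _ v]) simp
  qed
  have tsub: "x \<in> carrier M" if "x \<in> torsion_set R I M" for x and M :: "('a, 'm) module"
    using that by (simp add: torsion_set_def)
  have fd: "diff_of ?F k v = pr (diff_of C k (p1 v)) (f k (p1 v) \<ominus>\<^bsub>term_of D k\<^esub> diff_of D (k - 1) (p2 v))"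
    if "p1 v \<in> torsion_set R I (term_of C k)" "p2 v \<in> torsion_set R I (term_of D (k - 1))" for k v
    by (rule fibre_d[OF C D fm tsub[OF that(1)] tsub[OF that(2)]])
  have "chain_map R (torsion_complex R I C) (torsion_complex R I D) f"
    unfolding chain_map_def
  proof (intro conjI allI ballI)
    fix k
    show "linear_map R (term_of (torsion_complex R I C) k) (term_of (torsion_complex R I D) k) (f k)"
      unfolding torsion_complex_simps
      using torsion_set_map[OF cx_module[OF C] cx_module[OF D] cm_lin[OF fm] I]
      by (intro lm_restrict2[OF cm_lin[OF fm]]) (auto dest: tsub)
    show "f (k + 1) (diff_of (torsion_complex R I C) k x) = diff_of (torsion_complex R I D) k (f k x)"
      if "x \<in> carrier (term_of (torsion_complex R I C) k)" for x
      using cm_comm[OF fm tsub] that by simp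
  qed
  moreover have "a \<in> cobounds (torsion_complex R I C) k"
    if a: "a \<in> cocycles (torsion_complex R I C) k" and fa: "f k a \<in> cobounds (torsion_complex R I D) k" for k a
  proof -
    obtain y where y: "y \<in> torsion_set R I (term_of D (k - 1))" "f k a = diff_of D (k - 1) y"
      using fa by (auto simp: cobounds_iff)
    have aT: "a \<in> torsion_set R I (term_of C k)" "a \<in> cocycles C k" using a tsub by (auto simp: cocycles_def)
    have "pr a y \<in> cocycles ?F k" using aT y tsub by (simp add: fibre_cocycle_iff[OF C D fm])
    moreover have "pr a y \<in> torsion_set R I (term_of ?F k)"
      using aT y torsion_set_pair_module[OF R I, of "pr a y"] by simp
    ultimately obtain v where v: "p1 v \<in> torsion_set R I (term_of C (k - 1))"
      "p2 v \<in> torsion_set R I (term_of D (k - 2))" "diff_of ?F (k - 1) v = pr a y" using lift by blast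
    then have "a = diff_of C (k - 1) (p1 v)" using fd[of v "k - 1"] by simp
    then show ?thesis using v(1) by (auto simp: cobounds_iff)
  qed
  moreover have "\<exists>a\<in>cocycles (torsion_complex R I C) k. \<exists>e\<in>carrier (term_of (torsion_complex R I D) (k - 1)).
      b = f k a \<oplus>\<^bsub>term_of (torsion_complex R I D) k\<^esub> diff_of (torsion_complex R I D) (k - 1) e"
    if b: "b \<in> cocycles (torsion_complex R I D) k" for k b
  proof -
    interpret Dk: module R "term_of D k" by (rule cx_module[OF D])
    interpret Dk1: module R "term_of D (k - 1)" by (rule cx_module[OF D])
    have bT: "b \<in> torsion_set R I (term_of D k)" and db: "diff_of D k b = \<zero>\<^bsub>term_of D (k + 1)\<^esub>"
      using b by (auto simp: cocycles_def)
    let ?z = "\<zero>\<^bsub>term_of C (k + 1)\<^esub>"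
    have zT: "?z \<in> torsion_set R I (term_of C (k + 1))"
      by (rule submodule_zero[OF torsion_set_submodule[OF cx_module[OF C] I]])
    have "pr ?z b \<in> cocycles ?F (k + 1)"
      using tsub[OF bT] db lm_zero[OF cx_module[OF C] cx_module[OF D] cm_lin[OF fm]]
        submodule_zero[OF cocycles_submodule[OF C]]
      by (simp add: fibre_cocycle_iff[OF C D fm])
    moreover have "pr ?z b \<in> torsion_set R I (term_of ?F (k + 1))"
      using zT bT torsion_set_pair_module[OF R I, of "pr ?z b"] by simp
    ultimately obtain v where v: "p1 v \<in> torsion_set R I (term_of C k)"
      "p2 v \<in> torsion_set R I (term_of D (k - 1))" "diff_of ?F k v = pr ?z b" using lift[of "pr ?z b" "k + 1"] by auto
    have eq: "diff_of C k (p1 v) = ?z" "b = f k (p1 v) \<ominus>\<^bsub>term_of D k\<^esub> diff_of D (k - 1) (p2 v)"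
      using fd[OF v(1,2)] v(3) by simp_all
    have "p1 v \<in> cocycles (torsion_complex R I C) k" using v(1) eq(1) by (simp add: cocycles_def)
    moreover have "\<ominus>\<^bsub>term_of D (k - 1)\<^esub> p2 v \<in> torsion_set R I (term_of D (k - 1))"
      by (rule submodule_neg[OF torsion_set_submodule[OF cx_module[OF D] I] v(2)])
    moreover have "b = f k (p1 v) \<oplus>\<^bsub>term_of D k\<^esub> diff_of D (k - 1) (\<ominus>\<^bsub>term_of D (k - 1)\<^esub> p2 v)"
      using eq(2) tsub[OF v(2)] by (simp add: lm_neg[OF cx_module[OF D] cx_module[OF D] cx_lin'[OF D]] a_minus_def)
    ultimately show ?thesis by auto
  qed
  ultimately show ?thesis unfolding quasi_iso_def by blast
qed

end

section \<open>Cohomology modules\<close>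

text \<open>
  The link between \<open>belongs_to\<close> for the modules of cosets in the definitions of \<open>Ext\<close> and local cohomology and
  subquotients in the sense used here.
\<close>

lemma belongs_to_quotient:
  assumes S: "S \<subseteq> {M. module R M}" and M: "module R M" and N: "submodule N R M"
  shows "belongs_to R (quotient_module M N) S \<longleftrightarrow> subquotient_in R S M (carrier M) N"
proof
  let ?Q = "quotient_module M N" and ?q = "\<lambda>x. N +>\<^bsub>M\<^esub> x"
  have Q: "module R ?Q" by (rule quotient_module_module[OF M N])
  note q = quotient_projection[OF M N]
  interpret Q: module R ?Q by (rule Q)
  { assume "belongs_to R ?Q S"
    then obtain P f where P: "P \<in> S" and f: "linear_map R ?Q P f" "bij_betw f (carrier ?Q) (carrier P)"
      by (auto simp: belongs_to_def module_isomorphic_def)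
    have mP: "module R P" using S P by auto
    show "subquotient_in R S M (carrier M) N"
    proof (rule subquotient_inI[OF P])
      show "linear_map R (M\<lparr>carrier := carrier M\<rparr>) P (\<lambda>x. f (?q x))"
        using lm_comp[OF q(1) f(1)] by simp
      show "(\<lambda>x. f (?q x)) ` carrier M = carrier P"
        using f(2) by (auto simp: bij_betw_def quotient_module_carrier)
      fix z assume z: "z \<in> carrier M"
      have "f (?q z) = \<zero>\<^bsub>P\<^esub> \<longleftrightarrow> f (?q z) = f \<zero>\<^bsub>?Q\<^esub>" using lm_zero[OF Q mP f(1)] by simp
      also have "\<dots> \<longleftrightarrow> ?q z = \<zero>\<^bsub>?Q\<^esub>"
        using f(2) lm_closed[OF q(1) z] by (auto simp: bij_betw_def inj_on_eq_iff)
      finally show "f (?q z) = \<zero>\<^bsub>P\<^esub> \<longleftrightarrow> z \<in> N" using q(2)[OF z] by simp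
    qed }
  { assume "subquotient_in R S M (carrier M) N"
    then obtain P p where P: "P \<in> S" and p: "linear_map R (M\<lparr>carrier := carrier M\<rparr>) P p" "p ` carrier M = carrier P"
      "\<And>z. z \<in> carrier M \<Longrightarrow> p z = \<zero>\<^bsub>P\<^esub> \<longleftrightarrow> z \<in> N" by (rule subquotient_inE) blast
    have mP: "module R P" using S P by auto
    obtain f where f: "linear_map R ?Q P f" "\<And>z. z \<in> carrier M \<Longrightarrow> f (?q z) = p z"
    proof (rule linear_factor[OF M Q mP q(1), of p])
      show "linear_map R M P p" using p(1) by simp
      show "?q ` carrier M = carrier ?Q" by (simp add: quotient_module_carrier)
      show "p z = \<zero>\<^bsub>P\<^esub>" if "z \<in> carrier M" "?q z = \<zero>\<^bsub>?Q\<^esub>" for z using that p(3) q(2) by simp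
    qed blast
    have "inj_on f (carrier ?Q)"
    proof (rule lm_inj[OF Q mP f(1)])
      fix C assume C: "C \<in> carrier ?Q" "f C = \<zero>\<^bsub>P\<^esub>"
      then obtain x where x: "x \<in> carrier M" "C = ?q x" by (auto simp: quotient_module_carrier)
      then have "p x = \<zero>\<^bsub>P\<^esub>" using C(2) f(2) by simp
      then show "C = \<zero>\<^bsub>?Q\<^esub>" using p(3) q(2) x by simp
    qed
    moreover have "f ` carrier ?Q = carrier P"
      using f(2) p(2) by (simp add: quotient_module_carrier image_image)
    ultimately show "belongs_to R ?Q S"
      using P f(1) by (auto simp: belongs_to_def module_isomorphic_def bij_betw_def) }
qed

lemma subquotient_in_restrict:
  "subquotient_in R S (M\<lparr>carrier := Z\<rparr>) Z B \<longleftrightarrow> subquotient_in R S M Z B"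
  by (simp add: subquotient_in_def)

text \<open>Comparison of the two indexings of a complex that starts in degree \<open>n\<close>.\<close>

locale starts_at =
  fixes R :: "('a, 'r) ring_scheme" and D :: "('a, 'm) cochain" and n :: int
    and C :: "nat \<Rightarrow> ('a, 'm) module" and d :: "nat \<Rightarrow> 'm \<Rightarrow> 'm"
  assumes D: "cochain_complex R D"
    and terms: "\<And>i. term_of D (n + int i) = C i" and diffs: "\<And>i u. diff_of D (n + int i) u = d i u"
    and start: "carrier (term_of D (n - 1)) = {\<zero>\<^bsub>term_of D (n - 1)\<^esub>}"
begin

lemma kernel_eq: "a_kernel (C i) (C (Suc i)) (d i) = cocycles D (n + int i)"
proof -
  have "n + int i + 1 = n + int (Suc i)" by simp
  then have "term_of D (n + int i + 1) = C (Suc i)" using terms[of "Suc i"] by metis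
  then show ?thesis by (auto simp: a_kernel_eq cocycles_def terms diffs)
qed

lemma coboundaries_eq: "coboundaries C d i = cobounds D (n + int i)"
proof (cases i)
  case 0
  have "diff_of D (n - 1) \<zero>\<^bsub>term_of D (n - 1)\<^esub> = \<zero>\<^bsub>term_of D n\<^esub>"
    by (rule lm_zero[OF cx_module[OF D] cx_module[OF D] cx_lin'[OF D]])
  moreover have "term_of D n = C 0" using terms[of 0] by simp
  ultimately show ?thesis using 0 start by (simp add: coboundaries_def cobounds_def)
next
  case (Suc j)
  then have "n + int i - 1 = n + int j" by simp
  then show ?thesis using Suc by (auto simp: coboundaries_def cobounds_def terms diffs)
qed

lemma cohomology_eq: "cohomology C d i =
    quotient_module ((term_of D (n + int i))\<lparr>carrier := cocycles D (n + int i)\<rparr>) (cobounds D (n + int i))"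
  unfolding cohomology_def kernel_eq coboundaries_eq terms ..

lemma cobounds_sub: "submodule (cobounds D k) R ((term_of D k)\<lparr>carrier := cocycles D k\<rparr>)"
  by (rule submodule_of_submodule[OF cx_module[OF D] cocycles_submodule[OF D] cobounds_submodule[OF D]
        cobounds_cocycles[OF D]])

lemma cocycles_module: "module R ((term_of D k)\<lparr>carrier := cocycles D k\<rparr>)"
  by (rule submodule_module[OF cx_module[OF D] cocycles_submodule[OF D]])

lemma belongs_to_cohomology:
  assumes "S \<subseteq> {M. module R M}"
  shows "belongs_to R (cohomology C d i) S \<longleftrightarrow>
    subquotient_in R S (term_of D (n + int i)) (cocycles D (n + int i)) (cobounds D (n + int i))"
  unfolding cohomology_eq belongs_to_quotient[OF assms cocycles_module cobounds_sub]
  by (simp add: subquotient_in_restrict)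

lemma cohomology_in_universe:
  obtains H :: "('a, 'm) module" and h p where "module R (cohomology C d i)" "module R H"
    "linear_map R (cohomology C d i) H h" "bij_betw h (carrier (cohomology C d i)) (carrier H)"
    "linear_map R ((term_of D (n + int i))\<lparr>carrier := cocycles D (n + int i)\<rparr>) H p"
    "p ` cocycles D (n + int i) = carrier H"
    "\<And>z. z \<in> cocycles D (n + int i) \<Longrightarrow> p z = \<zero>\<^bsub>H\<^esub> \<longleftrightarrow> z \<in> cobounds D (n + int i)"
proof -
  let ?k = "n + int i"
  let ?Z = "(term_of D ?k)\<lparr>carrier := cocycles D ?k\<rparr>" and ?B = "cobounds D ?k"
  let ?Q = "quotient_module ?Z ?B"
  have Q: "module R ?Q" by (rule quotient_module_module[OF cocycles_module cobounds_sub])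
  have "carrier ?Q \<lesssim> (UNIV :: 'm set)"
    unfolding quotient_module_carrier by (rule lepoll_trans[OF image_lepoll subset_imp_lepoll]) simp
  then obtain H :: "('a, 'm) module" and h where H: "module R H" "linear_map R ?Q H h" "bij_betw h (carrier ?Q) (carrier H)"
    using isomorphic_in_universe[OF Q] by blast
  note q = quotient_projection[OF cocycles_module[of ?k] cobounds_sub[of ?k]]
  let ?p = "\<lambda>z. h (?B +>\<^bsub>?Z\<^esub> z)"
  interpret Q: module R ?Q by (rule Q)
  have "?p z = \<zero>\<^bsub>H\<^esub> \<longleftrightarrow> z \<in> ?B" if z: "z \<in> cocycles D ?k" for z
  proof -
    have "?p z = \<zero>\<^bsub>H\<^esub> \<longleftrightarrow> ?p z = h \<zero>\<^bsub>?Q\<^esub>" using lm_zero[OF Q H(1,2)] by simp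
    also have "\<dots> \<longleftrightarrow> ?B +>\<^bsub>?Z\<^esub> z = \<zero>\<^bsub>?Q\<^esub>"
      using H(3) lm_closed[OF q(1), of z] z by (auto simp: bij_betw_def inj_on_eq_iff)
    finally show ?thesis using q(2)[of z] z by simp
  qed
  moreover have "?p ` cocycles D ?k = carrier H"
    using H(3) by (auto simp: bij_betw_def quotient_module_carrier)
  ultimately show ?thesis
    using that[of H h ?p] Q H lm_comp[OF q(1) H(2)] unfolding cohomology_eq by blast
qed

end

section \<open>Ext of a residue ring\<close>

lemma Hom_module_module:
  assumes N: "module R N" and M: "module R M"
  shows "module R (Hom_module R N M)"
proof -
  let ?H = "Hom_module R N M"
  interpret M: module R M by fact
  interpret N: module R N by fact
  have res: "linear_map R N M (\<lambda>x\<in>carrier N. f x)" if "linear_map R N M f" for f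
    by (rule lm_cong[OF that N]) simp
  have cl: "f x \<in> carrier M" if "f \<in> carrier ?H" "x \<in> carrier N" for f x
    using that lm_closed by (force simp: Hom_module_def)
  have lin: "linear_map R N M f" if "f \<in> carrier ?H" for f using that by (simp add: Hom_module_def)
  have eqI: "f = g" if "f \<in> carrier ?H" "g \<in> carrier ?H" "\<And>x. x \<in> carrier N \<Longrightarrow> f x = g x" for f g
    using that by (auto simp: Hom_module_def intro: extensionalityI)
  have add: "f \<oplus>\<^bsub>?H\<^esub> g \<in> carrier ?H" if "f \<in> carrier ?H" "g \<in> carrier ?H" for f g
    using res[OF lm_sum[OF N M lin[OF that(1)] lin[OF that(2)]]] by (simp add: Hom_module_def)
  have sm: "a \<odot>\<^bsub>?H\<^esub> f \<in> carrier ?H" if "a \<in> carrier R" "f \<in> carrier ?H" for a f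
    using res[OF lm_scale[OF N M lin[OF that(2)] that(1)]] by (simp add: Hom_module_def)
  have zero: "\<zero>\<^bsub>?H\<^esub> \<in> carrier ?H" using res[OF lm_const_zero[OF M]] by (simp add: Hom_module_def)
  have ap: "(f \<oplus>\<^bsub>?H\<^esub> g) x = f x \<oplus>\<^bsub>M\<^esub> g x" "(a \<odot>\<^bsub>?H\<^esub> f) x = a \<odot>\<^bsub>M\<^esub> f x" "\<zero>\<^bsub>?H\<^esub> x = \<zero>\<^bsub>M\<^esub>"
    if "x \<in> carrier N" for f g a x using that by (simp_all add: Hom_module_def)
  have "abelian_group ?H"
  proof (rule abelian_groupI)
    fix f g h assume f: "f \<in> carrier ?H" and g: "g \<in> carrier ?H" and h: "h \<in> carrier ?H"
    show "f \<oplus>\<^bsub>?H\<^esub> g \<in> carrier ?H" by (rule add[OF f g])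
    show "f \<oplus>\<^bsub>?H\<^esub> g \<oplus>\<^bsub>?H\<^esub> h = f \<oplus>\<^bsub>?H\<^esub> (g \<oplus>\<^bsub>?H\<^esub> h)"
      by (rule eqI) (simp_all add: add f g h ap cl M.M.a_assoc)
    show "f \<oplus>\<^bsub>?H\<^esub> g = g \<oplus>\<^bsub>?H\<^esub> f"
      by (rule eqI) (simp_all add: add f g ap cl M.M.a_comm)
  next
    fix f assume f: "f \<in> carrier ?H"
    show "\<zero>\<^bsub>?H\<^esub> \<oplus>\<^bsub>?H\<^esub> f = f" by (rule eqI) (simp_all add: add f ap cl zero)
    show "\<exists>g\<in>carrier ?H. g \<oplus>\<^bsub>?H\<^esub> f = \<zero>\<^bsub>?H\<^esub>"
    proof (rule bexI[of _ "(\<ominus>\<^bsub>R\<^esub> \<one>\<^bsub>R\<^esub>) \<odot>\<^bsub>?H\<^esub> f"])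
      show g: "(\<ominus>\<^bsub>R\<^esub> \<one>\<^bsub>R\<^esub>) \<odot>\<^bsub>?H\<^esub> f \<in> carrier ?H" by (rule sm[OF _ f]) simp
      show "(\<ominus>\<^bsub>R\<^esub> \<one>\<^bsub>R\<^esub>) \<odot>\<^bsub>?H\<^esub> f \<oplus>\<^bsub>?H\<^esub> f = \<zero>\<^bsub>?H\<^esub>"
        by (rule eqI) (simp_all add: add sm f g ap cl zero M.smult_l_minus M.M.l_neg)
    qed
  qed (rule zero)
  then show ?thesis
  proof (rule moduleI[OF M.cring_axioms _ sm])
    fix a b f assume a: "a \<in> carrier R" and b: "b \<in> carrier R" and f: "f \<in> carrier ?H"
    show "(a \<oplus>\<^bsub>R\<^esub> b) \<odot>\<^bsub>?H\<^esub> f = a \<odot>\<^bsub>?H\<^esub> f \<oplus>\<^bsub>?H\<^esub> b \<odot>\<^bsub>?H\<^esub> f"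
      by (rule eqI) (simp_all add: a b f sm add ap cl M.smult_l_distr)
    show "(a \<otimes>\<^bsub>R\<^esub> b) \<odot>\<^bsub>?H\<^esub> f = a \<odot>\<^bsub>?H\<^esub> (b \<odot>\<^bsub>?H\<^esub> f)"
      by (rule eqI) (simp_all add: a b f sm add ap cl M.smult_assoc1)
  next
    fix a f g assume a: "a \<in> carrier R" and f: "f \<in> carrier ?H" and g: "g \<in> carrier ?H"
    show "a \<odot>\<^bsub>?H\<^esub> (f \<oplus>\<^bsub>?H\<^esub> g) = a \<odot>\<^bsub>?H\<^esub> f \<oplus>\<^bsub>?H\<^esub> a \<odot>\<^bsub>?H\<^esub> g"
      by (rule eqI) (simp_all add: a f g sm add ap cl M.smult_r_distr)
  next
    fix f assume f: "f \<in> carrier ?H"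
    show "\<one>\<^bsub>R\<^esub> \<odot>\<^bsub>?H\<^esub> f = f" by (rule eqI) (simp_all add: f sm ap cl)
  qed
qed

lemma Hom_compose_linear:
  assumes N: "module R N" and M: "module R M" and L: "module R L" and d: "linear_map R M L d"
  shows "linear_map R (Hom_module R N M) (Hom_module R N L) (compose (carrier N) d)"
proof -
  interpret N: module R N by fact
  have "linear_map R N L (compose (carrier N) d f)" if "linear_map R N M f" for f
    by (rule lm_cong[OF lm_comp[OF that d] N]) (simp add: compose_def)
  then show ?thesis
    by (intro linear_mapI)
      (auto simp: Hom_module_def compose_def fun_eq_iff restrict_def extensional_def lm_closed lm_add[OF d] lm_smult[OF d])
qed

text \<open>
  The isomorphism of the annihilator of \<open>J\<close> in \<open>M\<close> with \<open>Hom(R/J, M)\<close>, which sends \<open>u\<close> to \<open>r \<mapsto> r u\<close>. The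
  choice of a representative of a coset is harmless if \<open>J\<close> kills \<open>u\<close>.
\<close>

definition hom_of_ann :: "('a, 'r) ring_scheme \<Rightarrow> 'a set \<Rightarrow> ('a, 'b) module \<Rightarrow> 'b \<Rightarrow> 'a set \<Rightarrow> 'b" where
  "hom_of_ann R J M u =
     (\<lambda>C\<in>carrier (residue_module R J). (SOME r. r \<in> carrier R \<and> residue R J r = C) \<odot>\<^bsub>M\<^esub> u)"

lemma hom_of_ann_residue:
  fixes R (structure)
  assumes R: "cring R" and M: "module R M" and xs: "set xs \<subseteq> carrier R" and u: "u \<in> ann_set M xs" and r: "r \<in> carrier R"
  shows "hom_of_ann R (Idl (set xs)) M u (residue R (Idl (set xs)) r) = r \<odot>\<^bsub>M\<^esub> u"
proof -
  interpret cring R by fact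
  interpret M: module R M by fact
  let ?J = "Idl (set xs)"
  have J: "ideal ?J R" by (rule genideal_ideal[OF xs])
  note rJ = residue_facts[OF R J]
  let ?s = "SOME s. s \<in> carrier R \<and> residue R ?J s = residue R ?J r"
  have "?s \<in> carrier R \<and> residue R ?J ?s = residue R ?J r" using r by (intro someI) simp
  then have s: "?s \<in> carrier R" "residue R ?J ?s = residue R ?J r" by simp_all
  have uM: "u \<in> carrier M" using u by (simp add: ann_set_def)
  obtain t where t: "t \<in> carrier R" "?s = r \<oplus> t" "residue R ?J t = \<zero>\<^bsub>residue_module R ?J\<^esub>"
    using lm_eq_split[OF regular_module_module[OF R] residue_module_module[OF R J] rJ(1) _ _ s(2)] s(1) r by auto
  then have "t \<odot>\<^bsub>M\<^esub> u = \<zero>\<^bsub>M\<^esub>" using rJ(3) by (intro ann_ideal[OF M xs u]) simp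
  moreover have "?s \<odot>\<^bsub>M\<^esub> u = r \<odot>\<^bsub>M\<^esub> u \<oplus>\<^bsub>M\<^esub> t \<odot>\<^bsub>M\<^esub> u" unfolding t(2) using r t(1) uM by (simp add: M.smult_l_distr)
  moreover have "residue R ?J r \<in> carrier (residue_module R ?J)" using rJ(2) r by auto
  ultimately show ?thesis using r uM by (simp add: hom_of_ann_def)
qed

lemma hom_of_ann_linear:
  fixes R (structure)
    and M :: "('a, 'b) module"
  assumes R: "cring R" and M: "module R M" and xs: "set xs \<subseteq> carrier R"
  shows "linear_map R (M\<lparr>carrier := ann_set M xs\<rparr>) (Hom_module R (residue_module R (Idl (set xs))) M)
    (hom_of_ann R (Idl (set xs)) M)"
proof -
  interpret cring R by fact
  interpret M: module R M by fact
  let ?J = "Idl (set xs)" and ?A = "M\<lparr>carrier := ann_set M xs\<rparr>"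
  let ?N = "residue_module R ?J" and ?t = "hom_of_ann R (Idl (set xs)) M"
  have J: "ideal ?J R" by (rule genideal_ideal[OF xs])
  note rJ = residue_facts[OF R J] and val = hom_of_ann_residue[OF R M xs]
  have A: "submodule (ann_set M xs) R M" by (rule ann_submodule[OF M xs])
  have uM: "u \<in> carrier M" if "u \<in> ann_set M xs" for u using that by (simp add: ann_set_def)
  have eqI: "f = g" if "f \<in> extensional (carrier ?N)" "g \<in> extensional (carrier ?N)"
    and eq: "\<And>r. r \<in> carrier R \<Longrightarrow> f (residue R ?J r) = g (residue R ?J r)" for f g :: "'a set \<Rightarrow> 'b"
  proof (rule extensionalityI[OF that(1,2)])
    fix C assume "C \<in> carrier ?N"
    then show "f C = g C" unfolding rJ(2)[symmetric] using eq by auto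
  qed
  have ext: "?t u \<in> extensional (carrier ?N)" for u by (simp add: hom_of_ann_def)
  have cl: "residue R ?J r \<in> carrier ?N" if "r \<in> carrier R" for r using rJ(2) that by auto
  show ?thesis
  proof (rule linear_mapI)
    fix u assume "u \<in> carrier ?A"
    then have u: "u \<in> ann_set M xs" by simp
    have "linear_map R ?N M (?t u)"
    proof (rule linear_mapI)
      fix C assume "C \<in> carrier ?N"
      then obtain r where r: "r \<in> carrier R" "C = residue R ?J r" using rJ(2) by auto
      show "?t u C \<in> carrier M" using r val[OF u] uM[OF u] by simp
      { fix C' assume "C' \<in> carrier ?N"
        then obtain s where s: "s \<in> carrier R" "C' = residue R ?J s" using rJ(2) by auto
        have "C \<oplus>\<^bsub>?N\<^esub> C' = residue R ?J (r \<oplus> s)" using lm_add[OF rJ(1), of r s] r s by simp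
        then show "?t u (C \<oplus>\<^bsub>?N\<^esub> C') = ?t u C \<oplus>\<^bsub>M\<^esub> ?t u C'"
          using r s val[OF u] uM[OF u] by (simp add: M.smult_l_distr) }
      { fix a assume a: "a \<in> carrier R"
        have "a \<odot>\<^bsub>?N\<^esub> C = residue R ?J (a \<otimes> r)" using lm_smult[OF rJ(1), of a r] r a by simp
        then show "?t u (a \<odot>\<^bsub>?N\<^esub> C) = a \<odot>\<^bsub>M\<^esub> ?t u C"
          using r a val[OF u] uM[OF u] by (simp add: M.smult_assoc1) }
    qed
    then show "?t u \<in> carrier (Hom_module R ?N M)" using ext by (simp add: Hom_module_def)
    { fix v assume "v \<in> carrier ?A"
      then have v: "v \<in> ann_set M xs" by simp
      show "?t (u \<oplus>\<^bsub>?A\<^esub> v) = ?t u \<oplus>\<^bsub>Hom_module R ?N M\<^esub> ?t v"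
        using u v submodule_add[OF A u v] uM
        by (intro eqI) (simp_all add: ext Hom_module_def val cl M.smult_r_distr) }
    { fix a assume a: "a \<in> carrier R"
      have "r \<odot>\<^bsub>M\<^esub> (a \<odot>\<^bsub>M\<^esub> u) = a \<odot>\<^bsub>M\<^esub> (r \<odot>\<^bsub>M\<^esub> u)" if "r \<in> carrier R" for r
        using that a uM[OF u] by (simp add: m_comm[of r a] flip: M.smult_assoc1)
      then show "?t (a \<odot>\<^bsub>?A\<^esub> u) = a \<odot>\<^bsub>Hom_module R ?N M\<^esub> ?t u"
        using a u submodule_smult[OF A a u] by (intro eqI) (simp_all add: ext Hom_module_def val cl) }
  qed
qed

lemma hom_residue_one:
  fixes R (structure)
  assumes R: "cring R" and M: "module R M" and xs: "set xs \<subseteq> carrier R"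
    and f: "f \<in> carrier (Hom_module R (residue_module R (Idl (set xs))) M)"
  shows "f (residue R (Idl (set xs)) \<one>) \<in> ann_set M xs"
proof -
  interpret cring R by fact
  let ?J = "Idl (set xs)"
  have J: "ideal ?J R" by (rule genideal_ideal[OF xs])
  note rJ = residue_facts[OF R J]
  have fl: "linear_map R (residue_module R ?J) M f" using f by (simp add: Hom_module_def)
  have one: "residue R ?J \<one> \<in> carrier (residue_module R ?J)" using rJ(2) by auto
  have "x \<odot>\<^bsub>M\<^esub> f (residue R ?J \<one>) = \<zero>\<^bsub>M\<^esub>" if "x \<in> set xs" for x
  proof -
    have x: "x \<in> carrier R" "x \<in> ?J" using that xs genideal_self[OF xs] by auto
    have "x \<odot>\<^bsub>M\<^esub> f (residue R ?J \<one>) = f (x \<odot>\<^bsub>residue_module R ?J\<^esub> residue R ?J \<one>)"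
      using lm_smult[OF fl x(1) one] by simp
    also have "x \<odot>\<^bsub>residue_module R ?J\<^esub> residue R ?J \<one> = \<zero>\<^bsub>residue_module R ?J\<^esub>"
      using lm_smult[OF rJ(1) x(1), of \<one>] x rJ(3)[OF x(1)] by simp
    finally show ?thesis using lm_zero[OF residue_module_module[OF R J] M fl] by simp
  qed
  then show ?thesis using lm_closed[OF fl one] by (simp add: ann_set_def)
qed

text \<open>
  The complex of the elements killed by \<open>xs\<close> embeds into the complex that defines \<open>Ext(R/(xs), M)\<close>
  by \<open>hom_of_ann\<close>. Evaluation at the residue class of \<open>1\<close> shows that the embedding reflects
  coboundaries, so it is injective on cohomology.
\<close>

lemma (in resolution) ann_subquotient_in:
  fixes S :: "('a, 'm) module set" and n :: int
  assumes S: "serre_subcategory R S" and R: "cring R" and xs: "set xs \<subseteq> carrier R"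
    and ext: "belongs_to R (cohomology (\<lambda>k. Hom_module R (residue_module R (Idl\<^bsub>R\<^esub> (set xs))) (E k))
      (\<lambda>k. compose (carrier (residue_module R (Idl\<^bsub>R\<^esub> (set xs)))) (d k)) i) S"
  defines "A \<equiv> ann_complex xs (shifted n E d)"
  shows "subquotient_in R S (term_of A (n + int i)) (cocycles A (n + int i)) (cobounds A (n + int i))"
proof -
  interpret serre_class R S by (rule serre_class.intro[OF R S])
  interpret cring R by (rule R)
  let ?J = "Idl\<^bsub>R\<^esub> (set xs)"
  let ?N = "residue_module R ?J"
  let ?H = "\<lambda>k. Hom_module R ?N (E k)" and ?d = "\<lambda>k. compose (carrier ?N) (d k)"
  have J: "ideal ?J R" by (rule genideal_ideal[OF xs])
  note rJ = residue_facts[OF R J]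
  have N: "module R ?N" by (rule residue_module_module[OF R J])
  have H: "module R (?H k)" for k by (rule Hom_module_module[OF N E_module])
  have dH: "linear_map R (?H k) (?H (Suc k)) (?d k)" for k
    by (rule Hom_compose_linear[OF N E_module E_module d_lin])
  have A: "cochain_complex R A" unfolding A_def by (rule ann_complex_complex[OF complex xs])
  let ?Z = "a_kernel (?H i) (?H (Suc i)) (?d i)" and ?B = "coboundaries ?H ?d i"
  have Z: "submodule ?Z R (?H i)" unfolding a_kernel_eq by (rule lm_kernel[OF H H dH])
  have dd: "d (Suc k) (d k u) = \<zero>\<^bsub>E (Suc (Suc k))\<^esub>" if "u \<in> carrier (E k)" for k u
    using d_image[of k] that by auto
  have B: "submodule ?B R ((?H i)\<lparr>carrier := ?Z\<rparr>)"
  proof (rule submodule_of_submodule[OF H Z])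
    show "submodule ?B R (?H i)"
      by (cases i) (simp_all add: coboundaries_def submodule_zero_set[OF H] lm_image_carrier[OF H H dH])
    show "?B \<subseteq> ?Z"
    proof (cases i)
      case 0
      then show ?thesis using submodule_zero[OF Z] by (simp add: coboundaries_def)
    next
      case (Suc j)
      have "?d (Suc j) (?d j f) = \<zero>\<^bsub>?H (Suc (Suc j))\<^esub>" if f: "f \<in> carrier (?H j)" for f
      proof -
        have "f x \<in> carrier (E j)" if "x \<in> carrier ?N" for x
          using f that lm_closed by (force simp: Hom_module_def)
        then show ?thesis by (simp add: Hom_module_def compose_def fun_eq_iff restrict_def dd)
      qed
      then show ?thesis using Suc lm_closed[OF dH] by (auto simp: coboundaries_def a_kernel_eq)
    qed
  qed
  have Smod: "S \<subseteq> {M. module R M}" using S by (simp add: serre_subcategory_def)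
  have "subquotient_in R S ((?H i)\<lparr>carrier := ?Z\<rparr>) (carrier ((?H i)\<lparr>carrier := ?Z\<rparr>)) ?B"
    by (rule iffD1[OF belongs_to_quotient[OF Smod submodule_module[OF H Z] B] ext[unfolded cohomology_def]])
  then have sq: "subquotient_in R S (?H i) ?Z ?B" by (simp add: subquotient_in_restrict)
  let ?k = "n + int i"
  let ?t = "hom_of_ann R ?J (E i)"
  have tA: "term_of A ?k = (E i)\<lparr>carrier := ann_set (E i) xs\<rparr>" and dA: "diff_of A ?k u = d i u" for u
    by (simp_all add: A_def shifted_def)
  have tA1: "term_of A (?k + 1) = (E (Suc i))\<lparr>carrier := ann_set (E (Suc i)) xs\<rparr>"
    by (simp add: A_def shifted_def nat_add_distrib)
  have tl: "linear_map R (term_of A ?k) (?H i) ?t"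
    unfolding tA by (rule hom_of_ann_linear[OF R E_module xs])
  note val = hom_of_ann_residue[OF R E_module xs]
  have one: "\<one>\<^bsub>R\<^esub> \<in> carrier R" "residue R ?J \<one>\<^bsub>R\<^esub> \<in> carrier ?N" using rJ(2) by auto
  have annE: "u \<in> carrier (E k)" if "u \<in> ann_set (E k) xs" for u k using that by (simp add: ann_set_def)
  have tZ: "?t u \<in> ?Z" if u: "u \<in> cocycles A ?k" for u
  proof -
    have uA: "u \<in> ann_set (E i) xs" and du: "d i u = \<zero>\<^bsub>E (Suc i)\<^esub>"
      using u by (auto simp: cocycles_def tA tA1 dA)
    have "d i (?t u C) = \<zero>\<^bsub>E (Suc i)\<^esub>" if C: "C \<in> carrier ?N" for C
    proof -
      obtain r where r: "r \<in> carrier R" "C = residue R ?J r" using rJ(2) C by auto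
      interpret E1: module R "E (Suc i)" by (rule E_module)
      show ?thesis using r val[OF uA r(1)] lm_smult[OF d_lin r(1) annE[OF uA]] du by simp
    qed
    then have "?d i (?t u) = \<zero>\<^bsub>?H (Suc i)\<^esub>" by (simp add: Hom_module_def compose_def fun_eq_iff restrict_def)
    moreover have "?t u \<in> carrier (?H i)" by (rule lm_closed[OF tl]) (use uA in \<open>simp add: tA\<close>)
    ultimately show ?thesis by (simp add: a_kernel_eq)
  qed
  show ?thesis
  proof (rule subquotient_in_mono[OF sq cx_module[OF A] cocycles_submodule[OF A]])
    show "linear_map R ((term_of A ?k)\<lparr>carrier := cocycles A ?k\<rparr>) ((?H i)\<lparr>carrier := ?Z\<rparr>) ?t"
      by (rule lm_restrict2[OF tl]) (use tZ in \<open>auto dest: cocyclesD\<close>)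
    fix u assume u: "u \<in> cocycles A ?k"
    have uA: "u \<in> ann_set (E i) xs" using u by (auto simp: cocycles_def tA)
    interpret Ei: module R "E i" by (rule E_module)
    have u1: "?t u (residue R ?J \<one>\<^bsub>R\<^esub>) = u" using val[OF uA one(1)] annE[OF uA] by simp
    show "?t u \<in> ?B \<longleftrightarrow> u \<in> cobounds A ?k"
    proof (cases i)
      case 0
      have ann0: "ann_set ((E 0)\<lparr>carrier := {\<zero>\<^bsub>E 0\<^esub>}\<rparr>) xs = {\<zero>\<^bsub>E 0\<^esub>}"
        using submodule_zero[OF ann_submodule[OF E_module[of 0] xs]] by (auto simp: ann_set_def)
      have Bz: "cobounds A n = {\<zero>\<^bsub>E 0\<^esub>}"
        by (simp add: cobounds_def A_def shifted_def ann0)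
      have "?t u = \<zero>\<^bsub>?H 0\<^esub> \<longleftrightarrow> u = \<zero>\<^bsub>E 0\<^esub>"
      proof
        assume "?t u = \<zero>\<^bsub>?H 0\<^esub>"
        then have "?t u (residue R ?J \<one>\<^bsub>R\<^esub>) = \<zero>\<^bsub>E 0\<^esub>" using one(2) by (simp add: Hom_module_def)
        then show "u = \<zero>\<^bsub>E 0\<^esub>" using u1 by simp
      next
        assume "u = \<zero>\<^bsub>E 0\<^esub>"
        then show "?t u = \<zero>\<^bsub>?H 0\<^esub>" using lm_zero[OF cx_module[OF A] H tl] 0 tA by simp
      qed
      then show ?thesis using 0 Bz by (simp add: coboundaries_def)
    next
      case (Suc j)
      have k1: "?k - 1 = n + int j" using Suc by simp
      have cob: "u \<in> cobounds A ?k \<longleftrightarrow> (\<exists>v\<in>ann_set (E j) xs. u = d j v)"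
        unfolding cobounds_iff k1 by (simp add: A_def shifted_def)
      show ?thesis unfolding cob
      proof
        assume "?t u \<in> ?B"
        then obtain f where f: "f \<in> carrier (?H j)" "?t u = ?d j f" using Suc by (auto simp: coboundaries_def)
        have "u = d j (f (residue R ?J \<one>\<^bsub>R\<^esub>))" using u1 f(2) one(2) by (simp add: compose_def)
        then show "\<exists>v\<in>ann_set (E j) xs. u = d j v" using hom_residue_one[OF R E_module xs f(1)] by blast
      next
        assume "\<exists>v\<in>ann_set (E j) xs. u = d j v"
        then obtain v where v: "v \<in> ann_set (E j) xs" "u = d j v" by blast
        let ?s = "hom_of_ann R ?J (E j) v"
        have "?s \<in> carrier (?H j)" by (rule lm_closed[OF hom_of_ann_linear[OF R E_module xs]]) (use v in simp)
        moreover have "?t u = ?d j ?s"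
        proof (rule extensionalityI[of _ "carrier ?N"])
          show "?t u \<in> extensional (carrier ?N)" by (simp add: hom_of_ann_def)
          show "?d j ?s \<in> extensional (carrier ?N)" by (simp add: compose_def)
          fix C assume C: "C \<in> carrier ?N"
          then obtain r where r: "r \<in> carrier R" "C = residue R ?J r" using rJ(2) by auto
          show "?t u C = ?d j ?s C"
            using C r val[OF uA r(1)] val[OF v(1) r(1)] lm_smult[OF d_lin r(1) annE[OF v(1)]] v(2) Suc
            by (simp add: compose_def)
        qed
        ultimately show "?t u \<in> ?B" using Suc by (auto simp: coboundaries_def)
      qed
    qed
  qed
qed

lemma (in resolution) torsion_starts_at:
  assumes "ideal I R"
  shows "starts_at R (torsion_complex R I (shifted n E d)) n (\<lambda>k. torsion_submodule R I (E k)) d"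
proof
  show "cochain_complex R (torsion_complex R I (shifted n E d))" by (rule torsion_complex_complex[OF complex assms])
  show "carrier (term_of (torsion_complex R I (shifted n E d)) (n - 1)) =
      {\<zero>\<^bsub>term_of (torsion_complex R I (shifted n E d)) (n - 1)\<^esub>}"
    using submodule_zero[OF torsion_set_submodule[OF cx_module[OF complex, of n "n - 1"] assms]]
      shifted_bounded[of "n - 1" n]
    by (auto simp: torsion_set_def)
qed (simp_all add: shifted_def torsion_submodule_eq)

section \<open>Local cohomology of the residue ring of a regular sequence\<close>

theorem theorem1p1:
  fixes R :: "('a, 'r) ring_scheme"
    and xs :: "'a list"
    and I :: "'a set"
    and S :: "('a, 'm) module set"
  assumes "cring R" and "noetherian_ring R" and "\<one>\<^bsub>R\<^esub> \<noteq> \<zero>\<^bsub>R\<^esub>"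
    and universe: "infinite (UNIV :: 'm set)" "carrier R \<lesssim> (UNIV :: 'm set)"
    and "regular_sequence R xs"
    and "ideal I R"
    and "serre_subcategory R S"
    and "\<And>i j. belongs_to R
           (Ext R i (residue_module R (Idl\<^bsub>R\<^esub> (set xs)))
              (local_cohomology R I j (regular_module R) :: ('a, 'm set) module)
            :: ('a, ('a set \<Rightarrow> 'm) set) module) S"
  shows "\<And>j. belongs_to R
           (local_cohomology R I j (residue_module R (Idl\<^bsub>R\<^esub> (set xs)))
            :: ('a, 'm set) module) S"
proof -
  fix j0 :: nat
  note R = assms(1) and noeth = assms(2) and I = assms(7) and hyp = assms(9)
  interpret cring R by (rule R)
  obtain b :: "'m \<times> 'm \<Rightarrow> 'm" where b: "bij b" using pairing_exists[OF universe(1)] .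
  define pr where "pr u v = b (u, v)" for u v
  define p1 where "p1 w = fst (inv_into UNIV b w)" for w
  define p2 where "p2 w = snd (inv_into UNIV b w)" for w
  have Smod: "S \<subseteq> {M. module R M}" using assms(8) by (simp add: serre_subcategory_def)
  have "S \<noteq> {}" using hyp[of 0 0] by (auto simp: belongs_to_def)
  interpret serre_koszul R S pr p1 p2
    by unfold_locales (use R assms(8) b \<open>S \<noteq> {}\<close> in
        \<open>simp_all add: pr_def p1_def p2_def bij_is_inj bij_is_surj surj_f_inv_f\<close>)
  note resolves = injective_resolution_is_resolution[OF noeth universe]
  have xs: "set xs \<subseteq> carrier R" using assms(6) by (simp add: regular_sequence_def)
  define ys where "ys = rev xs"
  have ys: "set ys \<subseteq> carrier R" "set ys = set xs" using xs by (simp_all add: ys_def)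
  have reg: "regular_along R ys" unfolding ys_def by (rule regular_along_rev[OF R assms(6)])
  let ?J = "Idl\<^bsub>R\<^esub> (set xs)"
  let ?N = "residue_module R ?J" and ?A = "regular_module R"
  have J: "ideal ?J R" by (rule genideal_ideal[OF xs])
  have N: "module R ?N" by (rule residue_module_module[OF R J])
  have A: "module R ?A" by (rule regular_module_module[OF R])
  have cA: "carrier ?A \<lesssim> (UNIV :: 'm set)" using universe(2) by simp
  have cN: "carrier ?N \<lesssim> (UNIV :: 'm set)"
    unfolding residue_surj[OF R J, symmetric] by (rule lepoll_trans[OF image_lepoll universe(2)])
  obtain E :: "nat \<Rightarrow> ('a, 'm) module" and d where Ed: "injective_resolution R ?A = (E, d)" by fastforce
  obtain e where e: "is_injective_resolution R ?A e E d" using resolves[OF A cA Ed] .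
  obtain F :: "nat \<Rightarrow> ('a, 'm) module" and g where Fg: "injective_resolution R ?N = (F, g)" by fastforce
  obtain f where f: "is_injective_resolution R ?N f F g" using resolves[OF N cN Fg] .
  interpret rA: resolution R ?A e E d by (rule resolution.intro[OF A e])
  interpret rN: resolution R ?N f F g by (rule resolution.intro[OF N f])
  let ?C = "shifted 0 E d"
  let ?T = "torsion_complex R I ?C"
  have C: "cochain_complex R ?C" by (rule rA.complex)
  have T: "cochain_complex R ?T" by (rule torsion_complex_complex[OF C I])
  interpret T: starts_at R ?T 0 "\<lambda>k. torsion_submodule R I (E k)" d by (rule rA.torsion_starts_at[OF I])
  (* The hypothesis enters here: the Koszul cohomology of each local cohomology module H of R is
     Ext(R/(xs), H), so the Koszul complex of the torsion complex has its cohomology in S. *)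
  have "acyclic_mod R S (koszul R ys ?T)"
  proof (rule koszul_acyclic_mod[OF T ys(1), of 0])
    show "carrier (term_of ?T k) = {\<zero>\<^bsub>term_of ?T k\<^esub>}" if "k < 0" for k
      using submodule_zero[OF torsion_set_submodule[OF cx_module[OF C, of k] I]] rA.shifted_bounded[OF that]
      by (auto simp: torsion_set_def)
    fix k :: int assume "0 \<le> k"
    then obtain j where k: "k = 0 + int j" by (metis add_0 zero_le_imp_eq_int)
    let ?L = "local_cohomology R I j ?A :: ('a, 'm set) module"
    have L: "?L = cohomology (\<lambda>k. torsion_submodule R I (E k)) d j" by (simp add: local_cohomology_def Ed)
    obtain H :: "('a, 'm) module" and h p where mL: "module R ?L" and H: "module R H"
      and h: "linear_map R ?L H h" "bij_betw h (carrier ?L) (carrier H)"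
      and p: "linear_map R ((term_of ?T k)\<lparr>carrier := cocycles ?T k\<rparr>) H p" "p ` cocycles ?T k = carrier H"
        "\<And>z. z \<in> cocycles ?T k \<Longrightarrow> p z = \<zero>\<^bsub>H\<^esub> \<longleftrightarrow> z \<in> cobounds ?T k"
      using T.cohomology_in_universe[of j] unfolding L k by blast
    have "carrier ?L \<lesssim> carrier H" using h(2) by (auto simp: lepoll_def bij_betw_def)
    then have cL: "carrier ?L \<lesssim> (UNIV :: 'm set)" by (rule lepoll_trans[OF _ subset_imp_lepoll]) simp
    obtain G :: "nat \<Rightarrow> ('a, 'm) module" and q where Gq: "injective_resolution R ?L = (G, q)" by fastforce
    obtain l where l: "is_injective_resolution R ?L l G q" using resolves[OF mL cL Gq] .
    interpret rL: resolution R ?L l G q by (rule resolution.intro[OF mL l])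
    let ?G = "shifted k G q"
    have G: "cochain_complex R ?G" by (rule rL.complex)
    have ann: "cochain_complex R (ann_complex ys ?G)" by (rule ann_complex_complex[OF G ys(1)])
    have "acyclic_mod R S (ann_complex ys ?G)"
      unfolding acyclic_mod_def
    proof
      fix m
      show "subquotient_in R S (term_of (ann_complex ys ?G) m) (cocycles (ann_complex ys ?G) m) (cobounds (ann_complex ys ?G) m)"
      proof (cases "k \<le> m")
        case True
        then obtain i where m: "m = k + int i" using zle_iff_zadd by blast
        show ?thesis
          unfolding m
          by (rule rL.ann_subquotient_in[OF assms(8) R ys(1)])
            (use hyp[of i j] in \<open>simp add: Ext_def Gq ys(2)\<close>)
      next
        case False
        then have "cocycles (ann_complex ys ?G) m \<subseteq> {\<zero>\<^bsub>term_of (ann_complex ys ?G) m\<^esub>}"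
          using rL.shifted_bounded[of m k] by (auto simp: cocycles_def ann_set_def)
        then show ?thesis
          using submodule_zero[OF cobounds_submodule[OF ann, of m]]
          by (intro subquotient_in_trivial[OF S_nonempty cx_module[OF ann] cocycles_submodule[OF ann] cobounds_submodule[OF ann]]) auto
      qed
    qed
    moreover have "divisible_along ?G ys"
      by (rule injective_divisible_along[OF R universe(2) rL.shifted_injective ys(1) reg])
    then obtain r where "quasi_iso R (ann_complex ys ?G) (koszul R ys ?G) r"
      using ann_koszul_quasi_iso[OF G ys(1)] by blast
    ultimately have "acyclic_mod R S (koszul R ys ?G)"
      using acyclic_mod_quasi_iso[OF ann koszul_complex[OF G ys(1)]] by blast
    moreover have cH: "cochain_complex R (concentrated k H)" by (rule concentrated_complex[OF H])
    have "quasi_iso R (koszul R ys (concentrated k H)) (koszul R ys ?G)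
        (koszul_map ys (\<lambda>m u. if m = k then l (inv_into (carrier ?L) h u) else \<zero>\<^bsub>term_of ?G m\<^esub>))"
      by (rule koszul_map_quasi_iso[OF cH G concentrated_quasi_iso[OF H resolution_iso[OF l mL H h]] ys(1)])
    ultimately have "acyclic_mod R S (koszul R ys (concentrated k H))"
      using acyclic_mod_quasi_iso[OF koszul_complex[OF cH ys(1)] koszul_complex[OF G ys(1)]] by blast
    then show "\<exists>H p. module R H \<and> linear_map R ((term_of ?T k)\<lparr>carrier := cocycles ?T k\<rparr>) H p \<and>
       p ` cocycles ?T k = carrier H \<and> (\<forall>z\<in>cocycles ?T k. p z = \<zero>\<^bsub>H\<^esub> \<longleftrightarrow> z \<in> cobounds ?T k) \<and>
       acyclic_mod R S (koszul R ys (concentrated k H))"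
      using H p by blast
  qed
  then have acyclic: "acyclic_mod R S (torsion_complex R I (koszul R ys ?C))"
    unfolding koszul_torsion[OF R I] .
  (* The link with R/(xs): the Koszul complex of the resolution of R is quasi-isomorphic to
     the resolution of R/(xs), shifted by the length of xs. *)
  let ?K = "koszul R ys ?C" and ?n = "int (length ys)"
  let ?D = "shifted ?n F g"
  have K: "cochain_complex R ?K" by (rule koszul_complex[OF C ys(1)])
  have D: "cochain_complex R ?D" by (rule rN.complex)
  have Z: "ideal (Idl\<^bsub>R\<^esub> {}) R" by (rule genideal_ideal) simp
  have Zsub: "Idl\<^bsub>R\<^esub> {} \<subseteq> {\<zero>\<^bsub>R\<^esub>}" by (rule genideal_minimal[OF zeroideal]) simp
  have mZ: "module R (residue_module R (Idl\<^bsub>R\<^esub> {}))" by (rule residue_module_module[OF R Z])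
  have "inj_on (residue R (Idl\<^bsub>R\<^esub> {})) (carrier ?A)"
    by (rule lm_inj[OF A mZ residue_lin[OF R Z]]) (use residue_zero_iff[OF R Z] Zsub in auto)
  then have "bij_betw (residue R (Idl\<^bsub>R\<^esub> {})) (carrier ?A) (carrier (residue_module R (Idl\<^bsub>R\<^esub> {})))"
    using residue_surj[OF R Z] by (simp add: bij_betw_def)
  then have "concentrated_cohomology R ?C 0 (residue_module R (Idl\<^bsub>R\<^esub> {}))"
    by (rule rA.concentrated_shifted[OF mZ residue_lin[OF R Z]])
  then have "concentrated_cohomology R ?K ?n (residue_module R (Idl\<^bsub>R\<^esub> (set ys)))"
    by (rule concentrated_cohomology_koszul[OF R C _ ys(1) reg])
  then have "concentrated_cohomology R ?K ?n ?N" unfolding ys(2) .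
  then obtain \<phi> where \<phi>: "quasi_iso R ?K ?D \<phi>" using rN.quasi_iso_to_shifted[OF K] by blast
  have "quasi_iso R (torsion_complex R I ?K) (torsion_complex R I ?D) \<phi>"
  proof (rule torsion_quasi_iso[OF K D \<phi> _ rN.shifted_injective _ _ I, of 0])
    show "injective_module R (term_of ?K k)" for k by (rule koszul_injective[OF rA.shifted_injective])
    show "carrier (term_of ?K k) = {\<zero>\<^bsub>term_of ?K k\<^esub>}" if "k < 0" for k
      by (rule koszul_bounded[OF rA.shifted_bounded that])
    show "carrier (term_of ?D k) = {\<zero>\<^bsub>term_of ?D k\<^esub>}" if "k < 0" for k
      using that by (intro rN.shifted_bounded) simp
  qed
  then have "acyclic_mod R S (torsion_complex R I ?D)"
    using acyclic acyclic_mod_quasi_iso[OF torsion_complex_complex[OF K I] torsion_complex_complex[OF D I]] by blast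
  then have "belongs_to R (cohomology (\<lambda>k. torsion_submodule R I (F k)) g j0) S"
    unfolding acyclic_mod_def
    by (intro iffD2[OF starts_at.belongs_to_cohomology[OF rN.torsion_starts_at[OF I, of ?n] Smod]]) blast
  then show "belongs_to R (local_cohomology R I j0 ?N :: ('a, 'm set) module) S"
    by (simp add: local_cohomology_def Fg)
qed

end
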